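(* There exists an oracle $O \subseteq \{0,1\}^*$ such that all of the following hold: \begin{enumerate} \item There is no disjoint $\mathrm{NP}^O$-pair $(A,B)$ (i.e., $A,B\in\mathrm{NP}^O$ with $A\cap B=\emptyset$) that is $\le_m^{p,O}$-hard for $\mathrm{NP}^O\cap\mathrm{coNP}^O$; that is, for every disjoint $\mathrm{NP}^O$-pair $(A,B)$ there exists $L\in \mathrm{NP}^O\cap\mathrm{coNP}^O$ such that no function $f\in\mathrm{FP}^O$ satisfies both $f(L)\subseteq A$ and $f(\overline{L})\subseteq B$. \item Every $L\in\mathrm{NP}^O$ has a $\mathrm{P}^O$-optimal proof system. \item $\mathrm{UP}^O$ does not contain a $\le_m^{p,O}$-complete problem. \end{enumerate}
   Context: All sets are subsets of $\{0,1\}^*$ (identified with $\mathbb{N}$ via a standard bijection); $\overline{L}=\{0,1\}^*-L$. For an oracle $O$, $\mathrm{P}^O$, $\mathrm{NP}^O$, $\mathrm{FP}^O$ denote the classes of sets decidable in deterministic polynomial time with oracle $O$, sets accepted by nondeterministic polynomial-time oracle machines with oracle $O$, and functions computable in deterministic polynomial time with oracle $O$; $\mathrm{coNP}^O=\{\overline{L}: L\in\mathrm{NP}^O\}$; $\mathrm{UP}^O$ is the class of sets accepted by nondeterministic polynomial-time oracle machines with oracle $O$ that have at most one accepting path on every input. For sets $A,B$, $A\le_m^{p,O}B$ means there is $f\in\mathrm{FP}^O$ with $x\in A\Leftrightarrow f(x)\in B$ for all $x$; a set $C\in\mathrm{UP}^O$ is $\le_m^{p,O}$-complete for $\mathrm{UP}^O$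 if $A\le_m^{p,O}C$ for all $A\in\mathrm{UP}^O$. A proof system for a set $L$ (relative to $O$) is a function $g\in\mathrm{FP}^O$ with range exactly $L$. For proof systems $f,g\in\mathrm{FP}^O$, $f$ is $\mathrm{P}^O$-simulated by $g$ if there are $\pi\in\mathrm{FP}^O$ and a polynomial $p$ with $|\pi(x)|\le p(|x|)$ and $g(\pi(x))=f(x)$ for all $x$; $g$ is $\mathrm{P}^O$-optimal if every $f\in\mathrm{FP}^O$ with the same range as $g$ is $\mathrm{P}^O$-simulated by $g$.
   Formalization: Item 2 is stated for every nonempty L in NP^O: functions in FP^O are total, so the empty set, which lies in NP^O, is not the range of any of them and has no proof system. *)

theory Defs
  imports Main "HOL-Computational_Algebra.Polynomial"
begin

section \<open>Oracle Turing machines\<close>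

text \<open>
  Machines are nondeterministic multi-tape Turing machines over the alphabet
  0, 1, blank (\<^term>\<open>None\<close>) with two-way infinite tapes. Tape 0 holds the input, tape 1 the
  oracle query, tape 2 the output; a machine may have any number of further work tapes.
\<close>

type_synonym word = "bool list"
type_synonym symbol = "bool option"

text \<open>Cell contents and head position.\<close>
type_synonym tape = "(int \<Rightarrow> symbol) \<times> int"

datatype move = MoveLeft | MoveStay | MoveRight

type_synonym action = "symbol \<times> move"

type_synonym config = "nat \<times> tape list"

record otm =
  work_tapes :: nat
  rules :: "(nat \<times> symbol list \<times> nat \<times> action list) set"
  start_state :: nat
  accept_state :: nat
  query_state :: nat
  yes_state :: nat
  no_state :: nat

definition num_tapes :: "otm \<Rightarrow> nat" where
  "num_tapes M = 3 + work_tapes M"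

definition otm_wf :: "otm \<Rightarrow> bool" where
  "otm_wf M \<longleftrightarrow> finite (rules M) \<and>
     (\<forall>(q, rs, q', as) \<in> rules M. length rs = num_tapes M \<and> length as = num_tapes M)"

definition deterministic :: "otm \<Rightarrow> bool" where
  "deterministic M \<longleftrightarrow>
     (\<forall>q rs r r'. (q, rs, r) \<in> rules M \<longrightarrow> (q, rs, r') \<in> rules M \<longrightarrow> r = r')"

fun scanned :: "tape \<Rightarrow> symbol" where
  "scanned (c, h) = c h"

fun displacement :: "move \<Rightarrow> int" where
  "displacement MoveLeft = -1"
| "displacement MoveStay = 0"
| "displacement MoveRight = 1"

fun act :: "action \<Rightarrow> tape \<Rightarrow> tape" where
  "act (s, d) (c, h) = (c(h := s), h + displacement d)"

definition blank_tape :: tape where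
  "blank_tape = (\<lambda>_. None, 0)"

definition input_tape :: "word \<Rightarrow> tape" where
  "input_tape x = (\<lambda>i. if 0 \<le> i \<and> i < int (length x) then Some (x ! nat i) else None, 0)"

text \<open>
  The word written from cell 0 rightwards up to the first blank, irrespective of the head
  position. Only finitely many cells of a reachable tape are non-blank, so the minimum exists.
\<close>
definition tape_word :: "tape \<Rightarrow> word" where
  "tape_word t = map (\<lambda>i. the (fst t (int i))) [0..<(LEAST n. fst t (int n) = None)]"

definition initial :: "otm \<Rightarrow> word \<Rightarrow> config" where
  "initial M x = (start_state M, input_tape x # replicate (num_tapes M - 1) blank_tape)"

text \<open>
  In the query state the oracle answers in one step and leaves all tapes unchanged; rules
  for the query state are ignored.
\<close>
fun step :: "otm \<Rightarrow> word set \<Rightarrow> config \<Rightarrow> config \<Rightarrow> bool" where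
  "step M \<O> (q, ts) (q', ts') \<longleftrightarrow>
     (if q = query_state M
      then q' = (if tape_word (ts ! 1) \<in> \<O> then yes_state M else no_state M) \<and> ts' = ts
      else \<exists>as. (q, map scanned ts, q', as) \<in> rules M \<and> ts' = map2 act as ts)"

definition halted :: "otm \<Rightarrow> word set \<Rightarrow> config \<Rightarrow> bool" where
  "halted M \<O> c \<longleftrightarrow> (\<nexists>c'. step M \<O> c c')"

text \<open>
  Computation paths are sequences of configurations. Distinct rules applicable to a
  configuration lead to distinct successors (tapes are two-way infinite and head positions are
  absolute), so distinct sequences of nondeterministic choices are distinct paths.
\<close>
definition path :: "otm \<Rightarrow> word set \<Rightarrow> word \<Rightarrow> config list \<Rightarrow> bool" where
  "path M \<O> x cs \<longleftrightarrow> cs \<noteq> [] \<and> hd cs = initial M x \<and> successively (step M \<O>) cs"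

definition halting_path :: "otm \<Rightarrow> word set \<Rightarrow> word \<Rightarrow> config list \<Rightarrow> bool" where
  "halting_path M \<O> x cs \<longleftrightarrow> path M \<O> x cs \<and> halted M \<O> (last cs)"

definition accepting_path :: "otm \<Rightarrow> word set \<Rightarrow> word \<Rightarrow> config list \<Rightarrow> bool" where
  "accepting_path M \<O> x cs \<longleftrightarrow> halting_path M \<O> x cs \<and> fst (last cs) = accept_state M"

text \<open>
  The bound is on the number of steps of every path, accepting or not. A path may be a proper
  prefix of a computation, so in particular all computations halt.
\<close>
definition poly_time :: "otm \<Rightarrow> word set \<Rightarrow> bool" where
  "poly_time M \<O> \<longleftrightarrow>
     (\<exists>p :: nat poly. \<forall>x cs. path M \<O> x cs \<longrightarrow> length cs - 1 \<le> poly p (length x))"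

definition accepts :: "otm \<Rightarrow> word set \<Rightarrow> word \<Rightarrow> bool" where
  "accepts M \<O> x \<longleftrightarrow> (\<exists>cs. accepting_path M \<O> x cs)"

definition computes :: "otm \<Rightarrow> word set \<Rightarrow> (word \<Rightarrow> word) \<Rightarrow> bool" where
  "computes M \<O> f \<longleftrightarrow>
     (\<forall>x. \<exists>cs. halting_path M \<O> x cs \<and> tape_word (snd (last cs) ! 2) = f x)"


section \<open>Relativized complexity classes\<close>

definition NP :: "word set \<Rightarrow> word set set" where
  "NP \<O> = {L. \<exists>M. otm_wf M \<and> poly_time M \<O> \<and> L = {x. accepts M \<O> x}}"

definition coNP :: "word set \<Rightarrow> word set set" where
  "coNP \<O> = {- L | L. L \<in> NP \<O>}"

definition UP :: "word set \<Rightarrow> word set set" where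
  "UP \<O> = {L. \<exists>M. otm_wf M \<and> poly_time M \<O> \<and>
     (\<forall>x cs cs'. accepting_path M \<O> x cs \<longrightarrow> accepting_path M \<O> x cs' \<longrightarrow> cs = cs') \<and>
     L = {x. accepts M \<O> x}}"

definition FP :: "word set \<Rightarrow> (word \<Rightarrow> word) set" where
  "FP \<O> = {f. \<exists>M. otm_wf M \<and> deterministic M \<and> poly_time M \<O> \<and> computes M \<O> f}"


section \<open>Reductions, disjoint pairs and proof systems\<close>

definition many_one_reducible :: "word set \<Rightarrow> word set \<Rightarrow> word set \<Rightarrow> bool" where
  "many_one_reducible \<O> A B \<longleftrightarrow> (\<exists>f \<in> FP \<O>. \<forall>x. x \<in> A \<longleftrightarrow> f x \<in> B)"

definition UP_complete :: "word set \<Rightarrow> word set \<Rightarrow> bool" where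
  "UP_complete \<O> C \<longleftrightarrow> C \<in> UP \<O> \<and> (\<forall>A \<in> UP \<O>. many_one_reducible \<O> A C)"

definition disjoint_NP_pair :: "word set \<Rightarrow> word set \<Rightarrow> word set \<Rightarrow> bool" where
  "disjoint_NP_pair \<O> A B \<longleftrightarrow> A \<in> NP \<O> \<and> B \<in> NP \<O> \<and> A \<inter> B = {}"

definition pair_hard_for :: "word set \<Rightarrow> word set \<times> word set \<Rightarrow> word set set \<Rightarrow> bool" where
  "pair_hard_for \<O> = (\<lambda>(A, B) \<C>. \<forall>L \<in> \<C>. \<exists>f \<in> FP \<O>. f ` L \<subseteq> A \<and> f ` (- L) \<subseteq> B)"

definition proof_system_for :: "word set \<Rightarrow> (word \<Rightarrow> word) \<Rightarrow> word set \<Rightarrow> bool" where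
  "proof_system_for \<O> g L \<longleftrightarrow> g \<in> FP \<O> \<and> range g = L"

definition P_simulated :: "word set \<Rightarrow> (word \<Rightarrow> word) \<Rightarrow> (word \<Rightarrow> word) \<Rightarrow> bool" where
  "P_simulated \<O> f g \<longleftrightarrow>
     (\<exists>\<pi> \<in> FP \<O>. \<exists>p :: nat poly. \<forall>x. length (\<pi> x) \<le> poly p (length x) \<and> g (\<pi> x) = f x)"

definition P_optimal :: "word set \<Rightarrow> (word \<Rightarrow> word) \<Rightarrow> bool" where
  "P_optimal \<O> g \<longleftrightarrow> g \<in> FP \<O> \<and> (\<forall>f \<in> FP \<O>. range f = range g \<longrightarrow> P_simulated \<O> f g)"

text \<open>
  The functions in \<^term>\<open>FP \<O>\<close> are total, so no proof system for the empty set exists; claims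
  that every set of a class has a proof system are to be made for its nonempty members.
\<close>
definition has_P_optimal_proof_system :: "word set \<Rightarrow> word set \<Rightarrow> bool" where
  "has_P_optimal_proof_system \<O> L \<longleftrightarrow> (\<exists>g. proof_system_for \<O> g L \<and> P_optimal \<O> g)"

end

(*
  The oracle consists of generic words and of codewords. A codeword for a nondeterministic
  machine k certifies a proof u of some y accepted by k: either u lists the oracle answers of an
  accepting path, or u names a function i, an argument x with i(x) = y and enough padding. The
  optimal proof system for k looks u up in the oracle, and it simulates function i since the
  codewords of i can be found by padding x. The oracle is built by finite extensions. Whenever
  some extension lets i take a value outside the language of k, we choose it; otherwise all
  codewords justified by i are promised to enter the oracle, and they are sound from then on.

  Given a pair of NP machines, or a machine that is to be unambiguous, we choose an extension with
  a common input, or with two accepting paths, if there is one. Otherwise we attach to it a fresh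
  tag j and put exactly one generic word (j, b, y) on each length |y|; the inputs whose length has
  b = True form a language in UP and in coUP. If a function f reduced this language, each choice
  of (b, y) on a long length would yield an accepting path. Such a path depends, through the
  codewords it queries and the paths certifying these, on polynomially many words only, as a
  codeword is longer than everything it depends on taken together. So two choices exist whose
  paths ignore each other's word, and both paths survive in a common oracle. It violates the
  condition on j but is consistent with everything promised before j, a contradiction.
*)
theory Submission
  imports Defs "HOL-Library.Countable_Set"
begin

section \<open>Queries of computation paths\<close>

text \<open>Codewords certify facts about the very oracle that contains them, so merging two oracles
  must not falsify a certificate. Everything rests on one measure: the lengths, each plus one, of
  all words on which a codeword directly depends add up to at most the length of its proof. Hence an
  oracle can be defined by recursion on length, and following codewords to the codewords behind them
  reaches no more words than the weight of the initial queries; a bound on each single length would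
  not prevent an exponential number. A merge carries along, with every codeword that matters, the
  accepting path that makes it true. It thus stays true even if its function was promised only after
  the tag was assigned, and this permits the return to an older condition. For UP, two accepting
  paths may coincide, which violates nothing. A common path, however, depends only on words that
  matter to both branches, hence on neither distinguished word. It therefore survives under a third
  choice whose bit is False, where the value must be rejected.\<close>

definition queries :: "otm \<Rightarrow> config list \<Rightarrow> word set" where
  "queries M cs = {tape_word (ts ! 1) | ts. (query_state M, ts) \<in> set cs}"

lemma queries_append: "queries M (xs @ ys) = queries M xs \<union> queries M ys"
  by (auto simp: queries_def)

lemma step_cong:
  assumes "queries M [c] \<inter> \<O> = queries M [c] \<inter> \<O>'"
  shows "step M \<O> c c' \<longleftrightarrow> step M \<O>' c c'"
proof (cases c; cases c')
  fix q ts q' ts' assume c: "c = (q, ts)" "c' = (q', ts')"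
  show ?thesis
  proof (cases "q = query_state M")
    case True
    then have "tape_word (ts ! 1) \<in> queries M [c]" using c by (auto simp: queries_def)
    then have "tape_word (ts ! 1) \<in> \<O> \<longleftrightarrow> tape_word (ts ! 1) \<in> \<O>'" using assms by blast
    then show ?thesis using c True by simp
  qed (simp add: c)
qed

text \<open>A configuration in the query state always has a successor, and any other one steps
  independently of the oracle.\<close>

lemma halted_cong: "halted M \<O> c \<longleftrightarrow> halted M \<O>' c"
proof -
  have "halted M \<O>' c" if "halted M \<O> c" for \<O> \<O>'
  proof (cases c)
    case (Pair q ts)
    have "q \<noteq> query_state M"
      using that Pair by (auto simp: halted_def split: if_splits)
    then show ?thesis using that Pair by (auto simp: halted_def)
  qed
  then show ?thesis by blast
qed

lemma path_snoc:
  "path M \<O> x (cs @ [c]) \<longleftrightarrow>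
     (if cs = [] then c = initial M x else path M \<O> x cs \<and> step M \<O> (last cs) c)"
  by (auto simp: path_def successively_append_iff)

lemma path_singleton: "path M \<O> x [c] \<longleftrightarrow> c = initial M x"
  by (auto simp: path_def)

lemma path_append: "path M \<O> x (cs @ ds) \<Longrightarrow> cs \<noteq> [] \<Longrightarrow> path M \<O> x cs"
  by (auto simp: path_def successively_append_iff)

lemma path_take: "path M \<O> x cs \<Longrightarrow> 0 < n \<Longrightarrow> path M \<O> x (take n cs)"
  by (metis append_take_drop_id path_append path_def take_eq_Nil not_gr_zero)

lemma path_cong:
  assumes "path M \<O> x cs" "queries M cs \<inter> \<O> = queries M cs \<inter> \<O>'"
  shows "path M \<O>' x cs"
  using assms
proof (induction cs rule: rev_induct)
  case Nil
  then show ?case by (simp add: path_def)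
next
  case (snoc c cs)
  show ?case
  proof (cases "cs = []")
    case False
    then have cs: "cs = butlast cs @ [last cs]" by simp
    have "queries M [last cs] \<subseteq> queries M (cs @ [c])"
      using False by (subst cs, auto simp: queries_def)
    then have "step M \<O> (last cs) c \<longleftrightarrow> step M \<O>' (last cs) c"
      using snoc.prems by (intro step_cong) blast
    moreover have "queries M cs \<inter> \<O> = queries M cs \<inter> \<O>'"
      using snoc.prems by (auto simp: queries_append)
    ultimately show ?thesis using snoc False by (simp add: path_snoc)
  qed (use snoc.prems in \<open>simp add: path_singleton\<close>)
qed

lemma halting_path_cong:
  assumes "queries M cs \<inter> \<O> = queries M cs \<inter> \<O>'"
  shows "halting_path M \<O> x cs \<longleftrightarrow> halting_path M \<O>' x cs"
  unfolding halting_path_def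
  using path_cong[OF _ assms] path_cong[OF _ assms[symmetric]] halted_cong by blast

lemma accepting_path_cong:
  assumes "queries M cs \<inter> \<O> = queries M cs \<inter> \<O>'"
  shows "accepting_path M \<O> x cs \<longleftrightarrow> accepting_path M \<O>' x cs"
  unfolding accepting_path_def using halting_path_cong[OF assms] by simp

text \<open>After n steps a head is at most n cells to the right of its start, so the cells from n
  on are still blank. Only this side matters, since \<open>tape_word\<close> reads rightwards from
  cell 0. Tape 0 is left out because it starts with the input.\<close>

lemma path_tapes:
  assumes "otm_wf M" "path M \<O> x cs" "cs = ds @ [(q, ts)]"
  shows "length ts = num_tapes M \<and>
    (\<forall>k. 0 < k \<longrightarrow> k < num_tapes M \<longrightarrow>
       snd (ts ! k) \<le> int (length ds) \<and> (\<forall>i \<ge> int (length ds). fst (ts ! k) i = None))"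
  using assms(2,3)
proof (induction ds arbitrary: cs q ts rule: rev_induct)
  case Nil
  then have ts: "ts = input_tape x # replicate (num_tapes M - 1) blank_tape"
    by (simp add: path_def initial_def)
  have "ts ! k = blank_tape" if "0 < k" "k < num_tapes M" for k
    using that by (cases k) (auto simp: ts)
  then show ?case using ts by (simp add: blank_tape_def num_tapes_def)
next
  case (snoc d ds)
  obtain q0 ts0 where d: "d = (q0, ts0)" by (cases d)
  have p: "path M \<O> x (ds @ [(q0, ts0)])" and st: "step M \<O> (q0, ts0) (q, ts)"
    using snoc.prems path_snoc[of M \<O> x "ds @ [d]" "(q, ts)"] by (simp_all add: d)
  have IH1: "length ts0 = num_tapes M"
    and IH2: "\<And>k. 0 < k \<Longrightarrow> k < num_tapes M \<Longrightarrow>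
       snd (ts0 ! k) \<le> int (length ds) \<and> (\<forall>i \<ge> int (length ds). fst (ts0 ! k) i = None)"
    using snoc.IH[OF p refl] by auto
  show ?case
  proof (cases "q0 = query_state M")
    case True
    then have "ts = ts0" using st by simp
    moreover have "snd (ts0 ! k) \<le> int (length (ds @ [d])) \<and>
        (\<forall>i \<ge> int (length (ds @ [d])). fst (ts0 ! k) i = None)"
      if "0 < k" "k < num_tapes M" for k
      using IH2[OF that] by simp
    ultimately show ?thesis using IH1 by simp
  next
    case False
    then obtain as where r: "(q0, map scanned ts0, q, as) \<in> rules M" and ts: "ts = map2 act as ts0"
      using st by auto
    have las: "length as = num_tapes M" using assms(1) r by (auto simp: otm_wf_def)
    have *: "snd (ts ! k) \<le> int (length ds) + 1 \<and> (\<forall>i \<ge> int (length ds) + 1. fst (ts ! k) i = None)"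
      if k: "0 < k" "k < num_tapes M" for k
    proof -
      obtain s m where a: "as ! k = (s, m)" by (cases "as ! k")
      obtain c h where t: "ts0 ! k = (c, h)" by (cases "ts0 ! k")
      have "ts ! k = (c(h := s), h + displacement m)"
        using las IH1 k a t by (simp add: ts)
      moreover have "displacement m \<le> 1" by (cases m) auto
      moreover have "h \<le> int (length ds) \<and> (\<forall>i \<ge> int (length ds). c i = None)"
        using IH2[OF k] t by simp
      ultimately show ?thesis by auto
    qed
    then show ?thesis using las IH1 by (auto simp: ts add.commute)
  qed
qed

lemma tape_word_length_le:
  assumes "fst t (int n) = None"
  shows "length (tape_word t) \<le> n"
  using assms by (simp add: tape_word_def Least_le)

lemma path_tape_word_length:
  assumes "otm_wf M" "path M \<O> x cs" "(q, ts) \<in> set cs" "0 < k" "k < num_tapes M"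
  shows "length (tape_word (ts ! k)) < length cs"
proof -
  obtain ds es where cs: "cs = ds @ (q, ts) # es" using assms(3) by (meson split_list)
  then have "path M \<O> x (ds @ [(q, ts)])"
    using assms(2) path_append[of M \<O> x "ds @ [(q, ts)]" es] by simp
  from path_tapes[OF assms(1) this refl] assms(4,5)
  have "length (tape_word (ts ! k)) \<le> length ds"
    by (intro tape_word_length_le) auto
  then show ?thesis using cs by simp
qed

lemma finite_queries: "finite (queries M cs)"
proof -
  have "queries M cs \<subseteq> (\<lambda>(q, ts). tape_word (ts ! 1)) ` set cs"
    by (force simp: queries_def)
  then show ?thesis using finite_surj by blast
qed

lemma card_queries: "card (queries M cs) \<le> length cs"
proof -
  have "queries M cs \<subseteq> (\<lambda>(q, ts). tape_word (ts ! 1)) ` set cs"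
    by (force simp: queries_def)
  then have "card (queries M cs) \<le> card (set cs)"
    using surj_card_le by blast
  then show ?thesis using card_length le_trans by blast
qed

lemma query_length:
  assumes "otm_wf M" "path M \<O> x cs" "w \<in> queries M cs"
  shows "length w < length cs"
  using assms path_tape_word_length[of M \<O> x cs "query_state M" _ 1]
  by (auto simp: queries_def num_tapes_def)

text \<open>The summand 1 lets the weight dominate the number of words as well as each length, even
  if the empty word occurs.\<close>

abbreviation weight :: "word set \<Rightarrow> nat" where
  "weight Q \<equiv> (\<Sum>w\<in>Q. length w + 1)"

lemma weight_queries:
  assumes "otm_wf M" "path M \<O> x cs"
  shows "weight (queries M cs) \<le> length cs * length cs"
proof -
  have "weight (queries M cs) \<le> card (queries M cs) * length cs"
    using sum_bounded_above[of "queries M cs" "\<lambda>w. length w + 1" "length cs"] query_length[OF assms]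
    by (simp add: Suc_le_eq)
  also have "\<dots> \<le> length cs * length cs" using card_queries by (rule mult_right_mono) simp
  finally show ?thesis .
qed

section \<open>Deterministic machines\<close>

lemma step_deterministic:
  assumes "deterministic M" "step M \<O> c c1" "step M \<O> c c2"
  shows "c1 = c2"
proof (cases c; cases c1; cases c2)
  fix q ts q1 ts1 q2 ts2 assume c: "c = (q, ts)" "c1 = (q1, ts1)" "c2 = (q2, ts2)"
  show ?thesis
  proof (cases "q = query_state M")
    case False
    then obtain as1 as2 where "(q, map scanned ts, q1, as1) \<in> rules M" "ts1 = map2 act as1 ts"
      "(q, map scanned ts, q2, as2) \<in> rules M" "ts2 = map2 act as2 ts"
      using assms(2,3) c by auto
    then show ?thesis using assms(1) c unfolding deterministic_def by blast
  qed (use assms c in auto)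
qed

lemma path_deterministic:
  assumes "deterministic M" "path M \<O> x cs" "path M \<O> x ds" "length cs \<le> length ds"
  shows "cs = take (length cs) ds"
  using assms(2,4)
proof (induction cs rule: rev_induct)
  case Nil
  then show ?case by simp
next
  case (snoc c cs)
  show ?case
  proof (cases "cs = []")
    case True
    then show ?thesis using snoc.prems assms(3) by (cases ds) (auto simp: path_def)
  next
    case False
    then have cs: "cs = take (length cs) ds" and st: "step M \<O> (last cs) c"
      using snoc by (auto simp: path_snoc)
    have lt: "length cs < length ds" using snoc.prems by simp
    then have t: "take (length (cs @ [c])) ds = cs @ [ds ! length cs]"
      using cs by (simp add: take_Suc_conv_app_nth)
    moreover have "path M \<O> x (take (length (cs @ [c])) ds)"
      using assms(3) by (intro path_take) auto
    ultimately have "step M \<O> (last cs) (ds ! length cs)" using False by (simp add: path_snoc)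
    then show ?thesis using t st step_deterministic[OF assms(1)] by auto
  qed
qed

lemma halting_path_deterministic:
  assumes "deterministic M" "halting_path M \<O> x cs" "path M \<O> x ds"
  shows "length ds \<le> length cs"
proof (rule ccontr)
  assume less: "\<not> length ds \<le> length cs"
  have ne: "cs \<noteq> []" and p: "path M \<O> x cs" and h: "halted M \<O> (last cs)"
    using assms(2) by (auto simp: halting_path_def path_def)
  have cs: "cs = take (length cs) ds"
    using path_deterministic[OF assms(1) p assms(3)] less by simp
  have "path M \<O> x (take (Suc (length cs)) ds)" using assms(3) by (intro path_take) auto
  moreover have "take (Suc (length cs)) ds = cs @ [ds ! length cs]"
    using cs less by (simp add: take_Suc_conv_app_nth)
  ultimately have "step M \<O> (last cs) (ds ! length cs)" using ne by (simp add: path_snoc)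
  then show False using h unfolding halted_def by blast
qed

lemma halting_path_unique:
  assumes "deterministic M" "halting_path M \<O> x cs" "halting_path M \<O> x ds"
  shows "cs = ds"
proof -
  have "length cs = length ds"
    using halting_path_deterministic[OF assms(1)] assms(2,3)
    by (meson halting_path_def le_antisym)
  then show ?thesis
    using path_deterministic[OF assms(1), of \<O> x cs ds] assms(2,3) by (auto simp: halting_path_def)
qed

section \<open>Clocked machines\<close>

definition run_queries :: "otm \<Rightarrow> nat \<Rightarrow> word set \<Rightarrow> word \<Rightarrow> word set" where
  "run_queries M n \<O> x = \<Union>{queries M cs | cs. path M \<O> x cs \<and> length cs \<le> n}"

lemma path_run_queries_cong:
  assumes "run_queries M n \<O> x \<inter> run_queries M n \<O>' x \<inter> \<O> = run_queries M n \<O> x \<inter> run_queries M n \<O>' x \<inter> \<O>'"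
    and "path M \<O> x cs" "length cs \<le> n"
  shows "path M \<O>' x cs"
  using assms(2,3)
proof (induction cs rule: rev_induct)
  case Nil
  then show ?case by (simp add: path_def)
next
  case (snoc c cs)
  show ?case
  proof (cases "cs = []")
    case False
    then have p: "path M \<O> x cs" "path M \<O>' x cs" "length cs \<le> n" "step M \<O> (last cs) c"
      using snoc by (auto simp: path_snoc)
    then have "queries M cs \<subseteq> run_queries M n \<O> x \<inter> run_queries M n \<O>' x"
      unfolding run_queries_def by blast
    moreover have "queries M [last cs] \<subseteq> queries M cs"
      using False by (auto simp: queries_def)
    ultimately have "step M \<O>' (last cs) c"
      using step_cong[of M "last cs" \<O> \<O>' c] p(4) assms(1) by blast
    then show ?thesis using p False by (simp add: path_snoc)
  qed (use snoc.prems in \<open>simp add: path_singleton\<close>)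
qed

text \<open>
  Agreement on the words queried under both oracles suffices, since the first query on which
  two runs differ is asked by both.
\<close>
lemma run_queries_cong:
  assumes "run_queries M n \<O> x \<inter> run_queries M n \<O>' x \<inter> \<O> = run_queries M n \<O> x \<inter> run_queries M n \<O>' x \<inter> \<O>'"
  shows "run_queries M n \<O> x = run_queries M n \<O>' x"
    and "length cs \<le> n \<Longrightarrow> halting_path M \<O> x cs \<longleftrightarrow> halting_path M \<O>' x cs"
proof -
  have *: "path M \<O> x cs \<longleftrightarrow> path M \<O>' x cs" if "length cs \<le> n" for cs
    using path_run_queries_cong[OF assms _ that] path_run_queries_cong[of M n \<O>' x \<O> cs] assms that
    by (auto simp: Int_commute)
  then show "run_queries M n \<O> x = run_queries M n \<O>' x"
    unfolding run_queries_def by blast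
  show "length cs \<le> n \<Longrightarrow> halting_path M \<O> x cs \<longleftrightarrow> halting_path M \<O>' x cs"
    unfolding halting_path_def using * halted_cong by blast
qed

lemma queries_mono: "queries M (take n cs) \<subseteq> queries M cs"
  by (auto simp: queries_def dest: in_set_takeD)

text \<open>Among the paths within the clock there is a longest one, and by determinism all others
  are prefixes of it. So the queries of all paths are those of a single path and inherit its weight
  bound.\<close>

lemma run_queries_eq_queries:
  assumes "deterministic M" "0 < n"
  obtains cs where "path M \<O> x cs" "length cs \<le> n" "run_queries M n \<O> x = queries M cs"
proof -
  let ?P = "\<lambda>m. \<exists>cs. path M \<O> x cs \<and> length cs \<le> n \<and> length cs = m"
  have "path M \<O> x [initial M x]" by (simp add: path_def)
  then have "?P 1" using assms(2) by force
  then have "?P (Greatest ?P)"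
    by (rule GreatestI_nat[where b = n]) auto
  then obtain cs where cs: "path M \<O> x cs" "length cs \<le> n" "length cs = Greatest ?P" by auto
  have "queries M ds \<subseteq> queries M cs" if ds: "path M \<O> x ds" "length ds \<le> n" for ds
  proof -
    have "length ds \<le> length cs"
      unfolding cs(3) using ds by (intro Greatest_le_nat[where b = n]) auto
    then have "ds = take (length ds) cs" using path_deterministic[OF assms(1) ds(1) cs(1)] by blast
    then show ?thesis using queries_mono by metis
  qed
  then have "run_queries M n \<O> x = queries M cs" using cs unfolding run_queries_def by blast
  then show ?thesis using that cs by blast
qed

section \<open>Streaming machines\<close>

text \<open>
  Machines that read the input from left to right, only append to the query and output tapes,
  and remember one symbol on a work tape whose head does not move. State 0 queries and is left
  to state 1 (which also accepts) or 2. A transition consists of the new state, whether the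
  input head advances, the symbols to append, if any, and the new symbol to remember.
\<close>

type_synonym transitions =
  "nat \<Rightarrow> symbol \<Rightarrow> symbol \<Rightarrow> (nat \<times> bool \<times> symbol \<times> symbol \<times> symbol) set"

type_synonym stream_config = "nat \<times> nat \<times> word \<times> word \<times> symbol"

fun append_action :: "symbol \<Rightarrow> action" where
  "append_action None = (None, MoveStay)"
| "append_action (Some b) = (Some b, MoveRight)"

fun append_symbol :: "word \<Rightarrow> symbol \<Rightarrow> word" where
  "append_symbol w None = w"
| "append_symbol w (Some b) = w @ [b]"

definition word_tape :: "word \<Rightarrow> nat \<Rightarrow> tape" where
  "word_tape w h = (\<lambda>i. if 0 \<le> i \<and> i < int (length w) then Some (w ! nat i) else None, int h)"

definition flag_tape :: "symbol \<Rightarrow> tape" where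
  "flag_tape f = ((\<lambda>_. None)(0 := f), 0)"

definition symbol_at :: "word \<Rightarrow> nat \<Rightarrow> symbol" where
  "symbol_at x p = (if p < length x then Some (x ! p) else None)"

text \<open>The query and output heads always rest on the first blank cell, hence the two
  \<open>None\<close>; a word grows by writing that cell and moving right. The input symbol is
  written back unchanged.\<close>

definition stream_rules :: "transitions \<Rightarrow> (nat \<times> symbol list \<times> nat \<times> action list) set" where
  "stream_rules \<delta> = {(q, [a, None, None, f], q',
      [(a, if mv then MoveRight else MoveStay), append_action b, append_action c, (g, MoveStay)])
    | q a f q' mv b c g. (q', mv, b, c, g) \<in> \<delta> q a f}"

definition stream_machine :: "transitions \<Rightarrow> nat \<Rightarrow> otm" where
  "stream_machine \<delta> s = \<lparr>work_tapes = 1, rules = stream_rules \<delta>, start_state = s,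
     accept_state = 1, query_state = 0, yes_state = 1, no_state = 2\<rparr>"

fun stream_conf :: "word \<Rightarrow> stream_config \<Rightarrow> config" where
  "stream_conf x (q, p, w, z, f) =
     (q, [word_tape x p, word_tape w (length w), word_tape z (length z), flag_tape f])"

fun stream_step :: "transitions \<Rightarrow> word set \<Rightarrow> word \<Rightarrow> stream_config \<Rightarrow> stream_config \<Rightarrow> bool" where
  "stream_step \<delta> \<O> x (q, p, w, z, f) (q', p', w', z', f') \<longleftrightarrow>
     (if q = 0 then q' = (if w \<in> \<O> then 1 else 2) \<and> p' = p \<and> w' = w \<and> z' = z \<and> f' = f
      else \<exists>mv b c. (q', mv, b, c, f') \<in> \<delta> q (symbol_at x p) f \<and>
        p' = p + of_bool mv \<and> w' = append_symbol w b \<and> z' = append_symbol z c)"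

lemma num_tapes_stream [simp]: "num_tapes (stream_machine \<delta> s) = 4"
  by (simp add: num_tapes_def stream_machine_def)

lemma input_tape_eq: "input_tape x = word_tape x 0"
  by (simp add: input_tape_def word_tape_def)

lemma blank_tape_eq: "blank_tape = word_tape [] 0" "blank_tape = flag_tape None"
  by (auto simp: blank_tape_def word_tape_def flag_tape_def)

lemma scanned_word_tape: "scanned (word_tape w h) = symbol_at w h"
  by (simp add: word_tape_def symbol_at_def)

lemma scanned_flag_tape: "scanned (flag_tape f) = f"
  by (simp add: flag_tape_def)

lemma tape_word_word_tape: "tape_word (word_tape w h) = w"
proof -
  have "(LEAST n. fst (word_tape w h) (int n) = None) = length w"
    by (rule Least_equality) (auto simp: word_tape_def split: if_splits intro: leI)
  then show ?thesis
    by (auto simp: tape_word_def word_tape_def intro!: nth_equalityI)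
qed

lemma word_tape_inject: "word_tape w h = word_tape w' h' \<longleftrightarrow> w = w' \<and> h = h'"
  using tape_word_word_tape by (metis Pair_inject of_nat_eq_iff word_tape_def)

lemma flag_tape_inject: "flag_tape f = flag_tape f' \<longleftrightarrow> f = f'"
  using scanned_flag_tape by metis

lemma stream_conf_inject: "stream_conf x a = stream_conf x a' \<longleftrightarrow> a = a'"
  by (cases a; cases a') (auto simp: word_tape_inject flag_tape_inject)

lemma act_input:
  "act (symbol_at x p, if mv then MoveRight else MoveStay) (word_tape x p) = word_tape x (p + of_bool mv)"
  by (auto simp: word_tape_def symbol_at_def)

lemma act_append:
  "act (append_action b) (word_tape w (length w)) =
     word_tape (append_symbol w b) (length (append_symbol w b))"
  by (cases b) (auto simp: word_tape_def nth_append nat_eq_iff2 fun_eq_iff)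

lemma act_flag: "act (g, MoveStay) (flag_tape f) = flag_tape g"
  by (auto simp: flag_tape_def)

lemma symbol_at_length [simp]: "symbol_at w (length w) = None"
  by (simp add: symbol_at_def)

lemma initial_stream: "initial (stream_machine \<delta> s) x = stream_conf x (s, 0, [], [], None)"
proof -
  have "replicate 3 blank_tape = [word_tape [] 0, word_tape [] 0, flag_tape None]"
    by (simp add: numeral_3_eq_3 blank_tape_eq[symmetric])
  then show ?thesis
    by (simp add: initial_def input_tape_eq) (simp add: stream_machine_def)
qed

text \<open>Simulation in both directions, so that concrete machines can be analysed on words and
  positions instead of tapes.\<close>

lemma step_stream:
  "step (stream_machine \<delta> s) \<O> (stream_conf x a) c \<longleftrightarrow>
     (\<exists>a'. c = stream_conf x a' \<and> stream_step \<delta> \<O> x a a')"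
proof -
  obtain q p w z f where a: "a = (q, p, w, z, f)" by (metis prod_cases5)
  obtain q' ts where c: "c = (q', ts)" by (cases c)
  show ?thesis
  proof (cases "q = 0")
    case True
    then show ?thesis
      by (auto simp: a c stream_machine_def tape_word_word_tape word_tape_inject flag_tape_inject)
  next
    case False
    have "step (stream_machine \<delta> s) \<O> (stream_conf x a) c \<longleftrightarrow>
      (\<exists>mv b e g. (q', mv, b, e, g) \<in> \<delta> q (symbol_at x p) f \<and>
        ts = map2 act [(symbol_at x p, if mv then MoveRight else MoveStay), append_action b,
             append_action e, (g, MoveStay)]
          [word_tape x p, word_tape w (length w), word_tape z (length z), flag_tape f])"
    proof -
      have "step (stream_machine \<delta> s) \<O> (stream_conf x a) c \<longleftrightarrow>
        (\<exists>as. (q, [symbol_at x p, None, None, f], q', as) \<in> stream_rules \<delta> \<and>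
          ts = map2 act as [word_tape x p, word_tape w (length w), word_tape z (length z), flag_tape f])"
        using False by (simp add: a c stream_machine_def scanned_word_tape scanned_flag_tape)
      moreover have "(q, [symbol_at x p, None, None, f], q', as) \<in> stream_rules \<delta> \<longleftrightarrow>
        (\<exists>mv b e g. (q', mv, b, e, g) \<in> \<delta> q (symbol_at x p) f \<and>
          as = [(symbol_at x p, if mv then MoveRight else MoveStay), append_action b,
             append_action e, (g, MoveStay)])" for as
        unfolding stream_rules_def by blast
      ultimately show ?thesis by metis
    qed
    also have "\<dots> \<longleftrightarrow> (\<exists>mv b e g. (q', mv, b, e, g) \<in> \<delta> q (symbol_at x p) f \<and>
        c = stream_conf x (q', p + of_bool mv, append_symbol w b, append_symbol z e, g))"
      by (simp add: act_input act_append act_flag c)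
    also have "\<dots> \<longleftrightarrow> (\<exists>a'. c = stream_conf x a' \<and> stream_step \<delta> \<O> x a a')" (is "?L \<longleftrightarrow> ?R")
    proof
      assume ?L
      then obtain mv b e g where "(q', mv, b, e, g) \<in> \<delta> q (symbol_at x p) f"
        "c = stream_conf x (q', p + of_bool mv, append_symbol w b, append_symbol z e, g)"
        by blast
      moreover from this have
        "stream_step \<delta> \<O> x a (q', p + of_bool mv, append_symbol w b, append_symbol z e, g)"
        using False unfolding a stream_step.simps by (simp only: if_False) blast
      ultimately show ?R by blast
    next
      assume ?R
      then obtain q2 p2 w2 z2 f2 where "c = stream_conf x (q2, p2, w2, z2, f2)"
        "stream_step \<delta> \<O> x a (q2, p2, w2, z2, f2)"
        by (metis prod_cases5)
      moreover from this have "q2 = q'" by (simp add: c)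
      ultimately show ?L using False unfolding a stream_step.simps by (simp only: if_False) blast
    qed
    finally show ?thesis .
  qed
qed

section \<open>Well-formedness, determinism and running time of streaming machines\<close>

lemma stream_wf:
  assumes "\<And>q a f. N \<le> q \<Longrightarrow> \<delta> q a f = {}" "\<And>q a f. finite (\<delta> q a f)"
  shows "otm_wf (stream_machine \<delta> s)"
proof -
  let ?F = "\<lambda>(q, a, f, q', mv, b, c, g). (q, [a, None, None, f], q',
    [(a, if mv then MoveRight else MoveStay), append_action b, append_action c, (g, MoveStay)])"
  have "stream_rules \<delta> \<subseteq> ?F ` (SIGMA q:{..<N}. SIGMA a:UNIV. SIGMA f:UNIV. \<delta> q a f)"
  proof
    fix r assume "r \<in> stream_rules \<delta>"
    then obtain q a f q' mv b c g where r: "r = ?F (q, a, f, q', mv, b, c, g)"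
      and *: "(q', mv, b, c, g) \<in> \<delta> q a f"
      unfolding stream_rules_def by auto
    then have "q < N" using assms(1) by (metis empty_iff not_le)
    then show "r \<in> ?F ` (SIGMA q:{..<N}. SIGMA a:UNIV. SIGMA f:UNIV. \<delta> q a f)"
      unfolding r using * by (intro imageI) auto
  qed
  moreover have "finite (SIGMA q:{..<N}. SIGMA a:(UNIV :: symbol set). SIGMA f:UNIV. \<delta> q a f)"
    using assms(2) by (intro finite_SigmaI) auto
  ultimately have "finite (stream_rules \<delta>)" by (meson finite_surj)
  then show ?thesis
    by (auto simp: otm_wf_def stream_rules_def stream_machine_def num_tapes_def)
qed

lemma stream_deterministic:
  assumes "\<And>q a f r r'. r \<in> \<delta> q a f \<Longrightarrow> r' \<in> \<delta> q a f \<Longrightarrow> r = r'"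
  shows "deterministic (stream_machine \<delta> s)"
  unfolding deterministic_def
proof (intro allI impI)
  fix q rs r r'
  assume r: "(q, rs, r) \<in> rules (stream_machine \<delta> s)" and r': "(q, rs, r') \<in> rules (stream_machine \<delta> s)"
  obtain a f q1 mv1 b1 c1 g1 where 1: "rs = [a, None, None, f]" "(q1, mv1, b1, c1, g1) \<in> \<delta> q a f"
    "r = (q1, [(a, if mv1 then MoveRight else MoveStay), append_action b1, append_action c1, (g1, MoveStay)])"
    using r unfolding stream_machine_def stream_rules_def by auto
  obtain a' f' q2 mv2 b2 c2 g2 where 2: "rs = [a', None, None, f']" "(q2, mv2, b2, c2, g2) \<in> \<delta> q a' f'"
    "r' = (q2, [(a', if mv2 then MoveRight else MoveStay), append_action b2, append_action c2, (g2, MoveStay)])"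
    using r' unfolding stream_machine_def stream_rules_def by auto
  show "r = r'" using 1 2 assms by fastforce
qed

text \<open>The rank drops with every step, so the rank already spent pays for the steps made; the
  initial rank bounds the running time.\<close>

lemma stream_path_last:
  assumes "path (stream_machine \<delta> s) \<O> x cs"
    and "I (s, 0, [], [], None)"
    and "\<And>a a'. I a \<Longrightarrow> stream_step \<delta> \<O> x a a' \<Longrightarrow> I a' \<and> \<mu> a' < (\<mu> a :: nat)"
  shows "\<exists>a. last cs = stream_conf x a \<and> I a \<and> \<mu> a + (length cs - 1) \<le> \<mu> (s, 0, [], [], None)"
  using assms(1)
proof (induction cs rule: rev_induct)
  case Nil
  then show ?case by (simp add: path_def)
next
  case (snoc c cs)
  show ?case
  proof (cases "cs = []")
    case True
    then show ?thesis using snoc.prems assms(2)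
      by (intro exI[of _ "(s, 0, [], [], None)"]) (simp add: path_singleton initial_stream)
  next
    case False
    then have "path (stream_machine \<delta> s) \<O> x cs" and st: "step (stream_machine \<delta> s) \<O> (last cs) c"
      using snoc.prems by (auto simp: path_snoc)
    then obtain a where a: "last cs = stream_conf x a" "I a"
      "\<mu> a + (length cs - 1) \<le> \<mu> (s, 0, [], [], None)"
      using snoc.IH by blast
    then obtain a' where a': "c = stream_conf x a'" "stream_step \<delta> \<O> x a a'"
      using st step_stream by metis
    then have "I a'" "\<mu> a' < \<mu> a" using assms(3) a by auto
    then show ?thesis using a a' False by (intro exI[of _ a']) (cases cs; auto)
  qed
qed

lemma stream_poly_time:
  assumes "\<And>x. I x (s, 0, [], [], None)"
    and "\<And>x a a'. I x a \<Longrightarrow> stream_step \<delta> \<O> x a a' \<Longrightarrow> I x a' \<and> \<mu> x a' < (\<mu> x a :: nat)"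
    and "\<And>x. \<mu> x (s, 0, [], [], None) \<le> poly p (length x)"
  shows "poly_time (stream_machine \<delta> s) \<O>"
  unfolding poly_time_def
proof (intro exI allI impI)
  fix x cs assume "path (stream_machine \<delta> s) \<O> x cs"
  from stream_path_last[where I = "I x" and \<mu> = "\<mu> x", OF this assms(1,2)] assms(3)[of x]
  show "length cs - 1 \<le> poly p (length x)" by force
qed

text \<open>The time bound yields a longest path, and its last configuration cannot have a
  successor.\<close>

lemma poly_time_halting_path:
  assumes "poly_time M \<O>"
  obtains cs where "halting_path M \<O> x cs"
proof -
  obtain p where p: "\<And>cs. path M \<O> x cs \<Longrightarrow> length cs - 1 \<le> poly p (length x)"
    using assms unfolding poly_time_def by blast
  let ?P = "\<lambda>n. \<exists>cs. path M \<O> x cs \<and> length cs = n"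
  have b: "n \<le> poly p (length x) + 1" if "?P n" for n
    using that p by fastforce
  have "?P 1" by (rule exI[of _ "[initial M x]"]) (simp add: path_singleton)
  then have "?P (Greatest ?P)" using b by (rule GreatestI_nat[where b = "poly p (length x) + 1"])
  then obtain cs where cs: "path M \<O> x cs" "length cs = Greatest ?P" by blast
  have "halted M \<O> (last cs)"
    unfolding halted_def
  proof
    assume "\<exists>c'. step M \<O> (last cs) c'"
    then obtain c where "step M \<O> (last cs) c" by blast
    moreover have "cs \<noteq> []" using cs by (simp add: path_def)
    ultimately have "path M \<O> x (cs @ [c])" using cs by (simp add: path_snoc)
    then have "?P (Suc (Greatest ?P))" using cs(2) by force
    then show False using Greatest_le_nat[of ?P, OF _ b] by force
  qed
  then show ?thesis using that cs by (auto simp: halting_path_def)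
qed

lemma stream_FP:
  assumes "\<And>q a f. N \<le> q \<Longrightarrow> \<delta> q a f = {}"
    and "\<And>q a f r r'. r \<in> \<delta> q a f \<Longrightarrow> r' \<in> \<delta> q a f \<Longrightarrow> r = r'"
    and I: "\<And>x. I x (s, 0, [], [], None)"
    and step: "\<And>x a a'. I x a \<Longrightarrow> stream_step \<delta> \<O> x a a' \<Longrightarrow> I x a' \<and> \<mu> x a' < (\<mu> x a :: nat)"
    and "\<And>x. \<mu> x (s, 0, [], [], None) \<le> poly p (length x)"
    and out: "\<And>x q p w z f. I x (q, p, w, z, f) \<Longrightarrow>
      (\<And>a'. \<not> stream_step \<delta> \<O> x (q, p, w, z, f) a') \<Longrightarrow> z = g x"
  shows "g \<in> FP \<O>"
proof -
  have "finite (\<delta> q a f)" for q a f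
  proof (cases "\<delta> q a f = {}")
    case False
    then obtain r where "r \<in> \<delta> q a f" by blast
    then have "\<delta> q a f \<subseteq> {r}" using assms(2) by blast
    then show ?thesis using finite_subset by blast
  qed simp
  then have wf: "otm_wf (stream_machine \<delta> s)" using assms(1) by (intro stream_wf)
  have det: "deterministic (stream_machine \<delta> s)" using assms(2) by (rule stream_deterministic)
  have pt: "poly_time (stream_machine \<delta> s) \<O>"
    by (rule stream_poly_time[where I = I and \<mu> = \<mu>]) (use assms in auto)
  have "computes (stream_machine \<delta> s) \<O> g"
    unfolding computes_def
  proof
    fix x
    obtain cs where cs: "halting_path (stream_machine \<delta> s) \<O> x cs"
      using poly_time_halting_path[OF pt] .
    then obtain q p w z f where a: "last cs = stream_conf x (q, p, w, z, f)" "I x (q, p, w, z, f)"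
      using stream_path_last[where I = "I x" and \<mu> = "\<mu> x", OF _ I step]
      unfolding halting_path_def by (metis prod_cases5)
    have "z = g x"
    proof (rule out[OF a(2)])
      show "\<not> stream_step \<delta> \<O> x (q, p, w, z, f) a'" for a'
        using cs a(1) step_stream unfolding halting_path_def halted_def by metis
    qed
    then show "\<exists>cs. halting_path (stream_machine \<delta> s) \<O> x cs \<and> tape_word (snd (last cs) ! 2) = g x"
      using cs a(1) by (intro exI[of _ cs]) (auto simp: tape_word_word_tape)
  qed
  then show ?thesis using wf det pt unfolding FP_def by blast
qed

lemma stream_reach_path:
  assumes "(stream_step \<delta> \<O> x)\<^sup>*\<^sup>* (s, 0, [], [], None) a"
  shows "\<exists>cs. path (stream_machine \<delta> s) \<O> x cs \<and> last cs = stream_conf x a"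
  using assms
proof (induction rule: rtranclp_induct)
  case base
  show ?case
    by (rule exI[of _ "[initial (stream_machine \<delta> s) x]"]) (simp add: path_singleton initial_stream)
next
  case (step b c)
  then obtain cs where cs: "path (stream_machine \<delta> s) \<O> x cs" "last cs = stream_conf x b" by blast
  then have "cs \<noteq> []" by (simp add: path_def)
  then have "path (stream_machine \<delta> s) \<O> x (cs @ [stream_conf x c])"
    using cs step.hyps(2) step_stream by (metis path_snoc)
  then show ?case by (metis last_snoc)
qed

text \<open>If predecessors are determined within the invariant, a path can be traced back from its
  last configuration. The rank keeps the initial configuration from recurring, so both traces end at
  the same time.\<close>

lemma stream_path_unique:
  assumes I: "I (s, 0, [], [], None)"
    and step: "\<And>a a'. I a \<Longrightarrow> stream_step \<delta> \<O> x a a' \<Longrightarrow> I a' \<and> \<mu> a' < (\<mu> a :: nat)"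
    and backward: "\<And>a b c. I a \<Longrightarrow> I b \<Longrightarrow> stream_step \<delta> \<O> x a c \<Longrightarrow> stream_step \<delta> \<O> x b c \<Longrightarrow> a = b"
    and cs: "path (stream_machine \<delta> s) \<O> x cs" "path (stream_machine \<delta> s) \<O> x cs'" "last cs = last cs'"
  shows "cs = cs'"
  using cs
proof (induction cs arbitrary: cs' rule: rev_induct)
  case Nil
  then show ?case by (simp add: path_def)
next
  case (snoc c cs)
  note last = stream_path_last[where I = I and \<mu> = \<mu>, OF _ I step]
  obtain c' ds where cs': "cs' = ds @ [c']" using snoc.prems(2) by (metis path_def rev_exhaust)
  have c': "c' = c" using snoc.prems cs' by simp
  have init: False if es: "path (stream_machine \<delta> s) \<O> x (es @ [initial (stream_machine \<delta> s) x])" "es \<noteq> []" for es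
  proof -
    obtain a where a: "initial (stream_machine \<delta> s) x = stream_conf x a"
      "\<mu> a + length es \<le> \<mu> (s, 0, [], [], None)"
      using last[OF es(1)] by auto
    then have "a = (s, 0, [], [], None)" by (metis initial_stream stream_conf_inject)
    then show False using a es(2) by simp
  qed
  show ?case
  proof (cases "cs = [] \<or> ds = []")
    case True
    then show ?thesis using snoc.prems cs' c' init path_singleton by (metis append_Nil)
  next
    case False
    then have p: "path (stream_machine \<delta> s) \<O> x cs" "step (stream_machine \<delta> s) \<O> (last cs) c"
      "path (stream_machine \<delta> s) \<O> x ds" "step (stream_machine \<delta> s) \<O> (last ds) c"
      using snoc.prems cs' c' by (auto simp: path_snoc)
    obtain a b where ab: "last cs = stream_conf x a" "I a" "last ds = stream_conf x b" "I b"
      using last[OF p(1)] last[OF p(3)] by blast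
    obtain e where "c = stream_conf x e" "stream_step \<delta> \<O> x a e" "stream_step \<delta> \<O> x b e"
      using p(2,4) ab step_stream by (metis stream_conf_inject)
    then have "last cs = last ds" using backward ab by metis
    then show ?thesis using snoc.IH[OF p(1,3)] cs' c' by simp
  qed
qed

section \<open>Enumerating clocked machines\<close>

instance move :: countable
  by countable_datatype

lemma countable_wf_machines: "countable {M. otm_wf M}"
proof -
  let ?f = "\<lambda>(w, r, s, a, q, y, n). \<lparr>work_tapes = w, rules = r, start_state = s, accept_state = a,
    query_state = q, yes_state = y, no_state = n\<rparr>"
  let ?R = "{r :: (nat \<times> symbol list \<times> nat \<times> action list) set. finite r}"
  have "{M. otm_wf M} \<subseteq> ?f ` (UNIV \<times> ?R \<times> UNIV)"
  proof
    fix M :: otm assume M: "M \<in> {M. otm_wf M}"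
    have "M = ?f (work_tapes M, rules M, start_state M, accept_state M, query_state M, yes_state M, no_state M)"
      by simp
    then show "M \<in> ?f ` (UNIV \<times> ?R \<times> UNIV)"
      by (rule image_eqI) (use M in \<open>simp add: otm_wf_def\<close>)
  qed
  moreover have "countable ((UNIV :: nat set) \<times> ?R \<times> (UNIV :: (nat \<times> nat \<times> nat \<times> nat \<times> nat) set))"
    by (intro countable_SIGMA countable_Collect_finite countableI_type)
  ultimately show ?thesis by (meson countable_image countable_subset)
qed

text \<open>Shows that the sets of machines below are nonempty, as \<open>from_nat_into\<close>
  requires.\<close>

definition trivial_machine :: otm where
  "trivial_machine = \<lparr>work_tapes = 0, rules = {}, start_state = 0, accept_state = 1,
     query_state = 1, yes_state = 0, no_state = 0\<rparr>"

lemma trivial_machine: "otm_wf trivial_machine" "deterministic trivial_machine"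
  by (auto simp: trivial_machine_def otm_wf_def deterministic_def)

text \<open>Whether a machine runs in polynomial time depends on the oracle, which is still to be
  built. Each index therefore carries a clock of its own, given by an exponent, and paths beyond the
  clock are disregarded.\<close>

definition nmachines :: "(otm \<times> nat) set" where
  "nmachines = {M. otm_wf M} \<times> UNIV"

definition nmach :: "nat \<Rightarrow> otm" where
  "nmach k = fst (from_nat_into nmachines k)"

definition nclock :: "nat \<Rightarrow> nat \<Rightarrow> nat" where
  "nclock k n = (n + 2) ^ snd (from_nat_into nmachines k)"

definition fmachines :: "(otm \<times> nat) set" where
  "fmachines = {M. otm_wf M \<and> deterministic M} \<times> UNIV"

definition fmach :: "nat \<Rightarrow> otm" where
  "fmach i = fst (from_nat_into fmachines i)"

definition fclock :: "nat \<Rightarrow> nat \<Rightarrow> nat" where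
  "fclock i n = (n + 2) ^ snd (from_nat_into fmachines i)"

lemma from_nat_into_nmachines: "from_nat_into nmachines k \<in> nmachines"
  using trivial_machine by (intro from_nat_into) (auto simp: nmachines_def)

lemma from_nat_into_fmachines: "from_nat_into fmachines k \<in> fmachines"
  using trivial_machine by (intro from_nat_into) (auto simp: fmachines_def)

lemma nmach_wf: "otm_wf (nmach k)"
  using from_nat_into_nmachines[of k] by (auto simp: nmachines_def nmach_def)

lemma fmach_wf: "otm_wf (fmach k)" and fmach_deterministic: "deterministic (fmach k)"
  using from_nat_into_fmachines[of k] by (auto simp: fmachines_def fmach_def)

lemma ex_nmach:
  assumes "otm_wf M"
  obtains k where "nmach k = M" "nclock k = (\<lambda>n. (n + 2) ^ c)"
proof -
  have "countable nmachines" unfolding nmachines_def by (intro countable_SIGMA countable_wf_machines) simp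
  moreover have "(M, c) \<in> nmachines" using assms by (simp add: nmachines_def)
  ultimately obtain k where "from_nat_into nmachines k = (M, c)"
    by (meson from_nat_into_surj)
  then show ?thesis by (intro that[of k]) (simp_all add: nmach_def nclock_def fun_eq_iff)
qed

lemma ex_fmach:
  assumes "otm_wf M" "deterministic M"
  obtains i where "fmach i = M" "fclock i = (\<lambda>n. (n + 2) ^ c)"
proof -
  have "countable {M. otm_wf M \<and> deterministic M}"
    by (rule countable_subset[OF _ countable_wf_machines]) auto
  then have "countable fmachines" unfolding fmachines_def by (intro countable_SIGMA) simp_all
  moreover have "(M, c) \<in> fmachines" using assms by (simp add: fmachines_def)
  ultimately obtain k where "from_nat_into fmachines k = (M, c)"
    by (meson from_nat_into_surj)
  then show ?thesis by (intro that[of k]) (simp_all add: fmach_def fclock_def fun_eq_iff)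
qed

text \<open>The base \<open>n + 2\<close> is never below 2, so powers of it exceed any constant even
  at n = 0. The exponent \<open>a + c + 1\<close> absorbs the new coefficient through
  \<open>a < 2 ^ a\<close> and leaves one factor for n.\<close>

lemma poly_le_power: "\<exists>c. \<forall>n. poly p n \<le> (n + 2) ^ c" for p :: "nat poly"
proof (induction p)
  case 0
  then show ?case by simp
next
  case (pCons a p)
  then obtain c where c: "\<And>n. poly p n \<le> (n + 2) ^ c" by blast
  have "poly (pCons a p) n \<le> (n + 2) ^ (a + c + 1)" for n
  proof -
    have "a \<le> (n + 2) ^ a"
      using less_exp[of a] power_mono[of 2 "n + 2" a] by linarith
    also have "\<dots> \<le> (n + 2) ^ (a + c)" by (intro power_increasing) auto
    finally have 1: "a \<le> (n + 2) ^ (a + c)" .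
    have "poly p n \<le> (n + 2) ^ (a + c)"
      by (rule order_trans[OF c power_increasing]) auto
    then have "a + n * poly p n \<le> (n + 2) ^ (a + c) + n * (n + 2) ^ (a + c)"
      using 1 by (intro add_mono mult_left_mono) auto
    then show ?thesis by (simp add: algebra_simps)
  qed
  then show ?case by blast
qed

text \<open>A path of n steps has n + 1 configurations, hence the 1 added to the clock.\<close>

definition acc :: "nat \<Rightarrow> word set \<Rightarrow> word \<Rightarrow> config list \<Rightarrow> bool" where
  "acc k \<O> y cs \<longleftrightarrow> accepting_path (nmach k) \<O> y cs \<and> length cs \<le> nclock k (length y) + 1"

definition nlang :: "nat \<Rightarrow> word set \<Rightarrow> word set" where
  "nlang k \<O> = {y. \<exists>cs. acc k \<O> y cs}"

definition fval :: "nat \<Rightarrow> word set \<Rightarrow> word \<Rightarrow> word \<Rightarrow> bool" where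
  "fval i \<O> x y \<longleftrightarrow> (\<exists>cs. halting_path (fmach i) \<O> x cs \<and> length cs \<le> fclock i (length x) + 1 \<and>
     tape_word (snd (last cs) ! 2) = y)"

definition fqueries :: "nat \<Rightarrow> word set \<Rightarrow> word \<Rightarrow> word set" where
  "fqueries i \<O> x = run_queries (fmach i) (fclock i (length x) + 1) \<O> x"

lemma acc_cong:
  "queries (nmach k) cs \<inter> \<O> = queries (nmach k) cs \<inter> \<O>' \<Longrightarrow> acc k \<O> y cs \<longleftrightarrow> acc k \<O>' y cs"
  unfolding acc_def using accepting_path_cong by blast

lemma acc_weight:
  assumes "acc k \<O> y cs"
  shows "weight (queries (nmach k) cs) \<le> (nclock k (length y) + 1)\<^sup>2"
proof -
  have "path (nmach k) \<O> y cs" and l: "length cs \<le> nclock k (length y) + 1"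
    using assms by (auto simp: acc_def accepting_path_def halting_path_def)
  then have "weight (queries (nmach k) cs) \<le> length cs * length cs"
    using weight_queries nmach_wf by blast
  then show ?thesis using mult_le_mono[OF l l] by (simp add: power2_eq_square)
qed

lemma fval_unique: "fval i \<O> x y \<Longrightarrow> fval i \<O> x z \<Longrightarrow> y = z"
  unfolding fval_def using halting_path_unique[OF fmach_deterministic] by blast

lemma fval_length:
  assumes "fval i \<O> x y"
  shows "length y \<le> fclock i (length x)"
proof -
  obtain cs where cs: "halting_path (fmach i) \<O> x cs" "length cs \<le> fclock i (length x) + 1"
    "tape_word (snd (last cs) ! 2) = y"
    using assms by (auto simp: fval_def)
  then have p: "path (fmach i) \<O> x cs" "cs \<noteq> []" by (auto simp: halting_path_def path_def)
  then have "(fst (last cs), snd (last cs)) \<in> set cs" by simp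
  from path_tape_word_length[OF fmach_wf p(1) this, of 2] show ?thesis
    using cs by (simp add: num_tapes_def)
qed

lemma fqueries_cong:
  assumes "\<And>q. q \<in> fqueries i \<O> x \<Longrightarrow> q \<in> fqueries i \<O>' x \<Longrightarrow> q \<in> \<O> \<longleftrightarrow> q \<in> \<O>'"
  shows "fqueries i \<O> x = fqueries i \<O>' x" "fval i \<O> x = fval i \<O>' x"
proof -
  have *: "fqueries i \<O> x \<inter> fqueries i \<O>' x \<inter> \<O> = fqueries i \<O> x \<inter> fqueries i \<O>' x \<inter> \<O>'"
    using assms by blast
  show "fqueries i \<O> x = fqueries i \<O>' x"
    using run_queries_cong(1)[OF *[unfolded fqueries_def]] by (simp add: fqueries_def)
  show "fval i \<O> x = fval i \<O>' x"
    unfolding fval_def using run_queries_cong(2)[OF *[unfolded fqueries_def]] by (intro ext) blast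
qed

lemma fqueries_finite: "finite (fqueries i \<O> x)"
  and fqueries_weight: "weight (fqueries i \<O> x) \<le> (fclock i (length x) + 1)\<^sup>2"
proof -
  obtain cs where cs: "path (fmach i) \<O> x cs" "length cs \<le> fclock i (length x) + 1"
    "fqueries i \<O> x = queries (fmach i) cs"
    using run_queries_eq_queries[OF fmach_deterministic, of "fclock i (length x) + 1" i \<O> x]
    unfolding fqueries_def by auto
  then have "weight (fqueries i \<O> x) \<le> length cs * length cs"
    using weight_queries fmach_wf by simp
  then show "weight (fqueries i \<O> x) \<le> (fclock i (length x) + 1)\<^sup>2"
    using mult_le_mono[OF cs(2) cs(2)] by (simp add: power2_eq_square)
  show "finite (fqueries i \<O> x)" using cs finite_queries by simp
qed

lemma weight_Un: "finite A \<Longrightarrow> finite B \<Longrightarrow> weight (A \<union> B) \<le> weight A + weight B"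
  using sum.union_inter[of A B "\<lambda>w. length w + 1"] by linarith

lemma length_less_weight: "finite A \<Longrightarrow> w \<in> A \<Longrightarrow> length w < weight A"
  using member_le_sum[of w A "\<lambda>w. length w + 1"] by simp

section \<open>Generic words, codewords and proofs\<close>

text \<open>With the marker \<open>False\<close> before each bit, the padding by \<open>True\<close>
  in \<open>code\<close> cannot be mistaken for a continuation of u, and a machine can write the
  word while reading u from left to right.\<close>

definition dbl :: "word \<Rightarrow> word" where
  "dbl u = concat (map (\<lambda>b. [False, b]) u)"

definition code :: "nat \<Rightarrow> word \<Rightarrow> nat \<Rightarrow> word" where
  "code k u m = True # replicate k True @ False # dbl u @ replicate m True"

definition gen :: "nat \<Rightarrow> bool \<Rightarrow> word \<Rightarrow> word" where
  "gen j b y = False # replicate j True @ False # b # y"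

text \<open>The word is parsed from the right: the last \<open>False\<close> ends x, which therefore
  stays unencoded, and padding is just appended.\<close>

definition fproof :: "nat \<Rightarrow> word \<Rightarrow> nat \<Rightarrow> word" where
  "fproof i x t = True # replicate i True @ False # x @ False # replicate t True"

text \<open>Unary, since no machine ever has to produce such a proof; these proofs only put every
  word of the language into the range. The number n makes the proof as long as desired.\<close>

definition cproof :: "word \<Rightarrow> word list \<Rightarrow> word list \<Rightarrow> nat \<Rightarrow> word" where
  "cproof y Q P n = False # replicate (prod_encode (to_nat (y, Q, P), n)) True"

lemma replicate_True_False_inject:
  "replicate k True @ False # a = replicate k' True @ False # a' \<longleftrightarrow> k = k' \<and> a = a'"
proof (induction k arbitrary: k')
  case 0
  show ?case by (cases k') auto
next
  case (Suc k)
  show ?case using Suc by (cases k') auto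
qed

lemma False_replicate_True_inject:
  "x @ False # replicate t True = x' @ False # replicate t' True \<longleftrightarrow> x = x' \<and> t = t'"
proof -
  have "x @ False # replicate t True = x' @ False # replicate t' True \<longleftrightarrow>
    rev (x @ False # replicate t True) = rev (x' @ False # replicate t' True)"
    by (simp only: rev_is_rev_conv)
  also have "\<dots> \<longleftrightarrow> x = x' \<and> t = t'" by (auto simp: replicate_True_False_inject)
  finally show ?thesis .
qed

lemma dbl_simps [simp]: "dbl [] = []" "dbl (b # u) = False # b # dbl u" "dbl (u @ v) = dbl u @ dbl v"
  by (auto simp: dbl_def)

lemma length_dbl [simp]: "length (dbl u) = 2 * length u"
  by (induction u) auto

lemma dbl_replicate_inject:
  "dbl u @ replicate m True = dbl u' @ replicate m' True \<longleftrightarrow> u = u' \<and> m = m'"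
proof (induction u arbitrary: u')
  case Nil
  show ?case
  proof (cases u')
    case Nil
    then show ?thesis by (auto dest: arg_cong[where f = length])
  next
    case (Cons b v)
    then show ?thesis by (cases m) auto
  qed
next
  case (Cons b u)
  show ?case using Cons by (cases u'; cases m') auto
qed

lemma code_inject [simp]: "code k u m = code k' u' m' \<longleftrightarrow> k = k' \<and> u = u' \<and> m = m'"
  by (auto simp: code_def replicate_True_False_inject dbl_replicate_inject)

lemma gen_inject [simp]: "gen j b y = gen j' b' y' \<longleftrightarrow> j = j' \<and> b = b' \<and> y = y'"
  by (auto simp: gen_def replicate_True_False_inject)

lemma gen_neq_code [simp]: "gen j b y \<noteq> code k u m" "code k u m \<noteq> gen j b y"
  by (simp_all add: gen_def code_def)

lemma fproof_inject [simp]: "fproof i x t = fproof i' x' t' \<longleftrightarrow> i = i' \<and> x = x' \<and> t = t'"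
  by (auto simp: fproof_def replicate_True_False_inject False_replicate_True_inject)

lemma cproof_inject [simp]: "cproof y Q P n = cproof y' Q' P' n' \<longleftrightarrow> y = y' \<and> Q = Q' \<and> P = P' \<and> n = n'"
  by (auto simp: cproof_def prod_encode_eq)

lemma fproof_neq_cproof [simp]: "fproof i x t \<noteq> cproof y Q P n" "cproof y Q P n \<noteq> fproof i x t"
  by (simp_all add: fproof_def cproof_def)

lemma length_code: "length (code k u m) = k + 2 * length u + m + 2"
  by (simp add: code_def)

lemma length_gen: "length (gen j b y) = j + length y + 3"
  by (simp add: gen_def)

lemma length_fproof: "length (fproof i x t) = i + length x + t + 3"
  by (simp add: fproof_def)

lemma length_cproof: "n < length (cproof y Q P n)"
  by (simp add: cproof_def le_imp_less_Suc le_prod_encode_2)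

text \<open>Large enough to pay for the run on \<open>x\<close> and for an accepting path on its output.\<close>
definition threshold :: "nat \<Rightarrow> nat \<Rightarrow> nat \<Rightarrow> nat" where
  "threshold k i n = (fclock i n + 1)\<^sup>2 + (nclock k (fclock i n) + 1)\<^sup>2"

text \<open>The path runs under the finite oracle P, which makes this a property of the proof alone;
  the actual oracle enters only through its agreement with P on Q in \<open>proves\<close>.\<close>

definition certificate :: "nat \<Rightarrow> word \<Rightarrow> word set \<Rightarrow> word set \<Rightarrow> nat \<Rightarrow> bool" where
  "certificate k y Q P n \<longleftrightarrow> weight Q \<le> n \<and> length y \<le> n \<and>
     (\<exists>cs. acc k P y cs \<and> queries (nmach k) cs \<subseteq> Q)"

section \<open>Proofs relative to an oracle and the words on which they depend\<close>

definition proves :: "word set \<Rightarrow> nat \<Rightarrow> word \<Rightarrow> word \<Rightarrow> bool" where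
  "proves \<O> k u y \<longleftrightarrow>
     (\<exists>Q P n. u = cproof y Q P n \<and> certificate k y (set Q) (set P) (length u) \<and> \<O> \<inter> set Q = set P) \<or>
     (\<exists>i x t. u = fproof i x t \<and> threshold k i (length x) \<le> t \<and> fval i \<O> x y)"

text \<open>A proof that fails its length condition proves nothing under any oracle and gets no
  queries. This keeps the weight within the length of u for every u.\<close>

definition proof_queries :: "word set \<Rightarrow> nat \<Rightarrow> word \<Rightarrow> word set" where
  "proof_queries \<O> k u =
     {q. \<exists>y Q P n. u = cproof y Q P n \<and> certificate k y (set Q) (set P) (length u) \<and> q \<in> set Q} \<union>
     {q. \<exists>i x t. u = fproof i x t \<and> threshold k i (length x) \<le> t \<and> q \<in> fqueries i \<O> x}"

lemma proof_cases:
  obtains (c) y Q P n where "u = cproof y Q P n" | (f) i x t where "u = fproof i x t"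
  | (none) "\<And>y Q P n. u \<noteq> cproof y Q P n" "\<And>i x t. u \<noteq> fproof i x t"
  by blast

lemma proves_simps:
  "proves \<O> k (cproof y Q P n) y' \<longleftrightarrow>
     y' = y \<and> certificate k y (set Q) (set P) (length (cproof y Q P n)) \<and> \<O> \<inter> set Q = set P"
  "proves \<O> k (fproof i x t) y \<longleftrightarrow> threshold k i (length x) \<le> t \<and> fval i \<O> x y"
  by (auto simp: proves_def)

lemma proof_queries_simps:
  "proof_queries \<O> k (cproof y Q P n) =
     (if certificate k y (set Q) (set P) (length (cproof y Q P n)) then set Q else {})"
  "proof_queries \<O> k (fproof i x t) = (if threshold k i (length x) \<le> t then fqueries i \<O> x else {})"
  by (auto simp: proof_queries_def)

lemma proves_unique: "proves \<O> k u y \<Longrightarrow> proves \<O> k u z \<Longrightarrow> y = z"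
  by (cases u rule: proof_cases) (auto simp: proves_simps proves_def dest: fval_unique)

text \<open>For a certificate both query sets are \<open>set Q\<close>; for a run, the first query
  answered differently would belong to both sets.\<close>

lemma proves_cong:
  assumes "\<And>q. q \<in> proof_queries \<O> k u \<Longrightarrow> q \<in> proof_queries \<O>' k u \<Longrightarrow> q \<in> \<O> \<longleftrightarrow> q \<in> \<O>'"
  shows "proof_queries \<O> k u = proof_queries \<O>' k u \<and> proves \<O> k u = proves \<O>' k u"
proof (cases u rule: proof_cases)
  case (c y Q P n)
  show ?thesis
  proof (cases "certificate k y (set Q) (set P) (length u)")
    case True
    then have "\<O> \<inter> set Q = \<O>' \<inter> set Q" using assms unfolding c proof_queries_simps by auto
    then show ?thesis unfolding c proof_queries_simps by (auto simp: fun_eq_iff proves_simps)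
  next
    case False
    then show ?thesis unfolding c proof_queries_simps by (auto simp: fun_eq_iff proves_simps)
  qed
next
  case (f i x t)
  show ?thesis
  proof (cases "threshold k i (length x) \<le> t")
    case True
    then have "\<And>q. q \<in> fqueries i \<O> x \<Longrightarrow> q \<in> fqueries i \<O>' x \<Longrightarrow> q \<in> \<O> \<longleftrightarrow> q \<in> \<O>'"
      using assms unfolding f proof_queries_simps by simp
    from fqueries_cong[OF this] show ?thesis
      unfolding f proof_queries_simps by (auto simp: fun_eq_iff proves_simps)
  next
    case False
    then show ?thesis unfolding f proof_queries_simps by (auto simp: fun_eq_iff proves_simps)
  qed
next
  case none
  then show ?thesis by (auto simp: fun_eq_iff proof_queries_def proves_def)
qed

lemma proof_queries_finite: "finite (proof_queries \<O> k u)"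
  by (cases u rule: proof_cases) (auto simp: proof_queries_simps fqueries_finite proof_queries_def)

lemma proof_queries_weight: "weight (proof_queries \<O> k u) \<le> length u"
proof (cases u rule: proof_cases)
  case (f i x t)
  then show ?thesis
    using fqueries_weight[of i \<O> x] by (auto simp: proof_queries_simps threshold_def length_fproof)
next
  case none
  then show ?thesis by (simp add: proof_queries_def)
qed (auto simp: proof_queries_simps certificate_def)

lemma proof_queries_length: "q \<in> proof_queries \<O> k u \<Longrightarrow> length q < length u"
  using length_less_weight[OF proof_queries_finite] proof_queries_weight le_trans less_le_trans by blast

lemma proves_length:
  assumes "proves \<O> k u y"
  shows "length y \<le> length u"
proof (cases u rule: proof_cases)
  case (f i x t)
  then have "length y \<le> fclock i (length x)" "threshold k i (length x) \<le> t"
    using assms fval_length by (auto simp: proves_simps)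
  moreover have "fclock i (length x) \<le> (fclock i (length x) + 1)\<^sup>2" by (simp add: power2_eq_square)
  ultimately show ?thesis by (simp add: f length_fproof threshold_def)
qed (use assms in \<open>auto simp: proves_simps certificate_def proves_def\<close>)

lemma nclock_mono: "m \<le> n \<Longrightarrow> nclock k m \<le> nclock k n"
  by (simp add: nclock_def power_mono)

lemma acc_of_cproof:
  assumes "proves \<O> k (cproof y Q P n) y'"
  shows "\<exists>cs. acc k \<O> y' cs \<and> queries (nmach k) cs \<subseteq> proof_queries \<O> k (cproof y Q P n)"
proof -
  obtain cs where cs: "acc k (set P) y cs" "queries (nmach k) cs \<subseteq> set Q"
    and c: "certificate k y (set Q) (set P) (length (cproof y Q P n))" "\<O> \<inter> set Q = set P" "y' = y"
    using assms unfolding proves_simps certificate_def by blast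
  have "queries (nmach k) cs \<inter> set P = queries (nmach k) cs \<inter> \<O>" using cs(2) c(2) by blast
  then have "acc k \<O> y cs" using cs(1) acc_cong by blast
  then show ?thesis using cs(2) c by (simp only: proof_queries_simps if_True) blast
qed

text \<open>The source of all length estimates. A certificate has already paid for Q, which contains
  the queries of its path. For a run, the two summands of \<open>threshold\<close> pay for the run
  and for an accepting path on its output, whose length is bounded by the clock.\<close>

lemma proof_weight:
  assumes "proves \<O> k u y" "y \<in> nlang k \<O>"
  shows "\<exists>cs. acc k \<O> y cs \<and> weight (proof_queries \<O> k u \<union> queries (nmach k) cs) \<le> length u"
proof (cases u rule: proof_cases)
  case (c y' Q P n)
  then obtain cs where "acc k \<O> y cs" "queries (nmach k) cs \<subseteq> proof_queries \<O> k u"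
    using acc_of_cproof assms(1) by blast
  then show ?thesis using proof_queries_weight[of \<O> k u] by (metis sup.absorb1)
next
  case (f i x t)
  obtain cs where cs: "acc k \<O> y cs" using assms(2) by (auto simp: nlang_def)
  have t: "threshold k i (length x) \<le> t" "fval i \<O> x y" using assms(1) by (auto simp: f proves_simps)
  have "weight (proof_queries \<O> k u) \<le> (fclock i (length x) + 1)\<^sup>2"
    using fqueries_weight[of i \<O> x] t by (simp add: f proof_queries_simps)
  moreover have "weight (queries (nmach k) cs) \<le> (nclock k (fclock i (length x)) + 1)\<^sup>2"
    using acc_weight[OF cs] nclock_mono[OF fval_length[OF t(2)], of k]
    by (meson add_le_mono1 le_trans power_mono zero_le)
  ultimately have "weight (proof_queries \<O> k u \<union> queries (nmach k) cs) \<le> length u"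
    using weight_Un[OF proof_queries_finite finite_queries, of \<O> k u "nmach k" cs] t(1)
    by (simp add: f length_fproof threshold_def)
  then show ?thesis using cs by blast
qed (use assms in \<open>auto simp: proves_def\<close>)

section \<open>Items\<close>

text \<open>The words \<open>code k u m\<close> for all \<open>m\<close> stand or fall together.\<close>
definition item :: "word \<Rightarrow> word" where
  "item w = (if \<exists>k u m. w = code k u m then SOME v. \<exists>k u m. w = code k u m \<and> v = code k u 0 else w)"

lemma item_code [simp]: "item (code k u m) = code k u 0"
  by (auto simp: item_def)

lemma item_other: "(\<And>k u m. w \<noteq> code k u m) \<Longrightarrow> item w = w"
  by (auto simp: item_def)

lemma item_gen [simp]: "item (gen j b y) = gen j b y"
  by (rule item_other) simp

lemma length_item: "length (item w) \<le> length w"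
proof (cases "\<exists>k u m. w = code k u m")
  case True
  then show ?thesis by (auto simp: length_code)
qed (simp add: item_def)

lemma weight_item_image: "finite Q \<Longrightarrow> weight (item ` Q) \<le> weight Q"
proof -
  assume f: "finite Q"
  have "weight (item ` Q) \<le> sum ((\<lambda>w. length w + 1) \<circ> item) Q"
    using f by (intro sum_image_le) auto
  also have "\<dots> \<le> weight Q" by (intro sum_mono) (simp add: length_item)
  finally show ?thesis .
qed

text \<open>The closures of the dependencies v have at most \<open>length v + 1\<close> elements
  each; these numbers add up to \<open>weight (dep w)\<close>, which is at most the length of w. The
  word w itself is the one extra element.\<close>

lemma dependency_closure_single:
  assumes "\<And>w. finite (dep w)" "\<And>w. weight (dep w) \<le> length w"
  shows "\<exists>R. w \<in> R \<and> finite R \<and> card R \<le> length w + 1 \<and> (\<forall>v\<in>R. dep v \<subseteq> R)"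
proof (induction w rule: measure_induct_rule[of length])
  case (less w)
  have "\<exists>R. v \<in> R \<and> finite R \<and> card R \<le> length v + 1 \<and> (\<forall>u\<in>R. dep u \<subseteq> R)" if "v \<in> dep w" for v
    using less length_less_weight[OF assms(1) that] assms(2)[of w] by simp
  then obtain r where r: "\<And>v. v \<in> dep w \<Longrightarrow> v \<in> r v \<and> finite (r v) \<and> card (r v) \<le> length v + 1 \<and>
      (\<forall>u\<in>r v. dep u \<subseteq> r v)"
    by metis
  let ?R = "insert w (\<Union>v\<in>dep w. r v)"
  have f: "finite (\<Union>v\<in>dep w. r v)" using assms(1) r by auto
  have "card (\<Union>v\<in>dep w. r v) \<le> (\<Sum>v\<in>dep w. card (r v))"
    using assms(1) by (rule card_UN_le)
  also have "\<dots> \<le> weight (dep w)" using r by (intro sum_mono) auto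
  finally have "card (\<Union>v\<in>dep w. r v) \<le> length w" using assms(2)[of w] by simp
  then have "card ?R \<le> length w + 1" using card_insert_le_m1[of "length w + 1"] f
    by (simp add: card_insert_if)
  moreover have "dep u \<subseteq> ?R" if "u \<in> ?R" for u
  proof (cases "u = w")
    case True
    then show ?thesis using r by blast
  next
    case False
    then show ?thesis using that r by blast
  qed
  ultimately show ?case using f by (intro exI[of _ ?R]) auto
qed

lemma dependency_closure:
  assumes "\<And>w. finite (dep w)" "\<And>w. weight (dep w) \<le> length w" "finite Q"
  shows "\<exists>R. Q \<subseteq> R \<and> finite R \<and> card R \<le> weight Q \<and> (\<forall>v\<in>R. dep v \<subseteq> R)"
proof -
  obtain r where r: "\<And>w. w \<in> r w \<and> finite (r w) \<and> card (r w) \<le> length w + 1 \<and> (\<forall>v\<in>r w. dep v \<subseteq> r w)"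
    using dependency_closure_single[OF assms(1,2)] by metis
  have "card (\<Union>w\<in>Q. r w) \<le> (\<Sum>w\<in>Q. card (r w))" using assms(3) by (rule card_UN_le)
  also have "\<dots> \<le> weight Q" using r by (intro sum_mono) auto
  finally show ?thesis using r assms(3) by (intro exI[of _ "\<Union>w\<in>Q. r w"]) fastforce
qed

text \<open>Stage n decides the words of length n. Since \<open>\<Phi>\<close> looks only at shorter
  words, the earlier stages already give it the final answers.\<close>

lemma length_recursion:
  assumes "\<And>\<O> \<O>' w. (\<And>v. length v < length w \<Longrightarrow> v \<in> \<O> \<longleftrightarrow> v \<in> \<O>') \<Longrightarrow> \<Phi> \<O> w \<longleftrightarrow> \<Phi> \<O>' w"
  shows "\<exists>\<O> :: word set. \<forall>w. w \<in> \<O> \<longleftrightarrow> \<Phi> \<O> w"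
proof -
  define T where "T = rec_nat {} (\<lambda>n S. S \<union> {w. length w = n \<and> \<Phi> S w})"
  have T: "T 0 = {}" "\<And>n. T (Suc n) = T n \<union> {w. length w = n \<and> \<Phi> (T n) w}"
    by (auto simp: T_def)
  have in_T: "w \<in> T n \<longleftrightarrow> length w < n \<and> \<Phi> (T (length w)) w" for w n
    by (induction n) (auto simp: T less_Suc_eq)
  define \<O> where "\<O> = {w. \<Phi> (T (length w)) w}"
  have "w \<in> \<O> \<longleftrightarrow> \<Phi> \<O> w" for w
  proof -
    have "\<Phi> (T (length w)) w \<longleftrightarrow> \<Phi> \<O> w"
      by (rule assms) (auto simp: in_T \<O>_def)
    then show ?thesis by (simp add: \<O>_def)
  qed
  then show ?thesis by blast
qed

section \<open>Forcing conditions\<close>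

text \<open>R lists items only, so a finite R can fix all the words \<open>code k u m\<close> of a
  codeword at once.\<close>

definition agree :: "word set \<Rightarrow> word set \<Rightarrow> word set \<Rightarrow> bool" where
  "agree R \<O> \<O>' \<longleftrightarrow> (\<forall>q. item q \<in> R \<longrightarrow> (q \<in> \<O> \<longleftrightarrow> q \<in> \<O>'))"

abbreviation below :: "nat \<Rightarrow> word set" where
  "below n \<equiv> {v. length v < n}"

text \<open>The bits stored about a proof of \<open>y\<close>: its validity, and the symbols of \<open>y\<close> interleaved
  with bits telling that a further symbol exists.\<close>
definition info :: "word \<Rightarrow> nat \<Rightarrow> bool" where
  "info y m \<longleftrightarrow> m = 0 \<or> (\<exists>a < length y. m = 2 * a + 1 \<or> m = 2 * a + 2 \<and> y ! a)"

type_synonym task = "nat \<times> nat \<times> bool"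

text \<open>
  A condition fixes the oracle on all items shorter than \<open>level\<close>. A triple \<open>(k, i, m)\<close> in
  \<open>decl\<close> promises that every codeword of length at least \<open>m\<close> for machine \<open>k\<close> that is
  justified by a run of function \<open>i\<close> enters the oracle. A tag \<open>j\<close> promises exactly one generic
  word \<open>gen j b y\<close> for every length of \<open>y\<close>.
\<close>
record forcing =
  level :: nat
  seg :: "word set"
  decl :: "(nat \<times> nat \<times> nat) set"
  tag :: "task \<Rightarrow> nat option"

definition governed :: "(nat \<times> nat \<times> nat) set \<Rightarrow> nat \<Rightarrow> word \<Rightarrow> bool" where
  "governed D k u \<longleftrightarrow> (\<exists>y Q P n. u = cproof y Q P n) \<or>
     (\<exists>i x t m. u = fproof i x t \<and> (k, i, m) \<in> D \<and> m \<le> length (code k u 0))"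

text \<open>The clauses concern the stored bits, soundness and completeness. A codeword that is
  justified but not governed may be present or absent as long as it is sound; merging relies on this
  freedom.\<close>

definition valid_at :: "(nat \<times> nat \<times> nat) set \<Rightarrow> word set \<Rightarrow> nat \<Rightarrow> word \<Rightarrow> bool" where
  "valid_at D \<O> k u \<longleftrightarrow>
     (\<forall>m. code k u m \<in> \<O> \<longleftrightarrow> code k u 0 \<in> \<O> \<and> (\<exists>y. proves \<O> k u y \<and> info y m)) \<and>
     (code k u 0 \<in> \<O> \<longrightarrow> (\<exists>y. proves \<O> k u y \<and> y \<in> nlang k \<O>)) \<and>
     (governed D k u \<and> (\<exists>y. proves \<O> k u y) \<longrightarrow> code k u 0 \<in> \<O>)"

definition one_at :: "word set \<Rightarrow> nat \<Rightarrow> nat \<Rightarrow> bool" where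
  "one_at \<O> j n \<longleftrightarrow> (\<exists>!c. length (snd c) = n \<and> gen j (fst c) (snd c) \<in> \<O>)"

definition valid_below :: "forcing \<Rightarrow> nat \<Rightarrow> word set \<Rightarrow> bool" where
  "valid_below \<sigma> l \<O> \<longleftrightarrow>
     (\<forall>k u. length (code k u 0) < l \<longrightarrow> valid_at (decl \<sigma>) \<O> k u) \<and>
     (\<forall>j \<in> ran (tag \<sigma>). \<forall>n. j + n + 3 < l \<longrightarrow> one_at \<O> j n) \<and>
     agree (below (level \<sigma>)) \<O> (seg \<sigma>)"

definition models :: "forcing \<Rightarrow> word set set" where
  "models \<sigma> = {\<O>. \<forall>l. valid_below \<sigma> l \<O>}"

definition extends :: "forcing \<Rightarrow> forcing \<Rightarrow> bool" where
  "extends \<tau> \<sigma> \<longleftrightarrow> level \<sigma> \<le> level \<tau> \<and> decl \<sigma> \<subseteq> decl \<tau> \<and> tag \<sigma> \<subseteq>\<^sub>m tag \<tau> \<and>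
     agree (below (level \<sigma>)) (seg \<tau>) (seg \<sigma>)"

lemma agree_refl [simp]: "agree R \<O> \<O>"
  by (simp add: agree_def)

lemma agree_sym: "agree R \<O> \<O>' \<Longrightarrow> agree R \<O>' \<O>"
  by (simp add: agree_def)

lemma agree_trans: "agree R \<O> \<O>' \<Longrightarrow> agree R \<O>' \<O>'' \<Longrightarrow> agree R \<O> \<O>''"
  by (simp add: agree_def)

lemma agree_mono: "agree R \<O> \<O>' \<Longrightarrow> S \<subseteq> R \<Longrightarrow> agree S \<O> \<O>'"
  by (auto simp: agree_def)

lemma agree_Int: "agree R \<O> \<O>' \<Longrightarrow> item ` Q \<subseteq> R \<Longrightarrow> Q \<inter> \<O> = Q \<inter> \<O>'"
  unfolding agree_def by blast

lemma agree_below_iff: "agree (below l) \<O> \<O>' \<Longrightarrow> length q < l \<Longrightarrow> q \<in> \<O> \<longleftrightarrow> q \<in> \<O>'"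
  using length_item[of q] unfolding agree_def by simp

lemma proves_agree:
  assumes "agree R \<O> \<O>'" "item ` proof_queries \<O> k u \<subseteq> R"
  shows "proof_queries \<O>' k u = proof_queries \<O> k u" "proves \<O>' k u = proves \<O> k u"
proof -
  have "proof_queries \<O> k u = proof_queries \<O>' k u \<and> proves \<O> k u = proves \<O>' k u"
    using assms unfolding agree_def by (intro proves_cong) blast
  then show "proof_queries \<O>' k u = proof_queries \<O> k u" "proves \<O>' k u = proves \<O> k u" by auto
qed

lemma item_proof_queries_below: "length u \<le> l \<Longrightarrow> item ` proof_queries \<O> k u \<subseteq> below l"
proof (rule image_subsetI)
  fix q assume "length u \<le> l" "q \<in> proof_queries \<O> k u"
  then show "item q \<in> below l"
    using proof_queries_length[of q \<O> k u] length_item[of q] by simp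
qed

section \<open>Support of codewords and transfer of validity between oracles\<close>

definition supported :: "word set \<Rightarrow> word set \<Rightarrow> nat \<Rightarrow> word \<Rightarrow> bool" where
  "supported \<O> R k u \<longleftrightarrow> item ` proof_queries \<O> k u \<subseteq> R \<and>
     (code k u 0 \<in> \<O> \<longrightarrow>
       (\<exists>y cs. proves \<O> k u y \<and> acc k \<O> y cs \<and> item ` queries (nmach k) cs \<subseteq> R))"

lemma supported_mono: "supported \<O> R k u \<Longrightarrow> R \<subseteq> S \<Longrightarrow> supported \<O> S k u"
  unfolding supported_def by (meson subset_trans)

lemma supported_agree:
  assumes "agree R \<O> \<O>'" "code k u 0 \<in> R" "supported \<O> R k u"
  shows "supported \<O>' R k u" "valid_at D \<O> k u \<Longrightarrow> valid_at D \<O>' k u"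
proof -
  have pq: "proof_queries \<O>' k u = proof_queries \<O> k u" and pr: "proves \<O>' k u = proves \<O> k u"
    using proves_agree[OF assms(1)] assms(3) unfolding supported_def by auto
  have code: "code k u m \<in> \<O>' \<longleftrightarrow> code k u m \<in> \<O>" for m
    using assms(1,2) unfolding agree_def by auto
  have acc: "\<exists>y cs. proves \<O>' k u y \<and> acc k \<O>' y cs \<and> item ` queries (nmach k) cs \<subseteq> R"
    if "code k u 0 \<in> \<O>'"
  proof -
    have "code k u 0 \<in> \<O>" using that code by simp
    then obtain y cs where cs: "proves \<O> k u y" "acc k \<O> y cs" "item ` queries (nmach k) cs \<subseteq> R"
      using assms(3) unfolding supported_def by blast
    then have "acc k \<O>' y cs" using acc_cong agree_Int[OF assms(1) cs(3)] by blast
    then show ?thesis using cs pr by metis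
  qed
  then show "supported \<O>' R k u" using assms(3) pq unfolding supported_def by simp
  assume v: "valid_at D \<O> k u"
  have "\<exists>y. proves \<O>' k u y \<and> y \<in> nlang k \<O>'" if "code k u 0 \<in> \<O>'"
    using acc[OF that] unfolding nlang_def by blast
  then show "valid_at D \<O>' k u" using v unfolding valid_at_def code pr by blast
qed

text \<open>By \<open>proof_weight\<close>, the proof and a suitable accepting path query only words
  shorter than u.\<close>

lemma supported_below:
  assumes "valid_at D \<O> k u" "length u \<le> l"
  shows "supported \<O> (below l) k u"
  unfolding supported_def
proof (intro conjI impI)
  show "item ` proof_queries \<O> k u \<subseteq> below l" using assms(2) by (rule item_proof_queries_below)
  assume "code k u 0 \<in> \<O>"
  then obtain y where y: "proves \<O> k u y" "y \<in> nlang k \<O>" using assms(1) unfolding valid_at_def by blast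
  then obtain cs where cs: "acc k \<O> y cs" "weight (proof_queries \<O> k u \<union> queries (nmach k) cs) \<le> length u"
    using proof_weight by blast
  have "item ` queries (nmach k) cs \<subseteq> below l"
  proof (rule image_subsetI)
    fix q assume "q \<in> queries (nmach k) cs"
    then have "length q < length u"
      using length_less_weight[of "proof_queries \<O> k u \<union> queries (nmach k) cs" q]
        proof_queries_finite finite_queries cs(2) by fastforce
    then show "item q \<in> below l" using length_item[of q] assms(2) by simp
  qed
  then show "\<exists>y cs. proves \<O> k u y \<and> acc k \<O> y cs \<and> item ` queries (nmach k) cs \<subseteq> below l"
    using y cs by blast
qed

lemma valid_at_below:
  assumes "agree (below l) \<O> \<O>'" "length (code k u 0) < l" "valid_at D \<O> k u"
  shows "valid_at D \<O>' k u"
proof (rule supported_agree(2)[OF assms(1)])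
  show "supported \<O> (below l) k u"
    using supported_below[OF assms(3)] assms(2) by (simp add: length_code)
qed (use assms in auto)

lemma one_at_cong:
  assumes "\<And>b y. length y = n \<Longrightarrow> gen j b y \<in> \<O> \<longleftrightarrow> gen j b y \<in> \<O>'"
  shows "one_at \<O> j n \<longleftrightarrow> one_at \<O>' j n"
  unfolding one_at_def using assms by metis

lemma valid_below_agree:
  assumes "agree (below l) \<O> \<O>'" "level \<sigma> \<le> l" "valid_below \<sigma> l \<O>"
  shows "valid_below \<sigma> l \<O>'"
  unfolding valid_below_def
proof (intro conjI allI impI ballI)
  fix k u assume "length (code k u 0) < l"
  then show "valid_at (decl \<sigma>) \<O>' k u"
    using assms valid_at_below unfolding valid_below_def by blast
next
  fix j n assume j: "j \<in> ran (tag \<sigma>)" "j + n + 3 < l"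
  then have "one_at \<O> j n" using assms unfolding valid_below_def by blast
  moreover have "one_at \<O> j n \<longleftrightarrow> one_at \<O>' j n"
    using j(2) by (intro one_at_cong agree_below_iff[OF assms(1)]) (simp add: length_gen)
  ultimately show "one_at \<O>' j n" by simp
next
  have "agree (below (level \<sigma>)) \<O>' \<O>"
    by (rule agree_mono[OF agree_sym[OF assms(1)]]) (use assms(2) in auto)
  then show "agree (below (level \<sigma>)) \<O>' (seg \<sigma>)"
    using assms(3) agree_trans unfolding valid_below_def by blast
qed

lemma valid_below_mono: "valid_below \<sigma> l \<O> \<Longrightarrow> l' \<le> l \<Longrightarrow> valid_below \<sigma> l' \<O>"
  unfolding valid_below_def by auto

lemma modelsD:
  assumes "\<O> \<in> models \<sigma>"
  shows "valid_at (decl \<sigma>) \<O> k u" "j \<in> ran (tag \<sigma>) \<Longrightarrow> one_at \<O> j n"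
    "agree (below (level \<sigma>)) \<O> (seg \<sigma>)" "valid_below \<sigma> l \<O>"
proof -
  have *: "valid_below \<sigma> l \<O>" for l using assms by (simp add: models_def)
  show "valid_at (decl \<sigma>) \<O> k u" using *[of "Suc (length (code k u 0))"] unfolding valid_below_def by simp
  show "j \<in> ran (tag \<sigma>) \<Longrightarrow> one_at \<O> j n" using *[of "j + n + 4"] unfolding valid_below_def by simp
  show "agree (below (level \<sigma>)) \<O> (seg \<sigma>)" using *[of 0] unfolding valid_below_def by simp
  show "valid_below \<sigma> l \<O>" by (rule *)
qed

lemma extends_refl [simp]: "extends \<sigma> \<sigma>"
  by (simp add: extends_def)

lemma extends_trans: "extends \<rho> \<tau> \<Longrightarrow> extends \<tau> \<sigma> \<Longrightarrow> extends \<rho> \<sigma>"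
  unfolding extends_def agree_def by (auto intro: map_le_trans)

lemma governed_mono: "governed D k u \<Longrightarrow> D \<subseteq> D' \<Longrightarrow> governed D' k u"
  unfolding governed_def by blast

lemma ran_mono: "f \<subseteq>\<^sub>m g \<Longrightarrow> ran f \<subseteq> ran g"
  unfolding map_le_def ran_def by (auto simp: dom_def) metis

lemma extends_valid_below:
  assumes "extends \<tau> \<sigma>" "valid_below \<tau> l \<O>"
  shows "valid_below \<sigma> l \<O>"
  unfolding valid_below_def
proof (intro conjI allI impI ballI)
  fix k u assume "length (code k u 0) < l"
  then have "valid_at (decl \<tau>) \<O> k u" using assms(2) unfolding valid_below_def by blast
  moreover have "decl \<sigma> \<subseteq> decl \<tau>" using assms(1) unfolding extends_def by blast
  ultimately show "valid_at (decl \<sigma>) \<O> k u" using governed_mono unfolding valid_at_def by blast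
next
  fix j n assume "j \<in> ran (tag \<sigma>)" "j + n + 3 < l"
  moreover have "ran (tag \<sigma>) \<subseteq> ran (tag \<tau>)" using assms(1) ran_mono unfolding extends_def by blast
  ultimately show "one_at \<O> j n" using assms(2) unfolding valid_below_def by blast
next
  have "agree (below (level \<tau>)) \<O> (seg \<tau>)" using assms(2) unfolding valid_below_def by blast
  moreover have "below (level \<sigma>) \<subseteq> below (level \<tau>)" using assms(1) unfolding extends_def by auto
  moreover have "agree (below (level \<sigma>)) (seg \<tau>) (seg \<sigma>)" using assms(1) unfolding extends_def by blast
  ultimately show "agree (below (level \<sigma>)) \<O> (seg \<sigma>)" using agree_mono agree_trans by blast
qed

lemma extends_models: "extends \<tau> \<sigma> \<Longrightarrow> models \<tau> \<subseteq> models \<sigma>"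
  unfolding models_def using extends_valid_below by blast

text \<open>Oracles valid below the codeword are considered, and not only models: while a model is
  being built, nothing more is known about it.\<close>

definition sound :: "forcing \<Rightarrow> bool" where
  "sound \<sigma> \<longleftrightarrow> (\<forall>k i m x t \<O> y. (k, i, m) \<in> decl \<sigma> \<longrightarrow> m \<le> length (code k (fproof i x t) 0) \<longrightarrow>
     valid_below \<sigma> (length (code k (fproof i x t) 0)) \<O> \<longrightarrow> proves \<O> k (fproof i x t) y \<longrightarrow> y \<in> nlang k \<O>)"

text \<open>
  The words with items in \<open>R\<close> are preset to \<open>A\<close>; every other codeword enters the oracle
  exactly if it is governed and justified. Soundness of the latter follows by induction on
  the length, since the part of the oracle below a codeword is already known to be valid.
\<close>
lemma ex_preset_model:
  assumes "sound \<sigma>" "valid_below \<sigma> l A" "level \<sigma> \<le> l"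
    and R: "\<And>k u. code k u 0 \<in> R \<Longrightarrow> l \<le> length (code k u 0) \<Longrightarrow>
      valid_at (decl \<sigma>) A k u \<and> supported A (R \<union> below l) k u"
    and one: "\<And>j n. j \<in> ran (tag \<sigma>) \<Longrightarrow> one_at A j n"
  obtains \<O> where "\<O> \<in> models \<sigma>" "agree (R \<union> below l) \<O> A"
    "\<And>w. (\<And>k u m. w \<noteq> code k u m) \<Longrightarrow> w \<in> \<O> \<longleftrightarrow> w \<in> A"
    "\<And>k u. code k u 0 \<notin> R \<Longrightarrow> l \<le> length (code k u 0) \<Longrightarrow>
      code k u 0 \<in> \<O> \<longleftrightarrow> governed (decl \<sigma>) k u \<and> (\<exists>y. proves \<O> k u y)"
proof -
  let ?S = "R \<union> below l"
  \<comment> \<open>The first case is a codeword that is not preset: it enters by necessity only,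
    together with the bits of the word it proves.\<close>
  define \<Phi> where "\<Phi> \<O> w \<longleftrightarrow> (if \<exists>k u m. w = code k u m \<and> code k u 0 \<notin> ?S
     then \<exists>k u m y. w = code k u m \<and> governed (decl \<sigma>) k u \<and> proves \<O> k u y \<and> info y m
     else w \<in> A)" for \<O> :: "word set" and w :: word
  have "\<exists>\<O>. \<forall>w. w \<in> \<O> \<longleftrightarrow> \<Phi> \<O> w"
  proof (rule length_recursion)
    fix \<O> \<O>' :: "word set" and w :: word assume *: "\<And>v. length v < length w \<Longrightarrow> v \<in> \<O> \<longleftrightarrow> v \<in> \<O>'"
    have "proves \<O> k u = proves \<O>' k u" if "w = code k u m" for k u m
    proof -
      have "q \<in> \<O> \<longleftrightarrow> q \<in> \<O>'" if "q \<in> proof_queries \<O> k u" for q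
        using proof_queries_length[OF that] \<open>w = code k u m\<close> * by (simp add: length_code)
      then show ?thesis using proves_cong by blast
    qed
    then show "\<Phi> \<O> w \<longleftrightarrow> \<Phi> \<O>' w" unfolding \<Phi>_def by auto
  qed
  then obtain \<O> where \<O>: "\<And>w. w \<in> \<O> \<longleftrightarrow> \<Phi> \<O> w" by blast
  have code: "code k u m \<in> \<O> \<longleftrightarrow> governed (decl \<sigma>) k u \<and> (\<exists>y. proves \<O> k u y \<and> info y m)"
    if "code k u 0 \<notin> ?S" for k u m
    unfolding \<O>[of "code k u m"] \<Phi>_def using that by auto
  have agr: "agree ?S \<O> A"
    unfolding agree_def
  proof (intro allI impI)
    fix q assume "item q \<in> ?S"
    then have "\<not> (\<exists>k u m. q = code k u m \<and> code k u 0 \<notin> ?S)" by (metis item_code)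
    then show "q \<in> \<O> \<longleftrightarrow> q \<in> A" unfolding \<O>[of q] \<Phi>_def by (simp only: if_False)
  qed
  have other: "w \<in> \<O> \<longleftrightarrow> w \<in> A" if "\<And>k u m. w \<noteq> code k u m" for w
    unfolding \<O>[of w] \<Phi>_def using that by auto
  have one': "one_at \<O> j n" if "j \<in> ran (tag \<sigma>)" for j n
    using one[OF that, of n] one_at_cong[of n j \<O> A] other by simp
  have low: "agree (below l) \<O> A" using agree_mono[OF agr] by blast
  have agr': "agree (below (level \<sigma>)) \<O> (seg \<sigma>)"
  proof -
    have "agree (below (level \<sigma>)) \<O> A" by (rule agree_mono[OF low]) (use assms(3) in auto)
    then show ?thesis using assms(2) agree_trans unfolding valid_below_def by blast
  qed
  have valid: "\<forall>k u. length (code k u 0) = n \<longrightarrow> valid_at (decl \<sigma>) \<O> k u" for n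
  proof (induction n rule: less_induct)
    case (less n)
    \<comment> \<open>Validity of the shorter codewords is exactly what \<open>sound\<close> asks
      for at length n.\<close>
    have vb: "valid_below \<sigma> n \<O>" unfolding valid_below_def using less one' agr' by blast
    show ?case
    proof (intro allI impI)
      fix k u assume n: "length (code k u 0) = n"
      consider "n < l" | "l \<le> n" "code k u 0 \<in> R" | "code k u 0 \<notin> ?S" using n by fastforce
      then show "valid_at (decl \<sigma>) \<O> k u"
      proof cases
        case 1
        then have "valid_at (decl \<sigma>) A k u" using assms(2) n unfolding valid_below_def by blast
        then show ?thesis using valid_at_below[OF agree_sym[OF low]] 1 n by blast
      next
        case 2
        then have "valid_at (decl \<sigma>) A k u" "supported A ?S k u" using R n by auto
        then show ?thesis using supported_agree(2)[OF agree_sym[OF agr]] 2 by blast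
      next
        case 3
        have "y \<in> nlang k \<O>" if "governed (decl \<sigma>) k u" "proves \<O> k u y" for y
          using that(1) unfolding governed_def
        proof (elim disjE exE conjE)
          fix y' Q P n assume "u = cproof y' Q P n"
          then show ?thesis using acc_of_cproof that(2) unfolding nlang_def by blast
        next
          fix i x t m assume "u = fproof i x t" "(k, i, m) \<in> decl \<sigma>" "m \<le> length (code k u 0)"
          then show ?thesis using assms(1) vb n that(2) unfolding sound_def by blast
        qed
        moreover have "info y 0" for y by (simp add: info_def)
        ultimately show ?thesis unfolding valid_at_def code[OF 3] by blast
      qed
    qed
  qed
  have "\<O> \<in> models \<sigma>"
    unfolding models_def valid_below_def using valid one' agr' by blast
  moreover have "code k u 0 \<in> \<O> \<longleftrightarrow> governed (decl \<sigma>) k u \<and> (\<exists>y. proves \<O> k u y)"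
    if "code k u 0 \<notin> R" "l \<le> length (code k u 0)" for k u
    using that by (subst code) (auto simp: info_def)
  ultimately show ?thesis using that agr other by blast
qed

text \<open>From l on, no optional codeword is present, so membership is settled by the proof alone
  and not by accepting paths. This makes two such oracles comparable through the queries of
  proofs.\<close>

definition canonical :: "nat \<Rightarrow> (nat \<times> nat \<times> nat) set \<Rightarrow> word set \<Rightarrow> bool" where
  "canonical l D \<O> \<longleftrightarrow> (\<forall>k u. l \<le> length (code k u 0) \<longrightarrow>
     (code k u 0 \<in> \<O> \<longleftrightarrow> governed D k u \<and> (\<exists>y. proves \<O> k u y)))"

text \<open>Beyond l every number j receives its words, assigned as a tag or not. Two fillings of
  the same B thus differ only where their choice functions differ.\<close>

definition fill :: "nat \<Rightarrow> word set \<Rightarrow> (nat \<Rightarrow> nat \<Rightarrow> bool \<times> word) \<Rightarrow> word set" where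
  "fill l B ch = {w \<in> B. length (item w) < l} \<union>
     {gen j (fst (ch j n)) (snd (ch j n)) | j n. l \<le> j + n + 3}"

lemma gen_in_fill:
  assumes "\<And>j n. length (snd (ch j n)) = n"
  shows "gen j b y \<in> fill l B ch \<longleftrightarrow>
    (if l \<le> j + length y + 3 then (b, y) = ch j (length y) else gen j b y \<in> B)"
proof -
  have *: "gen j b y \<in> fill l B ch \<longleftrightarrow> gen j b y \<in> B \<and> j + length y + 3 < l \<or>
      (\<exists>n. b = fst (ch j n) \<and> y = snd (ch j n) \<and> l \<le> j + n + 3)"
    by (auto simp: fill_def length_gen)
  have n: "n = length y" if "y = snd (ch j n)" for n
    using assms[of j n] that by simp
  have "(\<exists>n. b = fst (ch j n) \<and> y = snd (ch j n) \<and> l \<le> j + n + 3) \<longleftrightarrow>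
      b = fst (ch j (length y)) \<and> y = snd (ch j (length y)) \<and> l \<le> j + length y + 3"
    (is "?L \<longleftrightarrow> ?R")
  proof
    assume ?L
    then obtain n where *: "b = fst (ch j n)" "y = snd (ch j n)" "l \<le> j + n + 3" by blast
    then show ?R unfolding n[OF *(2), symmetric] by blast
  qed blast
  then show ?thesis unfolding * prod_eq_iff fst_conv snd_conv by (simp split: if_split)
qed

lemma ex_filled_model:
  assumes "sound \<sigma>" "valid_below \<sigma> l B" "level \<sigma> \<le> l" "\<And>j n. length (snd (ch j n)) = n"
  obtains \<O> where "\<O> \<in> models \<sigma>" "agree (below l) \<O> B" "canonical l (decl \<sigma>) \<O>"
    "\<And>w. (\<And>k u m. w \<noteq> code k u m) \<Longrightarrow> w \<in> \<O> \<longleftrightarrow> w \<in> fill l B ch"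
proof -
  let ?A = "fill l B ch"
  have agr: "agree (below l) B ?A"
  proof -
    have "q \<in> B \<longleftrightarrow> q \<in> ?A" if "item q \<in> below l" for q
      using that unfolding fill_def by (auto simp: length_gen assms(4))
    then show ?thesis unfolding agree_def by blast
  qed
  have "one_at ?A j n" if "j \<in> ran (tag \<sigma>)" for j n
  proof (cases "l \<le> j + n + 3")
    case True
    then show ?thesis unfolding one_at_def gen_in_fill[of ch, OF assms(4)]
      by (intro ex1I[of _ "ch j n"]) (auto simp: assms(4))
  next
    case False
    then have "one_at B j n" using assms(2) that unfolding valid_below_def by simp
    then show ?thesis using one_at_cong[of n j B ?A] False by (simp add: gen_in_fill[of ch, OF assms(4)])
  qed
  with ex_preset_model[OF assms(1) valid_below_agree[OF agr assms(3,2)] assms(3), of "{}"]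
  obtain \<O> where "\<O> \<in> models \<sigma>" "agree (below l) \<O> ?A"
    "\<And>w. (\<And>k u m. w \<noteq> code k u m) \<Longrightarrow> w \<in> \<O> \<longleftrightarrow> w \<in> ?A"
    "\<And>k u. l \<le> length (code k u 0) \<Longrightarrow>
      code k u 0 \<in> \<O> \<longleftrightarrow> governed (decl \<sigma>) k u \<and> (\<exists>y. proves \<O> k u y)"
    by auto
  then show ?thesis using that agree_trans[OF _ agree_sym[OF agr]] unfolding canonical_def by metis
qed

text \<open>Without e the languages of a and b meet; with e and a = b the machine a is
  ambiguous.\<close>

definition collision :: "task \<Rightarrow> word set \<Rightarrow> bool" where
  "collision = (\<lambda>(a, b, e) \<O>. \<exists>z cs cs'. acc a \<O> z cs \<and> acc b \<O> z cs' \<and> (e \<longrightarrow> cs \<noteq> cs'))"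

text \<open>Promises and tags are granted only if their premise holds in all models. Starting them
  at \<open>level \<sigma>\<close> leaves the segment fixed so far free of new obligations.\<close>

inductive reachable :: "forcing \<Rightarrow> bool" where
  initial: "reachable \<lparr>level = 0, seg = {}, decl = {}, tag = Map.empty\<rparr>"
| grow: "reachable \<sigma> \<Longrightarrow> \<O> \<in> models \<sigma> \<Longrightarrow> level \<sigma> \<le> n \<Longrightarrow> reachable (\<sigma>\<lparr>level := n, seg := \<O>\<rparr>)"
| promise: "reachable \<sigma> \<Longrightarrow> (\<And>\<O> x y. \<O> \<in> models \<sigma> \<Longrightarrow> fval i \<O> x y \<Longrightarrow> y \<in> nlang k \<O>) \<Longrightarrow>
    reachable (\<sigma>\<lparr>decl := insert (k, i, level \<sigma>) (decl \<sigma>)\<rparr>)"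
| assign: "reachable \<sigma> \<Longrightarrow> (\<And>\<O>. \<O> \<in> models \<sigma> \<Longrightarrow> \<not> collision T \<O>) \<Longrightarrow> tag \<sigma> T = None \<Longrightarrow>
    level \<sigma> \<le> j \<Longrightarrow> j \<notin> ran (tag \<sigma>) \<Longrightarrow> reachable (\<sigma>\<lparr>tag := (tag \<sigma>)(T \<mapsto> j)\<rparr>)"

lemma extends_grow: "\<O> \<in> models \<sigma> \<Longrightarrow> level \<sigma> \<le> n \<Longrightarrow> extends (\<sigma>\<lparr>level := n, seg := \<O>\<rparr>) \<sigma>"
  using modelsD(3) by (simp add: extends_def)

lemma extends_promise: "extends (\<sigma>\<lparr>decl := insert d (decl \<sigma>)\<rparr>) \<sigma>"
  by (auto simp: extends_def)

lemma extends_assign: "tag \<sigma> T = None \<Longrightarrow> extends (\<sigma>\<lparr>tag := (tag \<sigma>)(T \<mapsto> j)\<rparr>) \<sigma>"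
  by (auto simp: extends_def map_le_def)

lemma sound_extends: "extends \<tau> \<sigma> \<Longrightarrow> decl \<tau> = decl \<sigma> \<Longrightarrow> sound \<sigma> \<Longrightarrow> sound \<tau>"
  unfolding sound_def by (simp only:) (blast dest: extends_valid_below)

lemma default_choice: "length (snd ((\<lambda>j n. (False, replicate n False)) j n)) = n"
  by simp

text \<open>An oracle valid below the codeword is completed to a model with the same part below. The
  premise applies to the model, and the accepting path it yields asks only words shorter than the
  codeword, so it also accepts under the given oracle.\<close>

lemma sound_promise:
  assumes "sound \<sigma>" "\<And>\<O> x y. \<O> \<in> models \<sigma> \<Longrightarrow> fval i \<O> x y \<Longrightarrow> y \<in> nlang k \<O>"
  shows "sound (\<sigma>\<lparr>decl := insert (k, i, level \<sigma>) (decl \<sigma>)\<rparr>)" (is "sound ?\<tau>")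
  unfolding sound_def
proof (intro allI impI)
  fix k' i' m x t \<O> y
  let ?u = "fproof i' x t"
  let ?l = "length (code k' ?u 0)"
  assume d: "(k', i', m) \<in> decl ?\<tau>" and m: "m \<le> ?l" and v: "valid_below ?\<tau> ?l \<O>" and y: "proves \<O> k' ?u y"
  have v': "valid_below \<sigma> ?l \<O>" using extends_valid_below[OF extends_promise v] .
  show "y \<in> nlang k' \<O>"
  proof (cases "(k', i', m) \<in> decl \<sigma>")
    case True
    then show ?thesis using assms(1) m v' y unfolding sound_def by blast
  next
    case False
    then have eq: "k' = k" "i' = i" "m = level \<sigma>" using d by auto
    then obtain \<O>' where \<O>': "\<O>' \<in> models \<sigma>" "agree (below ?l) \<O>' \<O>"
      using ex_filled_model[OF assms(1) v' _ default_choice] m by metis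
    have "proves \<O>' k' ?u = proves \<O> k' ?u"
      by (rule proves_agree(2)[OF agree_sym[OF \<O>'(2)] item_proof_queries_below]) (simp add: length_code)
    then have y': "proves \<O>' k' ?u y" using y by simp
    then have "fval i \<O>' x y" using eq by (simp add: proves_simps)
    then have "y \<in> nlang k' \<O>'" using assms(2) \<O>'(1) eq by blast
    then obtain cs where cs: "acc k' \<O>' y cs"
      "weight (proof_queries \<O>' k' ?u \<union> queries (nmach k') cs) \<le> length ?u"
      using proof_weight y' by blast
    have "q \<in> \<O>' \<longleftrightarrow> q \<in> \<O>" if "q \<in> queries (nmach k') cs" for q
    proof (rule agree_below_iff[OF \<O>'(2)])
      have "length q < length ?u"
        using length_less_weight[of "proof_queries \<O>' k' ?u \<union> queries (nmach k') cs" q]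
          proof_queries_finite finite_queries cs(2) that by fastforce
      then show "length q < ?l" by (simp add: length_code)
    qed
    then have "queries (nmach k') cs \<inter> \<O>' = queries (nmach k') cs \<inter> \<O>" by blast
    then show ?thesis using cs(1) acc_cong unfolding nlang_def by blast
  qed
qed

lemma reachable_sound: "reachable \<sigma> \<Longrightarrow> sound \<sigma> \<and> valid_below \<sigma> (level \<sigma>) (seg \<sigma>)"
proof (induction rule: reachable.induct)
  case initial
  then show ?case by (simp add: sound_def valid_below_def)
next
  case (grow \<sigma> \<O> n)
  have "valid_below \<sigma> n \<O>" using modelsD(4)[OF grow.hyps(2)] .
  then have "valid_below (\<sigma>\<lparr>level := n, seg := \<O>\<rparr>) n \<O>" by (simp add: valid_below_def)
  moreover have "sound (\<sigma>\<lparr>level := n, seg := \<O>\<rparr>)"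
    using sound_extends[OF extends_grow[OF grow.hyps(2,3)]] grow.IH by simp
  ultimately show ?case by simp
next
  case (promise \<sigma> i k)
  let ?\<tau> = "\<sigma>\<lparr>decl := insert (k, i, level \<sigma>) (decl \<sigma>)\<rparr>"
  have "valid_at (decl ?\<tau>) (seg \<sigma>) k' u" if l: "length (code k' u 0) < level \<sigma>" for k' u
  proof -
    have "valid_at (decl \<sigma>) (seg \<sigma>) k' u" using promise.IH l unfolding valid_below_def by blast
    \<comment> \<open>The new promise concerns codewords of length at least
      \<open>level \<sigma>\<close>, beyond the segment.\<close>
    moreover have "governed (decl ?\<tau>) k' u \<longleftrightarrow> governed (decl \<sigma>) k' u"
      using l unfolding governed_def by auto
    ultimately show ?thesis unfolding valid_at_def by blast
  qed
  then have "valid_below ?\<tau> (level ?\<tau>) (seg ?\<tau>)"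
    using promise.IH unfolding valid_below_def by simp
  then show ?case using sound_promise promise.IH promise.hyps(2) by blast
next
  case (assign \<sigma> T j)
  let ?\<tau> = "\<sigma>\<lparr>tag := (tag \<sigma>)(T \<mapsto> j)\<rparr>"
  have "ran (tag ?\<tau>) = insert j (ran (tag \<sigma>))" using assign.hyps(3) by simp
  \<comment> \<open>Words with tag j have length at least \<open>j + 3\<close>, so the tag demands
    nothing inside the segment.\<close>
  then have "valid_below ?\<tau> (level ?\<tau>) (seg ?\<tau>)"
    using assign.IH assign.hyps(4) unfolding valid_below_def by auto
  moreover have "sound ?\<tau>" using sound_extends[OF extends_assign[OF assign.hyps(3)]] assign.IH by simp
  ultimately show ?case by simp
qed

lemma reachable_model:
  assumes "reachable \<sigma>"
  obtains \<O> where "\<O> \<in> models \<sigma>"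
  using ex_filled_model[OF _ _ order_refl default_choice] reachable_sound[OF assms] by metis

text \<open>The condition sought is the one just before j was assigned: collisions are already
  excluded there, while j imposes nothing yet.\<close>

lemma reachable_assigned:
  assumes "reachable \<sigma>" "tag \<sigma> T = Some j"
  shows "\<exists>\<sigma>'. reachable \<sigma>' \<and> extends \<sigma> \<sigma>' \<and> j \<notin> ran (tag \<sigma>') \<and> (\<forall>\<O> \<in> models \<sigma>'. \<not> collision T \<O>)"
  using assms
proof (induction rule: reachable.induct)
  case initial
  then show ?case by simp
next
  case (grow \<sigma> \<O> n)
  then have "tag \<sigma> T = Some j" by simp
  then show ?case using grow.IH extends_trans[OF extends_grow[OF grow.hyps(2,3)]] by blast
next
  case (promise \<sigma> i k)
  then have "tag \<sigma> T = Some j" by simp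
  then show ?case using promise.IH extends_trans[OF extends_promise] by blast
next
  case (assign \<sigma> T' j')
  show ?case
  proof (cases "T' = T")
    case True
    then have "j' = j" using assign.prems by simp
    then show ?thesis using assign True extends_assign by blast
  next
    case False
    then have "tag \<sigma> T = Some j" using assign.prems by simp
    then show ?thesis using assign.IH extends_trans[OF extends_assign[OF assign.hyps(3)]] by blast
  qed
qed

text \<open>Freezes an initial part of a given model. What depends on this part only then holds in
  all models of the new condition.\<close>

lemma grow_to:
  assumes "reachable \<sigma>" "\<O> \<in> models \<sigma>"
  obtains \<sigma>' where "reachable \<sigma>'" "extends \<sigma>' \<sigma>" "N \<le> level \<sigma>'"
    "\<And>\<O>'. \<O>' \<in> models \<sigma>' \<Longrightarrow> agree (below N) \<O>' \<O>"
proof -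
  let ?\<sigma> = "\<sigma>\<lparr>level := max N (level \<sigma>), seg := \<O>\<rparr>"
  have "agree (below N) \<O>' \<O>" if "\<O>' \<in> models ?\<sigma>" for \<O>'
  proof -
    have "agree (below (max N (level \<sigma>))) \<O>' \<O>" using modelsD(3)[OF that] by simp
    then show ?thesis by (rule agree_mono) auto
  qed
  then show ?thesis using that reachable.grow[OF assms, of "max N (level \<sigma>)"] extends_grow[OF assms(2), of "max N (level \<sigma>)"]
    by simp
qed

section \<open>Merging two oracles\<close>

text \<open>Induction on the length of items. A codeword beyond l is present exactly if its proof is
  governed and succeeds; the words this proof asks in both oracles are shorter and lie in both
  closed sets, so the verdicts coincide. A difference could only originate in a word that is no
  codeword.\<close>

lemma canonical_agree:
  assumes "canonical l D \<O>1" "canonical l D \<O>2" "agree (below l) \<O>1 \<O>2"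
    and v1: "\<And>k u. valid_at D \<O>1 k u" and v2: "\<And>k u. valid_at D \<O>2 k u"
    and R1: "\<And>k u. code k u 0 \<in> R1 \<Longrightarrow> item ` proof_queries \<O>1 k u \<subseteq> R1"
    and R2: "\<And>k u. code k u 0 \<in> R2 \<Longrightarrow> item ` proof_queries \<O>2 k u \<subseteq> R2"
    and other: "\<And>w. w \<in> R1 \<inter> R2 \<Longrightarrow> (\<And>k u m. w \<noteq> code k u m) \<Longrightarrow> w \<in> \<O>1 \<longleftrightarrow> w \<in> \<O>2"
  shows "agree (R1 \<inter> R2) \<O>1 \<O>2"
proof -
  have "item q \<in> R1 \<inter> R2 \<Longrightarrow> q \<in> \<O>1 \<longleftrightarrow> q \<in> \<O>2" for q
  proof (induction "length (item q)" arbitrary: q rule: less_induct)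
    case less
    show ?case
    proof (cases "\<exists>k u m. q = code k u m")
      case True
      then obtain k u m where q: "q = code k u m" by blast
      show ?thesis
      proof (cases "length (code k u 0) < l")
        case True
        then show ?thesis using assms(3) unfolding agree_def q by simp
      next
        case False
        have "p \<in> \<O>1 \<longleftrightarrow> p \<in> \<O>2"
          if p: "p \<in> proof_queries \<O>1 k u" "p \<in> proof_queries \<O>2 k u" for p
        proof (rule less.hyps)
          show "length (item p) < length (item q)"
            using proof_queries_length[OF p(1)] length_item[of p] by (simp add: q length_code)
          show "item p \<in> R1 \<inter> R2" using R1[of k u] R2[of k u] less.prems p by (auto simp: q)
        qed
        then have pr: "proves \<O>1 k u = proves \<O>2 k u" using proves_cong by blast
        have "code k u 0 \<in> \<O>1 \<longleftrightarrow> governed D k u \<and> (\<exists>y. proves \<O>1 k u y)"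
          "code k u 0 \<in> \<O>2 \<longleftrightarrow> governed D k u \<and> (\<exists>y. proves \<O>2 k u y)"
          using assms(1,2) False unfolding canonical_def by (simp_all only: not_less)
        then have "code k u 0 \<in> \<O>1 \<longleftrightarrow> code k u 0 \<in> \<O>2" unfolding pr by blast
        then show ?thesis using v1[of k u] v2[of k u] unfolding valid_at_def pr q by blast
      qed
    next
      case False
      then have "item q = q" by (intro item_other) blast
      then show ?thesis using other[of q] less.prems False by simp
    qed
  qed
  then show ?thesis unfolding agree_def by blast
qed

definition dep_closed :: "word set \<Rightarrow> word set \<Rightarrow> bool" where
  "dep_closed \<O> R \<longleftrightarrow> (\<forall>k u. code k u 0 \<in> R \<longrightarrow> supported \<O> R k u)"

text \<open>A present codeword depends on its proof and on an accepting path that keeps it sound, an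
  absent one on its proof only. In both cases the weight of these words is at most its
  length.\<close>

lemma ex_dep_closed:
  assumes "\<And>k u. valid_at D \<O> k u" "finite Q"
  obtains R where "item ` Q \<subseteq> R" "finite R" "card R \<le> weight Q" "dep_closed \<O> R"
proof -
  have "\<exists>S. finite S \<and> weight S \<le> length w \<and> (\<forall>k u. w = code k u 0 \<longrightarrow> supported \<O> S k u)" for w
  proof (cases "\<exists>k u. w = code k u 0")
    case True
    then obtain k u where w: "w = code k u 0" by blast
    have "\<exists>T. finite T \<and> weight T \<le> length u \<and> supported \<O> (item ` T) k u"
    proof (cases "code k u 0 \<in> \<O>")
      case True
      then obtain y where y: "proves \<O> k u y" "y \<in> nlang k \<O>" using assms(1) unfolding valid_at_def by blast
      then obtain cs where "acc k \<O> y cs" "weight (proof_queries \<O> k u \<union> queries (nmach k) cs) \<le> length u"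
        using proof_weight by blast
      then show ?thesis using y proof_queries_finite finite_queries unfolding supported_def
        by (intro exI[of _ "proof_queries \<O> k u \<union> queries (nmach k) cs"]) blast
    next
      case False
      then show ?thesis using proof_queries_finite proof_queries_weight
        by (intro exI[of _ "proof_queries \<O> k u"]) (simp add: supported_def)
    qed
    then obtain T where T: "finite T" "weight T \<le> length u" "supported \<O> (item ` T) k u" by blast
    have "weight (item ` T) \<le> length w"
      using weight_item_image[OF T(1)] T(2) by (simp add: w length_code)
    then show ?thesis using T(1,3) by (intro exI[of _ "item ` T"]) (simp add: w)
  next
    case False
    then show ?thesis by (intro exI[of _ "{}"]) simp
  qed
  then obtain dep where dep: "\<And>w. finite (dep w)" "\<And>w. weight (dep w) \<le> length w"
    "\<And>k u. supported \<O> (dep (code k u 0)) k u"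
    by metis
  obtain R where R: "item ` Q \<subseteq> R" "finite R" "card R \<le> weight (item ` Q)" "\<And>v. v \<in> R \<Longrightarrow> dep v \<subseteq> R"
    using dependency_closure[of dep "item ` Q", OF dep(1,2)] assms(2) by blast
  have "card R \<le> weight Q" using R(3) weight_item_image[OF assms(2)] by simp
  moreover have "dep_closed \<O> R" unfolding dep_closed_def using dep(3) R(4) supported_mono by blast
  ultimately show ?thesis using that R by blast
qed

text \<open>A codeword in R1 or R2 keeps the support it had in its own oracle and so remains valid,
  governed by \<open>\<sigma>\<close> or not; the remaining ones beyond l are decided anew. Generic
  words whose tag is unknown to \<open>\<sigma>\<close> combine freely.\<close>

lemma merge_models:
  assumes "sound \<sigma>" "level \<sigma> \<le> l" "\<O>1 \<in> models \<sigma>" "\<O>2 \<in> models \<sigma>" "agree (below l) \<O>1 \<O>2"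
    and "dep_closed \<O>1 R1" "dep_closed \<O>2 R2" "agree (R1 \<inter> R2) \<O>1 \<O>2"
    and tags: "\<And>j b y. j \<in> ran (tag \<sigma>) \<Longrightarrow> gen j b y \<in> \<O>1 \<longleftrightarrow> gen j b y \<in> \<O>2"
  obtains \<O> where "\<O> \<in> models \<sigma>" "agree R1 \<O> \<O>1" "agree R2 \<O> \<O>2"
proof -
  \<comment> \<open>Where both sources apply, they agree: on \<open>R1 \<inter> R2\<close> and below
    l.\<close>
  define A where "A = {q. if item q \<in> R2 \<and> item q \<notin> R1 \<union> below l then q \<in> \<O>2 else q \<in> \<O>1}"
  have A1: "agree (R1 \<union> below l) \<O>1 A" unfolding agree_def A_def by auto
  have A2: "agree R2 \<O>2 A"
    using assms(5,8) unfolding agree_def A_def by auto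
  have low: "agree (below l) \<O>1 A" and A1': "agree R1 \<O>1 A" using agree_mono[OF A1] by blast+
  have v: "valid_below \<sigma> l A"
    using valid_below_agree[OF low assms(2) modelsD(4)[OF assms(3)]] .
  have sup: "valid_at (decl \<sigma>) A k u \<and> supported A (R1 \<union> R2 \<union> below l) k u"
    if "code k u 0 \<in> R1 \<union> R2" "l \<le> length (code k u 0)" for k u
  proof (cases "code k u 0 \<in> R1")
    case True
    then have "supported \<O>1 R1 k u" using assms(6) unfolding dep_closed_def by blast
    note * = supported_agree[OF A1' True this]
    show ?thesis
      by (intro conjI *(2) modelsD(1)[OF assms(3)] supported_mono[OF *(1)]) blast
  next
    case False
    then have *: "code k u 0 \<in> R2" using that(1) by blast
    then have "supported \<O>2 R2 k u" using assms(7) unfolding dep_closed_def by blast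
    note * = supported_agree[OF A2 * this]
    show ?thesis
      by (intro conjI *(2) modelsD(1)[OF assms(4)] supported_mono[OF *(1)]) blast
  qed
  have one: "one_at A j n" if "j \<in> ran (tag \<sigma>)" for j n
    using modelsD(2)[OF assms(3) that, of n] one_at_cong[of n j \<O>1 A] tags[OF that]
    by (simp add: A_def)
  obtain \<O> where "\<O> \<in> models \<sigma>" "agree (R1 \<union> R2 \<union> below l) \<O> A"
    by (rule ex_preset_model[OF assms(1) v assms(2) sup one]) (assumption | rule that)+
  moreover from this have "agree R1 \<O> A" "agree R2 \<O> A" using agree_mono by blast+
  ultimately show ?thesis
    using that agree_trans[OF _ agree_sym[OF A1']] agree_trans[OF _ agree_sym[OF A2]] by blast
qed

text \<open>Any r + 1 choices with bit b1, together with all the choices they notice, number at most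
  \<open>(r + 1)\<^sup>2\<close>, so some c2 with bit b2 lies outside. It notices at most r choices
  itself and hence misses one of the r + 1.\<close>

lemma independent_pair:
  fixes R :: "bool \<times> word \<Rightarrow> (bool \<times> word) set"
  assumes "\<And>c. length (snd c) = n \<Longrightarrow> finite (R c) \<and> card (R c) \<le> r" "(r + 1)\<^sup>2 < 2 ^ n"
  obtains c1 c2 where "fst c1 = b1" "fst c2 = b2" "length (snd c1) = n" "length (snd c2) = n"
    "c1 \<noteq> c2" "c1 \<notin> R c2" "c2 \<notin> R c1"
proof -
  let ?Y = "\<lambda>b :: bool. Pair b ` {y :: word. length y = n}"
  have card_Y: "card (?Y b) = 2 ^ n" for b
    using card_lists_length_eq[of "UNIV :: bool set" n] by (simp add: card_image inj_on_def)
  have fin_Y: "finite (?Y b)" for b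
    using card_Y[of b] by (metis card.infinite power_not_zero zero_neq_numeral)
  have "r + 1 \<le> (r + 1)\<^sup>2" by (simp add: power2_eq_square)
  then have "r + 1 \<le> card (?Y b1)" using assms(2) by (simp add: card_Y)
  then obtain F where F: "F \<subseteq> ?Y b1" "card F = r + 1" by (meson obtain_subset_with_card_n)
  then have fF: "finite F" using fin_Y finite_subset by blast
  have RF: "finite (R c) \<and> card (R c) \<le> r" if "c \<in> F" for c
    using that F(1) assms(1)[of c] by auto
  let ?U = "F \<union> (\<Union>c\<in>F. R c)"
  have "card (\<Union>c\<in>F. R c) \<le> (\<Sum>c\<in>F. card (R c))" using fF by (rule card_UN_le)
  also have "\<dots> \<le> (r + 1) * r" using sum_bounded_above[of F "\<lambda>c. card (R c)" r] RF F(2) by simp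
  finally have "card ?U \<le> (r + 1) + (r + 1) * r" using card_Un_le[of F "\<Union>c\<in>F. R c"] F(2) by linarith
  also have "\<dots> < card (?Y b2)" using assms(2) by (simp add: card_Y power2_eq_square)
  finally have "\<not> ?Y b2 \<subseteq> ?U" using card_mono[of ?U "?Y b2"] fF RF by force
  then obtain c2 where c2: "c2 \<in> ?Y b2" "c2 \<notin> ?U" by blast
  have "\<not> F \<subseteq> R c2"
    using card_mono[of "R c2" F] assms(1)[of c2] c2(1) F(2) by auto
  then obtain c1 where "c1 \<in> F" "c1 \<notin> R c2" by blast
  moreover from this have "c1 \<in> ?Y b1" using F(1) by blast
  ultimately show ?thesis by (intro that[of c1 c2]) (use c2 in auto)
qed

text \<open>
  The branches \<open>\<O> c\<close> run through all words at level \<open>n\<close> of tag \<open>j\<close>. Two of them that do not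
  notice each other's word are merged into a model of the condition preceding the assignment of \<open>j\<close>.
\<close>
lemma two_branches:
  assumes "reachable \<sigma>" "reachable \<sigma>'" "extends \<sigma> \<sigma>'" "j \<notin> ran (tag \<sigma>')"
    and n: "level \<sigma> \<le> j + n + 3" "(r + 1)\<^sup>2 < 2 ^ n"
  shows "\<exists>\<O>. (\<forall>c. length (snd c) = n \<longrightarrow> \<O> c \<in> models \<sigma>) \<and>
    (\<forall>c b y. length (snd c) = n \<longrightarrow> length y = n \<longrightarrow> (gen j b y \<in> \<O> c \<longleftrightarrow> (b, y) = c)) \<and>
    (\<forall>b1 b2 b3 Q. (\<forall>c. length (snd c) = n \<longrightarrow> finite (Q c) \<and> weight (Q c) \<le> r) \<longrightarrow>
       (\<exists>c1 c2 c3 \<O>'. fst c1 = b1 \<and> fst c2 = b2 \<and> fst c3 = b3 \<and>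
         length (snd c1) = n \<and> length (snd c2) = n \<and> length (snd c3) = n \<and>
         \<O>' \<in> models \<sigma>' \<and> Q c1 \<inter> \<O> c1 = Q c1 \<inter> \<O>' \<and> Q c2 \<inter> \<O> c2 = Q c2 \<inter> \<O>' \<and>
         Q c1 \<inter> Q c2 \<inter> \<O> c1 = Q c1 \<inter> Q c2 \<inter> \<O> c3))"
proof -
  \<comment> \<open>The length of the words \<open>gen j b y\<close> with y of length n; below it
    all branches are the same.\<close>
  let ?l = "j + n + 3"
  let ?D = "decl \<sigma>"
  obtain B where B: "B \<in> models \<sigma>" using reachable_model[OF assms(1)] .
  \<comment> \<open>Every other place gets the same arbitrary choice in all branches.\<close>
  define ch where "ch c j' n' = (if j' = j \<and> n' = n then c else (False, replicate n' False))"
    for c :: "bool \<times> word" and j' n'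
  have ch: "length (snd (ch c j' n')) = n'" if "length (snd c) = n" for c j' n'
    using that by (simp add: ch_def)
  have "\<exists>\<O>. \<O> \<in> models \<sigma> \<and> agree (below ?l) \<O> B \<and> canonical ?l ?D \<O> \<and>
      (\<forall>w. (\<forall>k u m. w \<noteq> code k u m) \<longrightarrow> (w \<in> \<O> \<longleftrightarrow> w \<in> fill ?l B (ch c)))"
    if "length (snd c) = n" for c
    using ex_filled_model[of \<sigma> ?l B "ch c", OF _ modelsD(4)[OF B] n(1) ch[OF that]] reachable_sound[OF assms(1)]
    by metis
  then obtain \<O> where \<O>: "\<And>c. length (snd c) = n \<Longrightarrow> \<O> c \<in> models \<sigma>"
    "\<And>c. length (snd c) = n \<Longrightarrow> agree (below ?l) (\<O> c) B"
    "\<And>c. length (snd c) = n \<Longrightarrow> canonical ?l ?D (\<O> c)"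
    "\<And>c w. length (snd c) = n \<Longrightarrow> (\<And>k u m. w \<noteq> code k u m) \<Longrightarrow> w \<in> \<O> c \<longleftrightarrow> w \<in> fill ?l B (ch c)"
    by metis
  have agr: "agree (below ?l) (\<O> c) (\<O> c')" if "length (snd c) = n" "length (snd c') = n" for c c'
    using \<O>(2) that agree_trans agree_sym by blast
  have val: "valid_at ?D (\<O> c) k u" if "length (snd c) = n" for c k u
    using modelsD(1)[OF \<O>(1)[OF that]] .
  have gen: "gen j' b y \<in> \<O> c \<longleftrightarrow> (if ?l \<le> j' + length y + 3 then (b, y) = ch c j' (length y) else gen j' b y \<in> B)"
    if "length (snd c) = n" for c j' b y
    using \<O>(4)[OF that] gen_in_fill[of "ch c", OF ch[OF that]] by simp
  have gen_j: "gen j b y \<in> \<O> c \<longleftrightarrow> (b, y) = c" if "length (snd c) = n" "length y = n" for c b y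
    using gen[OF that(1)] that by (simp add: ch_def)
  have diff: "w \<in> \<O> c \<longleftrightarrow> w \<in> \<O> c'"
    if "length (snd c) = n" "length (snd c') = n" "\<And>k u m. w \<noteq> code k u m"
      "w \<noteq> gen j (fst c) (snd c)" "w \<noteq> gen j (fst c') (snd c')" for c c' w
  proof -
    have "w \<in> fill ?l B (ch c1) \<Longrightarrow> w \<in> fill ?l B (ch c2)"
      if "w \<noteq> gen j (fst c1) (snd c1)" for c1 c2
      using that unfolding fill_def ch_def by (auto split: if_splits)
    then show ?thesis using that \<O>(4) by metis
  qed
  show ?thesis
  proof (intro exI[of _ \<O>] conjI allI impI, goal_cases)
    case (3 b1 b2 b3 Q)
    then have Q: "finite (Q c) \<and> weight (Q c) \<le> r" if "length (snd c) = n" for c using that by blast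
    have "\<exists>R. length (snd c) = n \<longrightarrow> item ` Q c \<subseteq> R \<and> finite R \<and> card R \<le> r \<and> dep_closed (\<O> c) R" for c
    proof (cases "length (snd c) = n")
      case True
      then show ?thesis using ex_dep_closed[OF val[OF True], of "Q c"] Q[OF True] le_trans by metis
    qed blast
    then obtain R where R: "\<And>c. length (snd c) = n \<Longrightarrow>
        item ` Q c \<subseteq> R c \<and> finite (R c) \<and> card (R c) \<le> r \<and> dep_closed (\<O> c) (R c)"
      by metis
    let ?G = "\<lambda>c. gen j (fst c) (snd c)"
    have inj: "inj ?G" by (auto simp: inj_on_def prod_eq_iff)
    \<comment> \<open>The choices whose generic word belongs to the closure of branch c, that is,
      those which this branch notices.\<close>
    let ?R = "\<lambda>c. ?G -` R c"
    have vR: "finite (?R c) \<and> card (?R c) \<le> r" if "length (snd c) = n" for c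
    proof -
      have "card (?R c) \<le> card (R c)"
        using R[OF that] by (intro card_inj_on_le[of ?G]) (auto intro: inj_on_subset[OF inj])
      then show ?thesis using R[OF that] finite_vimageI[OF _ inj] by force
    qed
    obtain c1 c2 where c: "fst c1 = b1" "fst c2 = b2" "length (snd c1) = n" "length (snd c2) = n"
      "c1 \<noteq> c2" "c1 \<notin> ?R c2" "c2 \<notin> ?R c1"
      by (rule independent_pair[of n ?R r b1 b2, OF vR n(2)])
    \<comment> \<open>Applied to a constant family, the lemma simply yields a choice with bit b3
      that the first branch does not notice.\<close>
    obtain c3 where c3: "fst c3 = b3" "length (snd c3) = n" "c3 \<notin> ?R c1"
      by (rule independent_pair[of n "\<lambda>_. ?R c1" r b3 b3, OF vR[OF c(3)] n(2)])
    let ?I = "R c1 \<inter> R c2"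
    have dep_closedD: "item ` proof_queries (\<O> c) k u \<subseteq> R c" if "length (snd c) = n" "code k u 0 \<in> R c" for c k u
      using R that unfolding dep_closed_def supported_def by blast
    have 12: "agree ?I (\<O> c1) (\<O> c2)"
      by (rule canonical_agree[OF \<O>(3)[OF c(3)] \<O>(3)[OF c(4)] agr[OF c(3,4)] val[OF c(3)] val[OF c(4)]
            dep_closedD[OF c(3)] dep_closedD[OF c(4)] diff[OF c(3,4)]]) (use c(6,7) in auto)
    \<comment> \<open>Each closure is closed for its own oracle only. As the two oracles agree on
      the intersection, a proof in it asks the same words in both branches, and these lie in both
      closures.\<close>
    have I: "item ` proof_queries (\<O> c1) k u \<subseteq> ?I" if "code k u 0 \<in> ?I" for k u
    proof -
      have "q \<in> \<O> c1 \<longleftrightarrow> q \<in> \<O> c2" if "q \<in> proof_queries (\<O> c1) k u" "q \<in> proof_queries (\<O> c2) k u" for q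
        using 12 dep_closedD[OF c(3), of k u] dep_closedD[OF c(4), of k u] that \<open>code k u 0 \<in> ?I\<close>
        unfolding agree_def by blast
      then have "proof_queries (\<O> c1) k u = proof_queries (\<O> c2) k u" using proves_cong by blast
      then show ?thesis using dep_closedD[OF c(3), of k u] dep_closedD[OF c(4), of k u] that by auto
    qed
    \<comment> \<open>The intersection contains none of the three distinguished words. The set
      \<open>UNIV\<close> serves as closed set for the third branch.\<close>
    have 13: "agree (?I \<inter> UNIV) (\<O> c1) (\<O> c3)"
      by (rule canonical_agree[OF \<O>(3)[OF c(3)] \<O>(3)[OF c3(2)] agr[OF c(3) c3(2)] val[OF c(3)] val[OF c3(2)]
            I _ diff[OF c(3) c3(2)]]) (use c(6,7) c3(3) in auto)
    have models': "\<O> c \<in> models \<sigma>'" if "length (snd c) = n" for c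
      using \<O>(1)[OF that] extends_models[OF assms(3)] by blast
    have tags: "gen j' b y \<in> \<O> c1 \<longleftrightarrow> gen j' b y \<in> \<O> c2" if "j' \<in> ran (tag \<sigma>')" for j' b y
      using diff[OF c(3,4), of "gen j' b y"] that assms(4) by auto
    have "level \<sigma>' \<le> ?l" using assms(3) n(1) unfolding extends_def by linarith
    note level = this
    have sound: "sound \<sigma>'" and cl: "dep_closed (\<O> c1) (R c1)" "dep_closed (\<O> c2) (R c2)"
      using reachable_sound[OF assms(2)] R[OF c(3)] R[OF c(4)] by blast+
    \<comment> \<open>The merge is made over \<open>\<sigma>'\<close>, since its result may contain
      two words with tag j on the same length, which \<open>\<sigma>\<close> forbids.\<close>
    obtain \<O>' where \<O>': "\<O>' \<in> models \<sigma>'" "agree (R c1) \<O>' (\<O> c1)" "agree (R c2) \<O>' (\<O> c2)"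
      by (rule merge_models[OF sound level models'[OF c(3)] models'[OF c(4)] agr[OF c(3,4)] cl 12 tags])
    have "Q c1 \<inter> \<O> c1 = Q c1 \<inter> \<O>'" "Q c2 \<inter> \<O> c2 = Q c2 \<inter> \<O>'"
      using agree_Int[OF agree_sym[OF \<O>'(2)], of "Q c1"] agree_Int[OF agree_sym[OF \<O>'(3)], of "Q c2"]
        R[OF c(3)] R[OF c(4)] by simp_all
    moreover have "Q c1 \<inter> Q c2 \<inter> \<O> c1 = Q c1 \<inter> Q c2 \<inter> \<O> c3"
      by (rule agree_Int[OF 13]) (use R[OF c(3)] R[OF c(4)] in blast)
    ultimately show ?case using c c3 \<O>'(1) by blast
  qed (use \<O>(1) gen_j in blast)+
qed

section \<open>Diagonalisation\<close>

text \<open>Membership depends only on the length of x, so one input per length suffices to test a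
  reduction.\<close>

definition witness_lang :: "word set \<Rightarrow> nat \<Rightarrow> bool \<Rightarrow> word set" where
  "witness_lang \<O> j b = {x. \<exists>y. length y = length x \<and> gen j b y \<in> \<O>}"

text \<open>
  \<open>z\<close> is an acceptable value at \<open>x\<close> of a reduction from \<open>witness_lang \<O> j True\<close> to the pair of
  the languages of \<open>a\<close> and \<open>b\<close> or, for \<open>e\<close>, to the language of \<open>a\<close>.
\<close>
fun reduces_at :: "task \<Rightarrow> word set \<Rightarrow> nat \<Rightarrow> word \<Rightarrow> word \<Rightarrow> bool" where
  "reduces_at (a, b, e) \<O> j x z \<longleftrightarrow>
     (if x \<in> witness_lang \<O> j True then z \<in> nlang a \<O>
      else if e then z \<notin> nlang a \<O> else z \<in> nlang b \<O>)"

lemma square_less_power: "5 \<le> s \<Longrightarrow> s * s < (2 :: nat) ^ s"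
proof (induction s rule: nat_induct_at_least)
  case (Suc n)
  have "2 * n + 1 \<le> n * n" using mult_le_mono1[OF Suc.hyps, of n] Suc.hyps by linarith
  then show ?case using Suc.IH by simp
qed simp

text \<open>At \<open>n = 2 ^ s\<close> the bound \<open>(n + 2) ^ c\<close> becomes a power of 2
  with exponent at most \<open>s * s\<close>, and \<open>s * s < 2 ^ s\<close> from s = 5
  on.\<close>

lemma poly_less_power: "\<exists>n \<ge> N. poly p n < 2 ^ n" for p :: "nat poly"
proof -
  obtain c where c: "\<And>n. poly p n \<le> (n + 2) ^ c" using poly_le_power by blast
  define s where "s = max 5 (max (2 * c) N)"
  let ?n = "2 ^ s :: nat"
  have s: "5 \<le> s" "2 * c \<le> s" "N \<le> s" by (auto simp: s_def)
  have "N \<le> ?n" using s(3) less_exp[of s] by linarith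
  moreover have "poly p ?n < 2 ^ ?n"
  proof -
    have "(2 :: nat) \<le> 2 ^ s" using power_increasing[of 1 s "2 :: nat"] s(1) by simp
    then have "?n + 2 \<le> 2 ^ (s + 1)" by simp
    then have "(?n + 2) ^ c \<le> (2 ^ (s + 1)) ^ c" by (rule power_mono) simp
    also have "\<dots> = 2 ^ ((s + 1) * c)" by (rule power_mult[symmetric])
    also have "\<dots> < 2 ^ ?n"
    proof (rule power_strict_increasing)
      have "(s + 1) * c \<le> (2 * s) * c" using s(1) by (intro mult_le_mono1) linarith
      also have "\<dots> = s * (2 * c)" by simp
      also have "\<dots> \<le> s * s" using s(2) by (rule mult_le_mono2)
      also have "\<dots> < ?n" using square_less_power s(1) .
      finally show "(s + 1) * c < ?n" .
    qed simp
    finally show ?thesis using c[of ?n] by linarith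
  qed
  ultimately show ?thesis by blast
qed

lemma nclock_poly: "\<exists>p. nclock k = poly p"
proof
  show "nclock k = poly ([:2, 1:] ^ snd (from_nat_into nmachines k))"
    by (rule ext) (simp add: nclock_def poly_power add.commute)
qed

lemma fclock_poly: "\<exists>p. fclock i = poly p"
proof
  show "fclock i = poly ([:2, 1:] ^ snd (from_nat_into fmachines i))"
    by (rule ext) (simp add: fclock_def poly_power add.commute)
qed

text \<open>The function has a single value in the merged oracle, so the paths of both branches
  accept the same word. For a pair, with bits True and False, this is a collision at once. For UP,
  with both bits True, the paths must coincide, and the third branch inherits a path on a value that
  it has to reject.\<close>

lemma diagonalise:
  assumes "reachable \<sigma>" "tag \<sigma> (a, b, e) = Some j" "e \<longrightarrow> a = b"
  obtains \<O> x where "\<O> \<in> models \<sigma>" "\<And>z. fval i \<O> x z \<Longrightarrow> \<not> reduces_at (a, b, e) \<O> j x z"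
proof (rule ccontr)
  assume "\<not> thesis"
  then have red: "\<exists>z. fval i \<O> x z \<and> reduces_at (a, b, e) \<O> j x z" if "\<O> \<in> models \<sigma>" for \<O> x
    using that \<open>\<And>\<O> x. \<O> \<in> models \<sigma> \<Longrightarrow> (\<And>z. fval i \<O> x z \<Longrightarrow> \<not> reduces_at (a, b, e) \<O> j x z) \<Longrightarrow> thesis\<close>
    by blast
  obtain \<sigma>' where \<sigma>': "reachable \<sigma>'" "extends \<sigma> \<sigma>'" "j \<notin> ran (tag \<sigma>')"
    "\<And>\<O>. \<O> \<in> models \<sigma>' \<Longrightarrow> \<not> collision (a, b, e) \<O>"
    using reachable_assigned[OF assms(1,2)] by blast
  obtain pf pa pb where p: "fclock i = poly pf" "nclock a = poly pa" "nclock b = poly pb"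
    using nclock_poly fclock_poly by metis
  \<comment> \<open>Pays for the run on an input of length n and for an accepting path of a or of b
    on its output.\<close>
  define r where "r n = (fclock i n + 1)\<^sup>2 + (nclock a (fclock i n) + 1)\<^sup>2 + (nclock b (fclock i n) + 1)\<^sup>2" for n
  obtain n where n: "level \<sigma> \<le> n" "(r n + 1)\<^sup>2 < 2 ^ n"
  proof -
    have "poly (((pf + 1)\<^sup>2 + (pcompose pa pf + 1)\<^sup>2 + (pcompose pb pf + 1)\<^sup>2 + 1)\<^sup>2) n = (r n + 1)\<^sup>2" for n
      by (simp add: r_def p poly_pcompose)
    then show ?thesis using that poly_less_power[of "level \<sigma>"] by metis
  qed
  let ?x = "replicate n False"
  have l: "level \<sigma> \<le> j + n + 3" using n(1) by simp
  from two_branches[OF assms(1) \<sigma>'(1-3) l n(2)] obtain \<O> where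
    \<O>: "\<forall>c. length (snd c) = n \<longrightarrow> \<O> c \<in> models \<sigma>" and
    gen: "\<forall>c b y. length (snd c) = n \<longrightarrow> length y = n \<longrightarrow> (gen j b y \<in> \<O> c \<longleftrightarrow> (b, y) = c)" and
    branches: "\<forall>b1 b2 b3 Q. (\<forall>c. length (snd c) = n \<longrightarrow> finite (Q c) \<and> weight (Q c) \<le> r n) \<longrightarrow>
       (\<exists>c1 c2 c3 \<O>'. fst c1 = b1 \<and> fst c2 = b2 \<and> fst c3 = b3 \<and>
         length (snd c1) = n \<and> length (snd c2) = n \<and> length (snd c3) = n \<and>
         \<O>' \<in> models \<sigma>' \<and> Q c1 \<inter> \<O> c1 = Q c1 \<inter> \<O>' \<and> Q c2 \<inter> \<O> c2 = Q c2 \<inter> \<O>' \<and>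
         Q c1 \<inter> Q c2 \<inter> \<O> c1 = Q c1 \<inter> Q c2 \<inter> \<O> c3)"
    by (elim exE conjE) (rule that)
  have wit: "?x \<in> witness_lang (\<O> c) j True \<longleftrightarrow> fst c" if "length (snd c) = n" for c
  proof -
    have "?x \<in> witness_lang (\<O> c) j True \<longleftrightarrow> (\<exists>y. length y = n \<and> (True, y) = c)"
      using gen[rule_format, OF that] by (simp add: witness_lang_def cong: conj_cong)
    then show ?thesis using that by (cases c) auto
  qed
  define k where "k c = (if fst c then a else b)" for c :: "bool \<times> word"
  \<comment> \<open>For UP and bit False there is no path to offer; the empty list is a placeholder
    without queries.\<close>
  have "\<exists>z cs. length (snd c) = n \<longrightarrow> fval i (\<O> c) ?x z \<and>
      (if fst c \<or> \<not> e then acc (k c) (\<O> c) z cs else cs = [] \<and> z \<notin> nlang a (\<O> c))" for c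
  proof (cases "length (snd c) = n")
    case True
    then obtain z where z: "fval i (\<O> c) ?x z" "reduces_at (a, b, e) (\<O> c) j ?x z" using red \<O> by blast
    show ?thesis
    proof (cases "fst c \<or> \<not> e")
      case True
      then have "z \<in> nlang (k c) (\<O> c)"
        using z(2) wit[OF \<open>length (snd c) = n\<close>] by (auto simp: k_def split: if_splits)
      then show ?thesis using z(1) True unfolding nlang_def by auto
    next
      case False
      then show ?thesis using z wit[OF \<open>length (snd c) = n\<close>] by auto
    qed
  qed blast
  then obtain z cs where z: "\<And>c. length (snd c) = n \<Longrightarrow> fval i (\<O> c) ?x (z c)"
    and cs: "\<And>c. length (snd c) = n \<Longrightarrow>
      if fst c \<or> \<not> e then acc (k c) (\<O> c) (z c) (cs c) else cs c = [] \<and> z c \<notin> nlang a (\<O> c)"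
    by metis
  define F where "F c = fqueries i (\<O> c) ?x" for c
  define P where "P c = queries (nmach (k c)) (cs c)" for c
  have Q: "finite (F c \<union> P c) \<and> weight (F c \<union> P c) \<le> r n" if c: "length (snd c) = n" for c
  proof -
    have l: "length (z c) \<le> fclock i n" using fval_length[OF z[OF c]] by simp
    have "weight (P c) \<le> (nclock a (fclock i n) + 1)\<^sup>2 + (nclock b (fclock i n) + 1)\<^sup>2"
    proof (cases "fst c \<or> \<not> e")
      case True
      then have "acc (k c) (\<O> c) (z c) (cs c)" using cs[OF c] by simp
      then have "weight (P c) \<le> (nclock (k c) (length (z c)) + 1)\<^sup>2" using acc_weight by (simp add: P_def)
      also have "\<dots> \<le> (nclock (k c) (fclock i n) + 1)\<^sup>2"
        using nclock_mono[OF l, of "k c"] by (intro power_mono) auto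
      finally show ?thesis by (simp add: k_def split: if_splits)
    next
      case False
      then show ?thesis using cs[OF c] by (simp add: P_def queries_def)
    qed
    moreover have "weight (F c) \<le> (fclock i n + 1)\<^sup>2"
      using fqueries_weight[of i "\<O> c" ?x] by (simp add: F_def)
    moreover have fin: "finite (F c)" "finite (P c)"
      using fqueries_finite finite_queries by (auto simp: F_def P_def)
    ultimately show ?thesis using weight_Un[OF fin] by (simp add: r_def)
  qed
  have fval_eq: "fval i \<O>' ?x (z c)"
    if "length (snd c) = n" "S \<inter> \<O> c = S \<inter> \<O>'" "F c \<subseteq> S" for c \<O>' S
  proof -
    have "fval i (\<O> c) ?x = fval i \<O>' ?x"
      using that by (intro fqueries_cong(2)) (auto simp: F_def)
    then show ?thesis using z[OF that(1)] by simp
  qed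
  have acc_eq: "acc (k c) \<O>' (z c) (cs c)"
    if "length (snd c) = n" "S \<inter> \<O> c = S \<inter> \<O>'" "P c \<subseteq> S" "fst c \<or> \<not> e" for c \<O>' S
  proof -
    have "acc (k c) (\<O> c) (z c) (cs c)" using cs[OF that(1)] that(4) by simp
    moreover have "queries (nmach (k c)) (cs c) \<inter> \<O> c = queries (nmach (k c)) (cs c) \<inter> \<O>'"
      using that(2,3) unfolding P_def by blast
    ultimately show ?thesis using acc_cong by blast
  qed
  \<comment> \<open>The second bit is e: False for a pair, to get a path of b, and True for UP, to
    get another path of the same machine.\<close>
  obtain c1 c2 c3 \<O>' where c: "fst c1 = True" "fst c2 = e" "fst c3 = False"
    "length (snd c1) = n" "length (snd c2) = n" "length (snd c3) = n" "\<O>' \<in> models \<sigma>'"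
    and Q1: "(F c1 \<union> P c1) \<inter> \<O> c1 = (F c1 \<union> P c1) \<inter> \<O>'"
    and Q2: "(F c2 \<union> P c2) \<inter> \<O> c2 = (F c2 \<union> P c2) \<inter> \<O>'"
    and Q3: "(F c1 \<union> P c1) \<inter> (F c2 \<union> P c2) \<inter> \<O> c1 = (F c1 \<union> P c1) \<inter> (F c2 \<union> P c2) \<inter> \<O> c3"
    using branches[rule_format, of "\<lambda>c. F c \<union> P c" True e False, OF Q] by blast
  have z12: "z c1 = z c2"
    using fval_eq[OF c(4) Q1] fval_eq[OF c(5) Q2] fval_unique by blast
  have k: "k c1 = a" "k c2 = b" using c(1,2) assms(3) by (auto simp: k_def)
  have acc1: "acc a \<O>' (z c1) (cs c1)" using acc_eq[OF c(4) Q1] c(1) k by auto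
  have acc2: "acc b \<O>' (z c1) (cs c2)" using acc_eq[OF c(5) Q2] c(2) k z12 by auto
  have "e" and eq: "cs c1 = cs c2" using \<sigma>'(4)[OF c(7)] acc1 acc2 unfolding collision_def by blast+
  have P12: "P c1 = P c2" using eq k assms(3) \<open>e\<close> by (simp add: P_def)
  have "q \<in> \<O> c1 \<longleftrightarrow> q \<in> \<O> c2" if "q \<in> F c1" "q \<in> F c2" for q
    using that Q1 Q2 by blast
  then have F12: "F c1 = F c2" unfolding F_def by (intro fqueries_cong(1)) auto
  \<comment> \<open>The first two branches ask the same words, so the intersection is the whole set
    and the third branch agrees on all of it.\<close>
  have Q3: "(F c1 \<union> P c1) \<inter> \<O> c1 = (F c1 \<union> P c1) \<inter> \<O> c3" using Q3 P12 F12 by blast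
  have "z c3 = z c1" using fval_eq[OF c(4) Q3] z[OF c(6)] fval_unique by blast
  moreover have "acc a (\<O> c3) (z c1) (cs c1)" using acc_eq[OF c(4) Q3] c(1) k by auto
  ultimately show False using cs[OF c(6)] c(3) \<open>e\<close> unfolding nlang_def by auto
qed

section \<open>The generic oracle\<close>

lemma acc_agree:
  assumes "agree (below N) \<O> \<O>'" "nclock k (length y) < N" "acc k \<O> y cs"
  shows "acc k \<O>' y cs"
proof -
  have p: "path (nmach k) \<O> y cs" "length cs \<le> nclock k (length y) + 1"
    using assms(3) by (auto simp: acc_def accepting_path_def halting_path_def)
  have "q \<in> \<O> \<longleftrightarrow> q \<in> \<O>'" if "q \<in> queries (nmach k) cs" for q
    using query_length[OF nmach_wf p(1) that] p(2) assms(2) by (intro agree_below_iff[OF assms(1)]) simp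
  then have "queries (nmach k) cs \<inter> \<O> = queries (nmach k) cs \<inter> \<O>'" by blast
  then show ?thesis using acc_cong assms(3) by blast
qed

lemma nlang_agree:
  "agree (below N) \<O> \<O>' \<Longrightarrow> nclock k (length y) < N \<Longrightarrow> y \<in> nlang k \<O> \<longleftrightarrow> y \<in> nlang k \<O>'"
  unfolding nlang_def using acc_agree agree_sym by blast

lemma fval_agree:
  assumes "agree (below N) \<O> \<O>'" "fclock i (length x) < N"
  shows "fval i \<O> x y \<longleftrightarrow> fval i \<O>' x y"
proof -
  have "q \<in> \<O> \<longleftrightarrow> q \<in> \<O>'" if q: "q \<in> fqueries i \<O> x" for q
  proof -
    obtain cs where cs: "path (fmach i) \<O> x cs" "length cs \<le> fclock i (length x) + 1" "q \<in> queries (fmach i) cs"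
      using q unfolding fqueries_def run_queries_def by blast
    show ?thesis
      using query_length[OF fmach_wf cs(1,3)] cs(2) assms(2) by (intro agree_below_iff[OF assms(1)]) simp
  qed
  then show ?thesis using fqueries_cong(2)[of i \<O> x \<O>'] by simp
qed

lemma witness_lang_agree:
  assumes "agree (below N) \<O> \<O>'" "j + length x + 3 < N"
  shows "x \<in> witness_lang \<O> j b \<longleftrightarrow> x \<in> witness_lang \<O>' j b"
proof -
  have "gen j b y \<in> \<O> \<longleftrightarrow> gen j b y \<in> \<O>'" if "length y = length x" for y
    using assms(2) that by (intro agree_below_iff[OF assms(1)]) (simp add: length_gen)
  then show ?thesis unfolding witness_lang_def by auto
qed

section \<open>Requirements and their satisfaction by extension\<close>

definition decided_proof :: "nat \<Rightarrow> nat \<Rightarrow> forcing \<Rightarrow> bool" where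
  "decided_proof k i \<sigma> \<longleftrightarrow>
     (\<exists>x y. \<forall>\<O> \<in> models \<sigma>. fval i \<O> x y \<and> y \<notin> nlang k \<O>) \<or> (\<exists>m. (k, i, m) \<in> decl \<sigma>)"

definition decided_task :: "task \<Rightarrow> nat \<Rightarrow> forcing \<Rightarrow> bool" where
  "decided_task T i \<sigma> \<longleftrightarrow> (\<forall>\<O> \<in> models \<sigma>. collision T \<O>) \<or>
     (\<exists>j x. tag \<sigma> T = Some j \<and> (\<forall>\<O> \<in> models \<sigma>. \<forall>z. fval i \<O> x z \<longrightarrow> \<not> reduces_at T \<O> j x z))"

lemma decided_proof_extends: "decided_proof k i \<sigma> \<Longrightarrow> extends \<tau> \<sigma> \<Longrightarrow> decided_proof k i \<tau>"
  using extends_models[of \<tau> \<sigma>] unfolding decided_proof_def extends_def by blast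

lemma decided_task_extends:
  assumes "decided_task T i \<sigma>" "extends \<tau> \<sigma>"
  shows "decided_task T i \<tau>"
proof -
  have "tag \<tau> T = Some j" if "tag \<sigma> T = Some j" for j
    using assms(2) that unfolding extends_def map_le_def by (metis domI)
  then show ?thesis using assms(1) extends_models[OF assms(2)] unfolding decided_task_def by blast
qed

lemma decide_proof:
  assumes "reachable \<sigma>"
  shows "\<exists>\<tau>. reachable \<tau> \<and> extends \<tau> \<sigma> \<and> decided_proof k i \<tau>"
proof (cases "\<exists>\<O> \<in> models \<sigma>. \<exists>x y. fval i \<O> x y \<and> y \<notin> nlang k \<O>")
  case True
  then obtain \<O> x y where \<O>: "\<O> \<in> models \<sigma>" "fval i \<O> x y" "y \<notin> nlang k \<O>" by blast
  obtain \<tau> where \<tau>: "reachable \<tau>" "extends \<tau> \<sigma>"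
    "\<And>\<O>'. \<O>' \<in> models \<tau> \<Longrightarrow> agree (below (fclock i (length x) + nclock k (length y) + 1)) \<O>' \<O>"
    using grow_to[OF assms \<O>(1)] by blast
  have "fval i \<O>' x y \<and> y \<notin> nlang k \<O>'" if "\<O>' \<in> models \<tau>" for \<O>'
    using fval_agree[OF \<tau>(3)[OF that], of i x y] nlang_agree[OF \<tau>(3)[OF that], of k y] \<O> by simp
  then show ?thesis using \<tau>(1,2) unfolding decided_proof_def by blast
next
  case False
  then have "reachable (\<sigma>\<lparr>decl := insert (k, i, level \<sigma>) (decl \<sigma>)\<rparr>)"
    using reachable.promise[OF assms] by blast
  moreover have "decided_proof k i (\<sigma>\<lparr>decl := insert (k, i, level \<sigma>) (decl \<sigma>)\<rparr>)"
    unfolding decided_proof_def by auto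
  ultimately show ?thesis using extends_promise by blast
qed

lemma reachable_finite_tags: "reachable \<sigma> \<Longrightarrow> finite (ran (tag \<sigma>))"
proof (induction rule: reachable.induct)
  case (assign \<sigma> T j)
  then show ?case by (simp del: fun_upd_apply)
qed auto

lemma collide_or_assign:
  assumes "reachable \<sigma>"
  shows "\<exists>\<tau>. reachable \<tau> \<and> extends \<tau> \<sigma> \<and> ((\<forall>\<O> \<in> models \<tau>. collision T \<O>) \<or> tag \<tau> T \<noteq> None)"
proof (cases "tag \<sigma> T \<noteq> None")
  case False
  show ?thesis
  proof (cases "\<exists>\<O> \<in> models \<sigma>. collision T \<O>")
    case True
    obtain a b e where T: "T = (a, b, e)" by (cases T)
    obtain \<O> z cs cs' where \<O>: "\<O> \<in> models \<sigma>" "acc a \<O> z cs" "acc b \<O> z cs'" "e \<longrightarrow> cs \<noteq> cs'"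
      using True unfolding T collision_def by blast
    obtain \<tau> where \<tau>: "reachable \<tau>" "extends \<tau> \<sigma>"
      "\<And>\<O>'. \<O>' \<in> models \<tau> \<Longrightarrow> agree (below (nclock a (length z) + nclock b (length z) + 1)) \<O>' \<O>"
      using grow_to[OF assms \<O>(1)] by blast
    have "collision T \<O>'" if "\<O>' \<in> models \<tau>" for \<O>'
      using acc_agree[OF agree_sym[OF \<tau>(3)[OF that]], of a z cs]
        acc_agree[OF agree_sym[OF \<tau>(3)[OF that]], of b z cs'] \<O> unfolding T collision_def by auto
    then show ?thesis using \<tau> by blast
  next
    case no: False
    obtain m where m: "\<And>j. j \<in> ran (tag \<sigma>) \<Longrightarrow> j < m"
      using reachable_finite_tags[OF assms] unfolding finite_nat_set_iff_bounded by blast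
    let ?j = "max m (level \<sigma>)"
    have "?j \<notin> ran (tag \<sigma>)" using m by fastforce
    then have "reachable (\<sigma>\<lparr>tag := (tag \<sigma>)(T \<mapsto> ?j)\<rparr>)"
      using reachable.assign[OF assms] no False by simp
    moreover have "extends (\<sigma>\<lparr>tag := (tag \<sigma>)(T \<mapsto> ?j)\<rparr>) \<sigma>" using False by (intro extends_assign) simp
    ultimately show ?thesis by (intro exI[of _ "\<sigma>\<lparr>tag := (tag \<sigma>)(T \<mapsto> ?j)\<rparr>"]) simp
  qed
qed (use assms extends_refl in blast)

lemma reduces_at_agree:
  assumes "agree (below N) \<O> \<O>'" "nclock a (length z) < N" "nclock b (length z) < N" "j + length x + 3 < N"
  shows "reduces_at (a, b, e) \<O> j x z \<longleftrightarrow> reduces_at (a, b, e) \<O>' j x z"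
  using nlang_agree[OF assms(1,2)] nlang_agree[OF assms(1,3)] witness_lang_agree[OF assms(1,4)] by simp

lemma decide_task:
  assumes "reachable \<sigma>" "T = (a, b, e)" "e \<longrightarrow> a = b"
  shows "\<exists>\<tau>. reachable \<tau> \<and> extends \<tau> \<sigma> \<and> decided_task T i \<tau>"
proof -
  obtain \<rho> where \<rho>: "reachable \<rho>" "extends \<rho> \<sigma>" "(\<forall>\<O> \<in> models \<rho>. collision T \<O>) \<or> tag \<rho> T \<noteq> None"
    using collide_or_assign[OF assms(1)] by blast
  show ?thesis
  proof (cases "tag \<rho> T")
    case None
    then show ?thesis using \<rho> unfolding decided_task_def by blast
  next
    case (Some j)
    obtain \<O> x where \<O>: "\<O> \<in> models \<rho>" "\<And>z. fval i \<O> x z \<Longrightarrow> \<not> reduces_at T \<O> j x z"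
      using diagonalise[OF \<rho>(1) _ assms(3)] Some assms(2) by metis
    \<comment> \<open>The only possible value, named also in case the clocked run yields none. The
      bound N then covers the run on x, both languages at z, and the words with tag j that decide
      x.\<close>
    obtain z where z: "\<And>z'. fval i \<O> x z' \<Longrightarrow> z' = z" using fval_unique by metis
    define N where "N = fclock i (length x) + nclock a (length z) + nclock b (length z) + j + length x + 4"
    obtain \<tau> where \<tau>: "reachable \<tau>" "extends \<tau> \<rho>" "\<And>\<O>'. \<O>' \<in> models \<tau> \<Longrightarrow> agree (below N) \<O>' \<O>"
      using grow_to[OF \<rho>(1) \<O>(1)] by blast
    have "\<not> reduces_at T \<O>' j x z'" if "\<O>' \<in> models \<tau>" "fval i \<O>' x z'" for \<O>' z'
    proof -
      have "fval i \<O> x z'" using fval_agree[OF \<tau>(3)[OF that(1)]] that(2) by (simp add: N_def)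
      then have "\<not> reduces_at T \<O> j x z'" "z' = z" using \<O>(2) z by blast+
      then show ?thesis using reduces_at_agree[OF \<tau>(3)[OF that(1)]] assms(2) by (simp add: N_def del: reduces_at.simps)
    qed
    moreover have "tag \<tau> T = Some j" using \<tau>(2) Some unfolding extends_def map_le_def by (metis domI)
    ultimately have "decided_task T i \<tau>" unfolding decided_task_def by blast
    then show ?thesis using \<tau> extends_trans[OF _ \<rho>(2)] by blast
  qed
qed

lemma decide_all:
  assumes "reachable \<sigma>"
  shows "\<exists>\<tau>. reachable \<tau> \<and> extends \<tau> \<sigma> \<and> s \<le> level \<tau> \<and> decided_proof k i \<tau> \<and>
    decided_task (a, b, False) i \<tau> \<and> decided_task (a, a, True) i \<tau>"
proof -
  obtain \<sigma>1 where 1: "reachable \<sigma>1" "extends \<sigma>1 \<sigma>" "decided_proof k i \<sigma>1"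
    using decide_proof[OF assms] by blast
  obtain \<sigma>2 where 2: "reachable \<sigma>2" "extends \<sigma>2 \<sigma>1" "decided_task (a, b, False) i \<sigma>2"
    using decide_task[OF 1(1) refl, of False a b i] by blast
  obtain \<sigma>3 where 3: "reachable \<sigma>3" "extends \<sigma>3 \<sigma>2" "decided_task (a, a, True) i \<sigma>3"
    using decide_task[OF 2(1) refl, of True a a i] by blast
  obtain \<O> where "\<O> \<in> models \<sigma>3" using reachable_model[OF 3(1)] .
  then obtain \<tau> where 4: "reachable \<tau>" "extends \<tau> \<sigma>3" "s \<le> level \<tau>"
    using grow_to[OF 3(1)] by metis
  have "extends \<tau> \<sigma>2" "extends \<tau> \<sigma>1" "extends \<tau> \<sigma>"
    using extends_trans 1(2) 2(2) 3(2) 4(2) by blast+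
  then show ?thesis
    using 1(3) 2(3) 3(3) 4 decided_proof_extends decided_task_extends by blast
qed

section \<open>A generic chain of conditions and its limit\<close>

lemma generic_chain:
  obtains \<sigma> where "\<And>s. reachable (\<sigma> s)" "\<And>s t. s \<le> t \<Longrightarrow> extends (\<sigma> t) (\<sigma> s)" "\<And>s. s \<le> level (\<sigma> s)"
    "\<And>k i. \<exists>s. decided_proof k i (\<sigma> s)" "\<And>a b i. \<exists>s. decided_task (a, b, False) i (\<sigma> s)"
    "\<And>a i. \<exists>s. decided_task (a, a, True) i (\<sigma> s)"
proof -
  \<comment> \<open>Step s handles the quadruple of indices coded by s. The growing level makes the
    limit fully determined.\<close>
  define Q where "Q s \<sigma> \<tau> \<longleftrightarrow> extends \<tau> \<sigma> \<and> Suc s \<le> level \<tau> \<and> (\<forall>k i a b. s = to_nat (k :: nat, i :: nat, a :: nat, b :: nat) \<longrightarrow>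
     decided_proof k i \<tau> \<and> decided_task (a, b, False) i \<tau> \<and> decided_task (a, a, True) i \<tau>)"
    for s \<sigma> \<tau>
  have "\<exists>\<sigma>. \<forall>s. reachable (\<sigma> s) \<and> Q s (\<sigma> s) (\<sigma> (Suc s))"
  proof (rule dependent_nat_choice)
    show "\<exists>\<sigma>. reachable \<sigma>" using reachable.initial by blast
    fix \<sigma> s assume "reachable \<sigma>"
    obtain k i a b where d: "from_nat s = (k :: nat, i :: nat, a :: nat, b :: nat)" by (metis prod_cases4)
    have "Q s \<sigma> \<tau>" if "extends \<tau> \<sigma> \<and> Suc s \<le> level \<tau> \<and> decided_proof k i \<tau> \<and>
        decided_task (a, b, False) i \<tau> \<and> decided_task (a, a, True) i \<tau>" for \<tau>
      unfolding Q_def using that d by auto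
    then show "\<exists>\<tau>. reachable \<tau> \<and> Q s \<sigma> \<tau>"
      using decide_all[OF \<open>reachable \<sigma>\<close>, of "Suc s" k i a b] by blast
  qed
  then obtain \<sigma> where \<sigma>: "\<And>s. reachable (\<sigma> s)" "\<And>s. Q s (\<sigma> s) (\<sigma> (Suc s))" by blast
  show ?thesis
  proof (rule that[of \<sigma>, OF \<sigma>(1)])
    show "extends (\<sigma> t) (\<sigma> s)" if "s \<le> t" for s t
      using that
    proof (induction t rule: dec_induct)
      case (step t)
      have "extends (\<sigma> (Suc t)) (\<sigma> t)" using \<sigma>(2)[of t] unfolding Q_def by blast
      then show ?case using step.IH extends_trans by blast
    qed simp
    show "s \<le> level (\<sigma> s)" for s
      using \<sigma>(2) unfolding Q_def by (cases s) auto
    show "\<exists>s. decided_proof k i (\<sigma> s)" for k i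
      using \<sigma>(2)[of "to_nat (k, i, 0 :: nat, 0 :: nat)"] unfolding Q_def by blast
    show "\<exists>s. decided_task (a, b, False) i (\<sigma> s)" for a b i
      using \<sigma>(2)[of "to_nat (0 :: nat, i, a, b)"] unfolding Q_def by blast
    show "\<exists>s. decided_task (a, a, True) i (\<sigma> s)" for a i
      using \<sigma>(2)[of "to_nat (0 :: nat, i, a, 0 :: nat)"] unfolding Q_def by blast
  qed
qed

lemma chain_limit:
  assumes "\<And>s. reachable (\<sigma> s)" "\<And>s t. s \<le> t \<Longrightarrow> extends (\<sigma> t) (\<sigma> s)" "\<And>s :: nat. s \<le> level (\<sigma> s)"
  obtains \<O> where "\<And>s. \<O> \<in> models (\<sigma> s)"
proof -
  \<comment> \<open>The level of stage \<open>Suc (length (item w))\<close> exceeds the length of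
    the item of w, so w is fixed from there on.\<close>
  define \<O> where "\<O> = {w. w \<in> seg (\<sigma> (Suc (length (item w))))}"
  have agr: "agree (below (level (\<sigma> s))) (seg (\<sigma> t)) (seg (\<sigma> s))" if "s \<le> t" for s t
    using assms(2)[OF that] unfolding extends_def by blast
  have \<O>: "agree (below (level (\<sigma> s))) (seg (\<sigma> s)) \<O>" for s
    unfolding agree_def
  proof (intro allI impI)
    fix q assume q: "item q \<in> below (level (\<sigma> s))"
    let ?t = "Suc (length (item q))"
    have "item q \<in> below (level (\<sigma> ?t))" using assms(3)[of ?t] by simp
    then have "q \<in> seg (\<sigma> s) \<longleftrightarrow> q \<in> seg (\<sigma> ?t)"
      using agr[of s ?t] agr[of ?t s] q unfolding agree_def by (meson nat_le_linear)
    then show "q \<in> seg (\<sigma> s) \<longleftrightarrow> q \<in> \<O>" by (simp add: \<O>_def)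
  qed
  have "valid_below (\<sigma> s) l \<O>" for s l
  proof -
    let ?t = "max s l"
    have e: "extends (\<sigma> ?t) (\<sigma> s)" using assms(2) by simp
    have "valid_below (\<sigma> ?t) (level (\<sigma> ?t)) (seg (\<sigma> ?t))" using reachable_sound assms(1) by blast
    then have "valid_below (\<sigma> s) (level (\<sigma> ?t)) (seg (\<sigma> ?t))" by (rule extends_valid_below[OF e])
    then have "valid_below (\<sigma> s) (level (\<sigma> ?t)) \<O>"
      using e by (intro valid_below_agree[OF \<O>]) (auto simp: extends_def)
    moreover have "l \<le> level (\<sigma> ?t)" using assms(3)[of ?t] by simp
    ultimately show ?thesis by (rule valid_below_mono)
  qed
  then show ?thesis using that unfolding models_def by blast
qed

definition proof_complete :: "word set \<Rightarrow> nat \<Rightarrow> nat \<Rightarrow> nat \<Rightarrow> bool" where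
  "proof_complete \<O> k i m \<longleftrightarrow> (\<forall>x y t. fval i \<O> x y \<longrightarrow> threshold k i (length x) \<le> t \<longrightarrow> m \<le> t \<longrightarrow>
     code k (fproof i x t) 0 \<in> \<O>)"

definition separating_tag :: "word set \<Rightarrow> task \<Rightarrow> nat \<Rightarrow> bool" where
  "separating_tag \<O> T j \<longleftrightarrow> (\<forall>n. one_at \<O> j n) \<and>
     (\<forall>i. \<exists>x. \<forall>z. fval i \<O> x z \<longrightarrow> \<not> reduces_at T \<O> j x z)"

lemma generic_oracle:
  obtains \<O> where "\<And>k u. valid_at {} \<O> k u"
    "\<And>k i. (\<And>x y. fval i \<O> x y \<Longrightarrow> y \<in> nlang k \<O>) \<Longrightarrow> \<exists>m. proof_complete \<O> k i m"
    "\<And>a b. \<not> collision (a, b, False) \<O> \<Longrightarrow> \<exists>j. separating_tag \<O> (a, b, False) j"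
    "\<And>a. \<not> collision (a, a, True) \<O> \<Longrightarrow> \<exists>j. separating_tag \<O> (a, a, True) j"
proof -
  obtain \<sigma> where \<sigma>: "\<And>s. reachable (\<sigma> s)" "\<And>s t. s \<le> t \<Longrightarrow> extends (\<sigma> t) (\<sigma> s)" "\<And>s. s \<le> level (\<sigma> s)"
    and proofs: "\<And>k i. \<exists>s. decided_proof k i (\<sigma> s)"
    and tasks: "\<And>a b i. \<exists>s. decided_task (a, b, False) i (\<sigma> s)" "\<And>a i. \<exists>s. decided_task (a, a, True) i (\<sigma> s)"
    by (rule generic_chain) (rule that; assumption)
  obtain \<O> where \<O>: "\<And>s. \<O> \<in> models (\<sigma> s)"
    using chain_limit[OF \<sigma>] by blast
  have separating: "\<exists>j. separating_tag \<O> T j" if no: "\<not> collision T \<O>" and dec: "\<And>i. \<exists>s. decided_task T i (\<sigma> s)" for T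
  proof -
    have *: "\<exists>s j x. tag (\<sigma> s) T = Some j \<and> (\<forall>z. fval i \<O> x z \<longrightarrow> \<not> reduces_at T \<O> j x z)" for i
      using dec[of i] no \<O> unfolding decided_task_def by blast
    then obtain s j where j: "tag (\<sigma> s) T = Some j" by blast
    \<comment> \<open>Different functions may be defeated at different stages, but extensions keep
      tags, so one tag defeats them all.\<close>
    have "j' = j" if "tag (\<sigma> t) T = Some j'" for t j'
    proof -
      have "tag (\<sigma> (max s t)) T = Some j" "tag (\<sigma> (max s t)) T = Some j'"
        using \<sigma>(2)[of s "max s t"] \<sigma>(2)[of t "max s t"] j that
        unfolding extends_def map_le_def by (metis domI max.cobounded1, metis domI max.cobounded2)
      then show ?thesis by simp
    qed
    moreover have "one_at \<O> j n" for n using modelsD(2)[OF \<O>] j by (metis ranI)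
    ultimately have "separating_tag \<O> T j" using * unfolding separating_tag_def by metis
    then show ?thesis ..
  qed
  show ?thesis
  proof (rule that[of \<O>])
    \<comment> \<open>Even without promises all certificates are governed, which suffices for the
      range of the proof system; promised runs are covered by \<open>proof_complete\<close>.\<close>
    show "valid_at {} \<O> k u" for k u
    proof -
      have "valid_at (decl (\<sigma> 0)) \<O> k u" by (rule modelsD(1)[OF \<O>])
      then show ?thesis using governed_mono[of "{}" k u] unfolding valid_at_def by blast
    qed
    show "\<exists>m. proof_complete \<O> k i m" if sound: "\<And>x y. fval i \<O> x y \<Longrightarrow> y \<in> nlang k \<O>" for k i
    proof -
      obtain s where "decided_proof k i (\<sigma> s)" using proofs by blast
      then obtain m where m: "(k, i, m) \<in> decl (\<sigma> s)"
        using sound \<O>[of s] unfolding decided_proof_def by blast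
      have "code k (fproof i x t) 0 \<in> \<O>"
        if "fval i \<O> x y" "threshold k i (length x) \<le> t" "m \<le> t" for x y t
      proof -
        have "m \<le> length (code k (fproof i x t) 0)" using that(3) by (simp add: length_code length_fproof)
        then have "governed (decl (\<sigma> s)) k (fproof i x t)" using m unfolding governed_def by blast
        moreover have "proves \<O> k (fproof i x t) y" using that by (simp add: proves_simps)
        ultimately show ?thesis using modelsD(1)[OF \<O>, of s k] unfolding valid_at_def by blast
      qed
      then show ?thesis unfolding proof_complete_def by blast
    qed
  qed (use separating tasks in blast)+
qed

section \<open>Concrete machines\<close>

subsection \<open>Guessing a suffix of a query\<close>

text \<open>The states from 3 on write v one symbol each; the state after them guesses a bit per
  input symbol, so that the input merely counts the guesses.\<close>

definition guess_trans :: "word \<Rightarrow> transitions" where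
  "guess_trans v q a f =
     (if 3 \<le> q \<and> q < 3 + length v then {(q + 1, False, Some (v ! (q - 3)), None, None)}
      else if q = 3 + length v then
        (if a = None then {(0, False, None, None, None)} else range (\<lambda>b. (q, True, Some b, None, None)))
      else {})"

inductive guess_inv :: "word set \<Rightarrow> word \<Rightarrow> word \<Rightarrow> stream_config \<Rightarrow> bool" for \<O> v x where
  prefix: "s < length v \<Longrightarrow> q = 3 + s \<Longrightarrow> guess_inv \<O> v x (q, 0, take s v, [], None)"
| guess: "length y = p \<Longrightarrow> p \<le> length x \<Longrightarrow> q = 3 + length v \<Longrightarrow> guess_inv \<O> v x (q, p, v @ y, [], None)"
| ask: "length y = length x \<Longrightarrow> guess_inv \<O> v x (0, length x, v @ y, [], None)"
| answer: "length y = length x \<Longrightarrow> q = (if v @ y \<in> \<O> then 1 else 2) \<Longrightarrow>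
    guess_inv \<O> v x (q, length x, v @ y, [], None)"

fun guess_rank :: "word \<Rightarrow> word \<Rightarrow> stream_config \<Rightarrow> nat" where
  "guess_rank v x (q, p, w, z, f) =
     (if q = 0 then 1 else if q \<le> 2 then 0 else (3 + length v - q) + (length x - p) + 2)"

lemma guess_inv_init: "guess_inv \<O> v x (3, 0, [], [], None)"
  using guess_inv.prefix[of 0 v 3] guess_inv.guess[of "[]" 0 x 3 v] by (cases v) auto

lemma guess_step:
  assumes "guess_inv \<O> v x a" "stream_step (guess_trans v) \<O> x a a'"
  shows "guess_inv \<O> v x a' \<and> guess_rank v x a' < guess_rank v x a"
  using assms(1)
proof cases
  case (prefix s q)
  then have a': "a' = (4 + s, 0, take (Suc s) v, [], None)"
    using assms(2) by (cases a') (auto simp: guess_trans_def take_Suc_conv_app_nth)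
  have "guess_inv \<O> v x a'"
  proof (cases "Suc s < length v")
    case True
    then show ?thesis unfolding a' by (intro guess_inv.prefix) auto
  next
    case False
    then have "Suc s = length v" using prefix by simp
    then show ?thesis using guess_inv.guess[of "[]" 0 x "4 + s" v] unfolding a' by simp
  qed
  then show ?thesis using prefix a' by simp
next
  case (guess y p q)
  show ?thesis
  proof (cases "p < length x")
    case True
    then obtain b where a': "a' = (q, Suc p, v @ y @ [b], [], None)"
      using assms(2) guess by (cases a') (auto simp: guess_trans_def symbol_at_def)
    show ?thesis unfolding a' using True guess by (auto intro!: guess_inv.guess)
  next
    case False
    then have a': "a' = (0, length x, v @ y, [], None)"
      using assms(2) guess by (cases a') (auto simp: guess_trans_def symbol_at_def)
    show ?thesis unfolding a' using False guess by (auto intro!: guess_inv.ask)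
  qed
next
  case (ask y)
  then have "a' = (if v @ y \<in> \<O> then 1 else 2, length x, v @ y, [], None)"
    using assms(2) by (cases a') auto
  then show ?thesis using ask guess_inv.answer by simp
next
  case (answer y q)
  then show ?thesis using assms(2) by (cases a') (auto simp: guess_trans_def split: if_splits)
qed

text \<open>The guesses stay on the query tape, so a configuration remembers how it was
  reached.\<close>

lemma guess_backward:
  assumes "guess_inv \<O> v x a" "guess_inv \<O> v x b"
    and "stream_step (guess_trans v) \<O> x a c" "stream_step (guess_trans v) \<O> x b c"
  shows "a = b"
proof -
  obtain q p w z f where c: "c = (q, p, w, z, f)" by (metis prod_cases5)
  show ?thesis
    using assms(1) by (cases; use assms(2) in cases)
      (use assms(3,4) in \<open>auto simp: c guess_trans_def symbol_at_def split: if_splits\<close>)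
qed

lemma stream_stepI:
  assumes "(q', mv, b, c, f') \<in> \<delta> q (symbol_at x p) f" "q \<noteq> 0"
  shows "stream_step \<delta> \<O> x (q, p, w, z, f) (q', p + of_bool mv, append_symbol w b, append_symbol z c, f')"
  unfolding stream_step.simps using assms by (simp only: if_False) blast

lemma guess_reach:
  assumes "length y = length x" "v @ y \<in> \<O>"
  shows "(stream_step (guess_trans v) \<O> x)\<^sup>*\<^sup>* (3, 0, [], [], None) (1, length x, v @ y, [], None)"
proof -
  let ?R = "(stream_step (guess_trans v) \<O> x)\<^sup>*\<^sup>*"
  have 1: "?R (3, 0, [], [], None) (3 + s, 0, take s v, [], None)" if "s \<le> length v" for s
    using that
  proof (induction s)
    case (Suc s)
    have "stream_step (guess_trans v) \<O> x (3 + s, 0, take s v, [], None) (3 + Suc s, 0, take (Suc s) v, [], None)"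
      using Suc.prems by (auto simp: guess_trans_def take_Suc_conv_app_nth)
    then show ?case using Suc by (meson Suc_leD rtranclp.rtrancl_into_rtrancl)
  qed simp
  have 2: "?R (3 + length v, 0, v, [], None) (3 + length v, p, v @ take p y, [], None)" if "p \<le> length x" for p
    using that
  proof (induction p)
    case (Suc p)
    have "stream_step (guess_trans v) \<O> x (3 + length v, p, v @ take p y, [], None)
        (3 + length v, Suc p, v @ take (Suc p) y, [], None)"
      using stream_stepI[of "3 + length v" True "Some (y ! p)" None None "guess_trans v" "3 + length v" x p None
          \<O> "v @ take p y" "[]"] Suc.prems assms(1)
      by (simp add: guess_trans_def symbol_at_def take_Suc_conv_app_nth)
    then show ?case using Suc by (meson Suc_leD rtranclp.rtrancl_into_rtrancl)
  qed simp
  have 3: "stream_step (guess_trans v) \<O> x (3 + length v, length x, v @ y, [], None) (0, length x, v @ y, [], None)"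
    by (auto simp: guess_trans_def)
  have 4: "stream_step (guess_trans v) \<O> x (0, length x, v @ y, [], None) (1, length x, v @ y, [], None)"
    using assms(2) by simp
  have "?R (3, 0, [], [], None) (3 + length v, 0, v, [], None)" using 1[of "length v"] by simp
  moreover have "?R (3 + length v, 0, v, [], None) (3 + length v, length x, v @ y, [], None)"
    using 2[of "length x"] assms(1) by simp
  ultimately have "?R (3, 0, [], [], None) (3 + length v, length x, v @ y, [], None)"
    by (rule rtranclp_trans)
  from rtranclp.rtrancl_into_rtrancl[OF rtranclp.rtrancl_into_rtrancl[OF this 3] 4]
  show ?thesis .
qed

abbreviation guess_machine :: "word \<Rightarrow> otm" where
  "guess_machine v \<equiv> stream_machine (guess_trans v) 3"

lemma guess_wf: "otm_wf (guess_machine v)"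
  by (rule stream_wf[where N = "4 + length v"]) (auto simp: guess_trans_def)

lemma guess_poly_time: "poly_time (guess_machine v) \<O>"
proof (rule stream_poly_time[where I = "guess_inv \<O> v" and \<mu> = "guess_rank v"])
  show "guess_rank v x (3, 0, [], [], None) \<le> poly [:length v + 2, 1:] (length x)" for x
    by simp
qed (use guess_inv_init guess_step in blast)+

lemma guess_last:
  assumes "accepting_path (guess_machine v) \<O> x cs"
  obtains y where "length y = length x" "v @ y \<in> \<O>" "last cs = stream_conf x (1, length x, v @ y, [], None)"
proof -
  have p: "path (guess_machine v) \<O> x cs" and s: "fst (last cs) = 1"
    using assms by (auto simp: accepting_path_def halting_path_def stream_machine_def)
  obtain a where a: "last cs = stream_conf x a" "guess_inv \<O> v x a"
    using stream_path_last[where I = "guess_inv \<O> v x" and \<mu> = "guess_rank v x", OF p guess_inv_init guess_step]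
    by blast
  have fst: "fst a = 1" using a(1) s by (cases a) simp
  from a(2) show ?thesis
  proof cases
    case (answer y q)
    have q: "q = 1" using fst unfolding answer(1) by simp
    have "v @ y \<in> \<O>"
    proof (rule ccontr)
      assume "v @ y \<notin> \<O>"
      then have "q = 2" unfolding answer(3) by (rule if_not_P)
      then show False using q by simp
    qed
    then show ?thesis using that[OF answer(2)] a(1) unfolding answer(1) q by blast
  qed (use fst in simp_all)
qed

lemma guess_accepts: "{x. accepts (guess_machine v) \<O> x} = {x. \<exists>y. length y = length x \<and> v @ y \<in> \<O>}"
proof (intro set_eqI iffI; unfold mem_Collect_eq)
  fix x :: word assume "accepts (guess_machine v) \<O> x"
  then show "\<exists>y. length y = length x \<and> v @ y \<in> \<O>" unfolding accepts_def by (metis guess_last)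
next
  fix x :: word assume "\<exists>y. length y = length x \<and> v @ y \<in> \<O>"
  then obtain y where "length y = length x" "v @ y \<in> \<O>" by blast
  from stream_reach_path[OF guess_reach[OF this]]
  obtain cs where cs: "path (guess_machine v) \<O> x cs" "last cs = stream_conf x (1, length x, v @ y, [], None)"
    by blast
  have "halted (guess_machine v) \<O> (last cs)"
    unfolding halted_def cs(2) step_stream by (simp add: guess_trans_def split_paired_all)
  then have "accepting_path (guess_machine v) \<O> x cs"
    using cs by (simp add: accepting_path_def halting_path_def stream_machine_def)
  then show "accepts (guess_machine v) \<O> x" unfolding accepts_def by blast
qed

lemma gen_eq_append: "gen j b y = (False # replicate j True @ [False, b]) @ y"
  by (simp add: gen_def)

lemma witness_lang_NP: "witness_lang \<O> j b \<in> NP \<O>"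
  unfolding NP_def witness_lang_def gen_eq_append
  using guess_wf guess_poly_time guess_accepts by blast

text \<open>Only one word of the relevant length can be answered positively. The last configuration
  of an accepting path is determined by this word, and it determines the path in turn.\<close>

lemma witness_lang_UP:
  assumes "\<And>n. one_at \<O> j n"
  shows "witness_lang \<O> j b \<in> UP \<O>"
proof -
  let ?v = "False # replicate j True @ [False, b]"
  have "cs = cs'" if cs: "accepting_path (guess_machine ?v) \<O> x cs"
    and cs': "accepting_path (guess_machine ?v) \<O> x cs'" for x cs cs'
  proof -
    obtain y where y: "length y = length x" "?v @ y \<in> \<O>" "last cs = stream_conf x (1, length x, ?v @ y, [], None)"
      using guess_last[OF cs] by blast
    obtain y' where y': "length y' = length x" "?v @ y' \<in> \<O>" "last cs' = stream_conf x (1, length x, ?v @ y', [], None)"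
      using guess_last[OF cs'] by blast
    have "(b, y) = (b, y')"
      using assms[of "length x"] y(1,2) y'(1,2) unfolding one_at_def gen_eq_append[symmetric]
      by (metis fst_conv snd_conv)
    then have "last cs = last cs'" using y(3) y'(3) by simp
    moreover have "path (guess_machine ?v) \<O> x cs" "path (guess_machine ?v) \<O> x cs'"
      using cs cs' unfolding accepting_path_def halting_path_def by blast+
    ultimately show ?thesis
      by (intro stream_path_unique[where I = "guess_inv \<O> ?v x" and \<mu> = "guess_rank ?v x"
            and \<delta> = "guess_trans ?v" and s = 3 and \<O> = \<O> and x = x])
        (use guess_inv_init guess_step guess_backward in blast)+
  qed
  then show ?thesis
    unfolding UP_def witness_lang_def gen_eq_append
    using guess_wf[of ?v] guess_poly_time[of ?v \<O>] guess_accepts[of ?v \<O>] by blast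
qed

lemma witness_lang_Compl:
  assumes "\<And>n. one_at \<O> j n"
  shows "- witness_lang \<O> j True = witness_lang \<O> j False"
proof -
  have "x \<notin> witness_lang \<O> j True \<longleftrightarrow> x \<in> witness_lang \<O> j False" for x
  proof -
    obtain c where c: "length (snd c) = length x \<and> gen j (fst c) (snd c) \<in> \<O>"
      and u: "\<And>c'. length (snd c') = length x \<and> gen j (fst c') (snd c') \<in> \<O> \<Longrightarrow> c' = c"
      using assms[of "length x"] unfolding one_at_def by blast
    have "x \<in> witness_lang \<O> j b \<longleftrightarrow> b = fst c" for b
      using c u[of "(b, _)"] unfolding witness_lang_def by force
    then show ?thesis by simp
  qed
  then show ?thesis by blast
qed

subsection \<open>Deterministic streaming machines\<close>

type_synonym next_function = "nat \<Rightarrow> symbol \<Rightarrow> symbol \<Rightarrow> (nat \<times> bool \<times> symbol \<times> symbol \<times> symbol) option"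

fun next_conf :: "next_function \<Rightarrow> word set \<Rightarrow> word \<Rightarrow> stream_config \<Rightarrow> stream_config option" where
  "next_conf nxt \<O> x (q, p, w, z, f) =
     (if q = 0 then Some (if w \<in> \<O> then 1 else 2, p, w, z, f)
      else map_option (\<lambda>(q', mv, b, c, g). (q', p + of_bool mv, append_symbol w b, append_symbol z c, g))
        (nxt q (symbol_at x p) f))"

lemma stream_step_next_conf:
  "stream_step (\<lambda>q a f. set_option (nxt q a f)) \<O> x a a' \<longleftrightarrow> next_conf nxt \<O> x a = Some a'"
proof -
  obtain q p w z f where a: "a = (q, p, w, z, f)" by (metis prod_cases5)
  obtain q' p' w' z' f' where a': "a' = (q', p', w', z', f')" by (metis prod_cases5)
  show ?thesis
  proof (cases "nxt q (symbol_at x p) f")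
    case None
    then show ?thesis by (auto simp: a a')
  next
    case (Some r)
    obtain q1 mv b c g where "r = (q1, mv, b, c, g)" by (metis prod_cases5)
    then show ?thesis using Some by (auto simp: a a')
  qed
qed

lemma next_function_FP:
  assumes "\<And>q a f. N \<le> q \<Longrightarrow> nxt q a f = None"
    and "\<And>x. I x (s, 0, [], [], None)"
    and "\<And>x a a'. I x a \<Longrightarrow> next_conf nxt \<O> x a = Some a' \<Longrightarrow> I x a' \<and> \<mu> x a' < (\<mu> x a :: nat)"
    and "\<And>x. \<mu> x (s, 0, [], [], None) \<le> poly p (length x)"
    and "\<And>x q p w z f. I x (q, p, w, z, f) \<Longrightarrow> next_conf nxt \<O> x (q, p, w, z, f) = None \<Longrightarrow> z = g x"
  shows "g \<in> FP \<O>"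
proof (rule stream_FP[where \<delta> = "\<lambda>q a f. set_option (nxt q a f)" and I = I and \<mu> = \<mu> and N = N])
  show "z = g x" if "I x (q, p, w, z, f)"
    "\<And>a'. \<not> stream_step (\<lambda>q a f. set_option (nxt q a f)) \<O> x (q, p, w, z, f) a'" for x q p w z f
    using assms(5)[OF that(1)] that(2) unfolding stream_step_next_conf by fastforce
qed (use assms(1-4) stream_step_next_conf in auto)

lemma info_simps:
  "info y 0" "info y (2 * a + 1) \<longleftrightarrow> a < length y" "info y (2 * a + 2) \<longleftrightarrow> a < length y \<and> y ! a"
proof -
  show "info y 0" by (simp add: info_def)
  have "2 * a + 1 \<noteq> 2 * a' + 2" "2 * a + 2 \<noteq> 2 * a' + 1" for a' by presburger+
  then show "info y (2 * a + 1) \<longleftrightarrow> a < length y" "info y (2 * a + 2) \<longleftrightarrow> a < length y \<and> y ! a"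
    unfolding info_def by auto
qed

lemma dbl_take_Suc: "p < length x \<Longrightarrow> dbl (take (Suc p) x) = dbl (take p x) @ [False, x ! p]"
  by (simp add: take_Suc_conv_app_nth)

subsection \<open>Reading off the value of a proof\<close>

text \<open>The remembered symbol tells whether the pending query asks for the validity of the proof,
  for the existence of a further output bit, or for its value.\<close>
definition reader_next :: "word \<Rightarrow> word \<Rightarrow> next_function" where
  "reader_next v y q a f =
     (if q = 1 then (case f of None \<Rightarrow> Some (0, False, Some True, None, Some False)
        | Some False \<Rightarrow> Some (0, False, Some True, None, Some True)
        | Some True \<Rightarrow> Some (0, False, Some True, Some True, Some False))
      else if q = 2 then (case f of None \<Rightarrow> Some (7 + length v, False, None, None, None)
        | Some False \<Rightarrow> None
        | Some True \<Rightarrow> Some (0, False, Some True, Some False, Some False))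
      else if q = 3 then (case a of Some b \<Rightarrow> Some (4, False, Some False, None, f)
        | None \<Rightarrow> Some (0, False, None, None, f))
      else if q = 4 then (case a of Some b \<Rightarrow> Some (3, True, Some b, None, f) | None \<Rightarrow> None)
      else if 6 \<le> q \<and> q < 6 + length v then Some (q + 1, False, Some (v ! (q - 6)), None, None)
      else if q = 6 + length v then Some (3, False, None, None, None)
      else if 7 + length v \<le> q \<and> q < 7 + length v + length y then
        Some (q + 1, False, None, Some (y ! (q - 7 - length v)), None)
      else None)"

text \<open>Here h is the word stored about u, and y the output if the codeword is absent. Each
  query is the previous one lengthened by a single \<open>True\<close>, which suits a query tape
  that can only grow; \<open>info\<close> interleaves its bits in this order.\<close>

inductive reader_inv :: "word set \<Rightarrow> word \<Rightarrow> word \<Rightarrow> word \<Rightarrow> word \<Rightarrow> stream_config \<Rightarrow> bool"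
  for \<O> v y h u where
  prefix: "s \<le> length v \<Longrightarrow> q = 6 + s \<Longrightarrow> reader_inv \<O> v y h u (q, 0, take s v, [], None)"
| copy: "p \<le> length u \<Longrightarrow> w = v @ dbl (take p u) \<Longrightarrow> reader_inv \<O> v y h u (3, p, w, [], None)"
| copy_bit: "p < length u \<Longrightarrow> w = v @ dbl (take p u) @ [False] \<Longrightarrow> reader_inv \<O> v y h u (4, p, w, [], None)"
| valid: "w = v @ dbl u \<Longrightarrow> q = 0 \<or> q = (if w \<in> \<O> then 1 else 2) \<Longrightarrow>
    reader_inv \<O> v y h u (q, length u, w, [], None)"
| more: "v @ dbl u \<in> \<O> \<Longrightarrow> a \<le> length h \<Longrightarrow> w = v @ dbl u @ replicate (2 * a + 1) True \<Longrightarrow> z = take a h \<Longrightarrow>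
    q = 0 \<or> q = (if w \<in> \<O> then 1 else 2) \<Longrightarrow> reader_inv \<O> v y h u (q, length u, w, z, Some False)"
| bit: "v @ dbl u \<in> \<O> \<Longrightarrow> a < length h \<Longrightarrow> w = v @ dbl u @ replicate (2 * a + 2) True \<Longrightarrow> z = take a h \<Longrightarrow>
    q = 0 \<or> q = (if w \<in> \<O> then 1 else 2) \<Longrightarrow> reader_inv \<O> v y h u (q, length u, w, z, Some True)"
| default: "v @ dbl u \<notin> \<O> \<Longrightarrow> s \<le> length y \<Longrightarrow> q = 7 + length v + s \<Longrightarrow> z = take s y \<Longrightarrow>
    reader_inv \<O> v y h u (q, length u, v @ dbl u, z, None)"

text \<open>\<open>C\<close> is the rank of the first query. From then on the rank falls as the
  query grows; its length stays below \<open>4 * length u + length v + 3\<close>, because the stored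
  word is no longer than u.\<close>

fun reader_rank :: "word \<Rightarrow> word \<Rightarrow> word \<Rightarrow> stream_config \<Rightarrow> nat" where
  "reader_rank v y u (q, p, w, z, f) =
     (let C = 2 * (2 * length u + 3) + length y + 3 in
      if q \<le> 2 then 2 * (4 * length u + length v + 3 - length w) + length y + 3 - (if q = 0 then 0 else 1)
      else if q = 3 then 2 * (length u - p) + 1 + C
      else if q = 4 then 2 * (length u - p) + C
      else if q \<le> 6 + length v then 6 + length v - q + 2 * length u + 2 + C
      else 7 + length v + length y - q)"

lemma replicate_snoc: "replicate n x @ [x] = replicate (Suc n) x"
  by (simp add: replicate_append_same)

lemma reader_step:
  assumes h: "v @ dbl u \<in> \<O> \<Longrightarrow> (\<forall>m. v @ dbl u @ replicate m True \<in> \<O> \<longleftrightarrow> info h m) \<and> length h \<le> length u"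
    and "reader_inv \<O> v y h u a" "next_conf (reader_next v y) \<O> u a = Some a'"
  shows "reader_inv \<O> v y h u a' \<and> reader_rank v y u a' < reader_rank v y u a"
  using assms(2)
proof cases
  case (prefix s q)
  show ?thesis
  proof (cases "s < length v")
    case True
    then have "a' = (7 + s, 0, take (Suc s) v, [], None)"
      using assms(3) prefix by (simp add: reader_next_def take_Suc_conv_app_nth)
    then show ?thesis using prefix True reader_inv.prefix[of "Suc s" v "7 + s"] by simp
  next
    case False
    then have "a' = (3, 0, v, [], None)" using assms(3) prefix by (simp add: reader_next_def)
    then show ?thesis using prefix False reader_inv.copy[of 0 u v v] by simp
  qed
next
  case (copy p w)
  show ?thesis
  proof (cases "p < length u")
    case True
    then have "a' = (4, p, w @ [False], [], None)"
      using assms(3) copy by (simp add: reader_next_def symbol_at_def)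
    then show ?thesis using copy True reader_inv.copy_bit[of p u] by simp
  next
    case False
    then have "a' = (0, length u, v @ dbl u, [], None)"
      using assms(3) copy by (simp add: reader_next_def symbol_at_def)
    then show ?thesis using copy False reader_inv.valid[of "v @ dbl u" v u 0] by simp
  qed
next
  case (copy_bit p w)
  then have "a' = (3, Suc p, v @ dbl (take (Suc p) u), [], None)"
    using assms(3) by (simp add: reader_next_def symbol_at_def dbl_take_Suc)
  then show ?thesis using copy_bit reader_inv.copy[of "Suc p" u] by simp
next
  case (valid w q)
  consider "q = 0" | "q = 1" "w \<in> \<O>" | "q = 2" "w \<notin> \<O>" using valid by (auto split: if_splits)
  then show ?thesis
  proof cases
    case 1
    then have "a' = (if w \<in> \<O> then 1 else 2, length u, w, [], None)" using assms(3) valid by simp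
    then show ?thesis using valid 1 reader_inv.valid[of w v u] by simp
  next
    case 2
    then have a': "a' = (0, length u, v @ dbl u @ replicate (2 * 0 + 1) True, take 0 h, Some False)"
      using assms(3) valid by (simp add: reader_next_def)
    have "reader_inv \<O> v y h u a'" unfolding a' by (rule reader_inv.more[where a = 0]) (use valid(2) 2(2) in simp_all)
    then show ?thesis unfolding valid(1,2) 2(1) a' by simp
  next
    case 3
    then have "a' = (7 + length v, length u, v @ dbl u, [], None)"
      using assms(3) valid by (simp add: reader_next_def)
    then show ?thesis using valid 3 reader_inv.default[of v u \<O> 0 y "7 + length v" "[]"] by simp
  qed
next
  case (more a w z q)
  have l: "length h \<le> length u" using h more by blast
  consider "q = 0" | "q = 1" "w \<in> \<O>" | "q = 2" "w \<notin> \<O>" using more by (auto split: if_splits)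
  then show ?thesis
  proof cases
    case 1
    then have "a' = (if w \<in> \<O> then 1 else 2, length u, w, z, Some False)" using assms(3) more by simp
    then show ?thesis using more 1 l reader_inv.more[OF more(2-5), of "if w \<in> \<O> then 1 else 2"] by simp
  next
    case 2
    then have "info h (2 * a + 1)" using h more by blast
    then have "a < length h" using info_simps(2)[of h a] by simp
    have a': "a' = (0, length u, v @ dbl u @ replicate (2 * a + 2) True, z, Some True)"
      using assms(3) unfolding more(1,4) 2(1) by (simp add: reader_next_def replicate_append_same)
    have "reader_inv \<O> v y h u a'" unfolding a'
      by (rule reader_inv.bit[where a = a]) (use more(2,5) \<open>a < length h\<close> in simp_all)
    then show ?thesis using l \<open>a < length h\<close> unfolding more(1,4,5) 2(1) a' by simp
  next
    case 3
    then show ?thesis using assms(3) unfolding more(1) 3(1) by (simp add: reader_next_def)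
  qed
next
  case (bit a w z q)
  have l: "length h \<le> length u" using h bit by blast
  consider "q = 0" | "q = 1" "w \<in> \<O>" | "q = 2" "w \<notin> \<O>" using bit by (auto split: if_splits)
  then show ?thesis
  proof cases
    case 1
    then have "a' = (if w \<in> \<O> then 1 else 2, length u, w, z, Some True)" using assms(3) bit by simp
    then show ?thesis using bit 1 l reader_inv.bit[OF bit(2-5), of "if w \<in> \<O> then 1 else 2"] by simp
  next
    case 2
    then have "info h (2 * a + 2)" using h bit by blast
    then have "h ! a" using info_simps(3)[of h a] by simp
    then have a': "a' = (0, length u, v @ dbl u @ replicate (2 * Suc a + 1) True, take (Suc a) h, Some False)"
      using assms(3) bit(3) unfolding bit(1,4,5) 2(1)
      by (simp add: reader_next_def replicate_append_same take_Suc_conv_app_nth)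
    have "reader_inv \<O> v y h u a'" unfolding a' by (rule reader_inv.more[where a = "Suc a"]) (use bit(2,3) in simp_all)
    then show ?thesis using l bit(3) unfolding bit(1,4,5) 2(1) a' by simp
  next
    case 3
    then have "\<not> info h (2 * a + 2)" using h bit by blast
    then have "\<not> h ! a" using info_simps(3)[of h a] bit by simp
    then have a': "a' = (0, length u, v @ dbl u @ replicate (2 * Suc a + 1) True, take (Suc a) h, Some False)"
      using assms(3) bit(3) unfolding bit(1,4,5) 3(1)
      by (simp add: reader_next_def replicate_append_same take_Suc_conv_app_nth)
    have "reader_inv \<O> v y h u a'" unfolding a' by (rule reader_inv.more[where a = "Suc a"]) (use bit(2,3) in simp_all)
    then show ?thesis using l bit(3) unfolding bit(1,4,5) 3(1) a' by simp
  qed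
next
  case (default s q z)
  have s: "s < length y" using assms(3) default by (simp add: reader_next_def split: if_splits)
  then have "a' = (Suc q, length u, v @ dbl u, take (Suc s) y, None)"
    using assms(3) default by (simp add: reader_next_def take_Suc_conv_app_nth)
  then show ?thesis using default s reader_inv.default[of v u \<O> "Suc s" y "Suc q"] by simp
qed

lemma reader_output:
  assumes h: "v @ dbl u \<in> \<O> \<Longrightarrow> (\<forall>m. v @ dbl u @ replicate m True \<in> \<O> \<longleftrightarrow> info h m) \<and> length h \<le> length u"
    and "reader_inv \<O> v y h u (q, p, w, z, f)" "next_conf (reader_next v y) \<O> u (q, p, w, z, f) = None"
  shows "z = (if v @ dbl u \<in> \<O> then h else y)"
  using assms(2)
proof cases
  case (prefix s)
  then show ?thesis using assms(3) by (simp add: reader_next_def split: if_splits)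
next
  case copy
  then show ?thesis using assms(3) by (simp add: reader_next_def split: if_splits option.splits)
next
  case copy_bit
  then show ?thesis using assms(3) by (simp add: reader_next_def symbol_at_def)
next
  case valid
  then show ?thesis using assms(3) by (auto simp: reader_next_def split: if_splits)
next
  case (more a)
  then have "w \<notin> \<O>" using assms(3) by (auto simp: reader_next_def split: if_splits)
  then have "\<not> info h (2 * a + 1)" using h more by blast
  then show ?thesis using more info_simps(2)[of h a] by simp
next
  case bit
  then show ?thesis using assms(3) by (auto simp: reader_next_def split: if_splits)
next
  case (default s)
  then show ?thesis using assms(3) by (auto simp: reader_next_def split: if_splits)
qed

lemma reader_FP:
  assumes "\<And>u. v @ dbl u \<in> \<O> \<Longrightarrow>
    (\<forall>m. v @ dbl u @ replicate m True \<in> \<O> \<longleftrightarrow> info (h u) m) \<and> length (h u) \<le> length u"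
  shows "(\<lambda>u. if v @ dbl u \<in> \<O> then h u else y) \<in> FP \<O>"
proof (rule next_function_FP[where nxt = "reader_next v y" and N = "7 + length v + length y"
      and I = "\<lambda>u. reader_inv \<O> v y (h u) u" and \<mu> = "reader_rank v y" and s = 6])
  show "reader_next v y q a f = None" if "7 + length v + length y \<le> q" for q a f
    using that by (simp add: reader_next_def)
  show "reader_inv \<O> v y (h u) u (6, 0, [], [], None)" for u
    using reader_inv.prefix[of 0 v 6] by simp
  show "reader_rank v y u (6, 0, [], [], None) \<le> poly [:length v + length y + 11, 6:] (length u)" for u
    by simp
qed (use reader_step[OF assms] reader_output[OF assms] in blast)+

subsection \<open>Finding a proof by padding\<close>

text \<open>The query and the output grow in parallel, v starting the codeword and v' the proof, so
  the output is right as soon as the oracle answers yes. After a no, one padding symbol is added to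
  both.\<close>

definition prover_next :: "word \<Rightarrow> word \<Rightarrow> next_function" where
  "prover_next v v' q a f =
     (if q = 2 then Some (7 + length v + length v', False, Some False, None, None)
      else if q = 3 then (case a of Some b \<Rightarrow> Some (4, False, Some False, None, None)
        | None \<Rightarrow> Some (5, False, Some False, None, None))
      else if q = 4 then (case a of Some b \<Rightarrow> Some (3, True, Some b, Some b, None) | None \<Rightarrow> None)
      else if q = 5 then Some (0, False, Some False, Some False, None)
      else if 6 \<le> q \<and> q < 6 + length v then Some (q + 1, False, Some (v ! (q - 6)), None, None)
      else if 6 + length v \<le> q \<and> q < 6 + length v + length v' then
        Some (q + 1, False, None, Some (v' ! (q - 6 - length v)), None)
      else if q = 6 + length v + length v' then Some (3, False, None, None, None)
      else if q = 7 + length v + length v' then Some (0, False, Some True, Some True, None)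
      else None)"

inductive prover_inv :: "word set \<Rightarrow> word \<Rightarrow> word \<Rightarrow> nat \<Rightarrow> word \<Rightarrow> stream_config \<Rightarrow> bool"
  for \<O> v v' m x where
  prefix: "s < length v \<Longrightarrow> q = 6 + s \<Longrightarrow> prover_inv \<O> v v' m x (q, 0, take s v, [], None)"
| prefix': "s \<le> length v' \<Longrightarrow> q = 6 + length v + s \<Longrightarrow> z = take s v' \<Longrightarrow> prover_inv \<O> v v' m x (q, 0, v, z, None)"
| copy: "p \<le> length x \<Longrightarrow> w = v @ dbl (take p x) \<Longrightarrow> z = v' @ take p x \<Longrightarrow> prover_inv \<O> v v' m x (3, p, w, z, None)"
| copy_bit: "p < length x \<Longrightarrow> w = v @ dbl (take p x) @ [False] \<Longrightarrow> z = v' @ take p x \<Longrightarrow>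
    prover_inv \<O> v v' m x (4, p, w, z, None)"
| separate: "prover_inv \<O> v v' m x (5, length x, v @ dbl x @ [False], v' @ x, None)"
| ask: "t \<le> m \<Longrightarrow> w = v @ dbl (x @ False # replicate t True) \<Longrightarrow> z = v' @ x @ False # replicate t True \<Longrightarrow>
    prover_inv \<O> v v' m x (0, length x, w, z, None)"
| found: "prover_inv \<O> v v' m x (1, length x, w, v' @ x @ False # replicate m True, None)"
| pad: "t < m \<Longrightarrow> w = v @ dbl (x @ False # replicate t True) \<Longrightarrow> z = v' @ x @ False # replicate t True \<Longrightarrow>
    prover_inv \<O> v v' m x (2, length x, w, z, None)"
| pad_bit: "t < m \<Longrightarrow> w = v @ dbl (x @ False # replicate t True) @ [False] \<Longrightarrow> z = v' @ x @ False # replicate t True \<Longrightarrow>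
    q = 7 + length v + length v' \<Longrightarrow> prover_inv \<O> v v' m x (q, length x, w, z, None)"

text \<open>The current amount t of padding is read off the output. Each further symbol takes a
  round of three steps, for which 4 units are set aside.\<close>

fun prover_rank :: "word \<Rightarrow> word \<Rightarrow> nat \<Rightarrow> word \<Rightarrow> stream_config \<Rightarrow> nat" where
  "prover_rank v v' m x (q, p, w, z, f) =
     (let t = length z - (length v' + length x + 1) in
      if q = 0 then 4 * (m - t) + 3
      else if q = 1 then 0
      else if q = 2 then 4 * (m - t) + 2
      else if q = 3 then 2 * (length x - p) + 4 * m + 6
      else if q = 4 then 2 * (length x - p) + 4 * m + 5
      else if q = 5 then 4 * m + 4
      else if q \<le> 6 + length v + length v' then 6 + length v + length v' - q + 2 * length x + 4 * m + 7
      else 4 * (m - t) + 1)"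

lemma dbl_replicate_snoc: "dbl (replicate t True) @ [False, True] = dbl (replicate (Suc t) True)"
proof -
  have "dbl (replicate t True) @ [False, True] = dbl (replicate t True @ [True])" by (simp only: dbl_simps append.simps)
  then show ?thesis by (simp only: replicate_snoc)
qed

lemma prover_step:
  assumes m: "v @ dbl (x @ False # replicate m True) \<in> \<O>"
    and least: "\<And>t. t < m \<Longrightarrow> v @ dbl (x @ False # replicate t True) \<notin> \<O>"
    and "prover_inv \<O> v v' m x a" "next_conf (prover_next v v') \<O> x a = Some a'"
  shows "prover_inv \<O> v v' m x a' \<and> prover_rank v v' m x a' < prover_rank v v' m x a"
  using assms(3)
proof cases
  case (prefix s q)
  have a': "a' = (7 + s, 0, take (Suc s) v, [], None)"
    using assms(4) prefix by (simp add: prover_next_def take_Suc_conv_app_nth)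
  have "prover_inv \<O> v v' m x a'"
  proof (cases "Suc s < length v")
    case True
    then show ?thesis unfolding a' by (intro prover_inv.prefix) auto
  next
    case False
    then have "Suc s = length v" using prefix by simp
    then show ?thesis using prover_inv.prefix'[of 0 v' "7 + s" v "[]"] unfolding a' by simp
  qed
  then show ?thesis using prefix a' by simp
next
  case (prefix' s q z)
  show ?thesis
  proof (cases "s < length v'")
    case True
    then have "a' = (Suc q, 0, v, take (Suc s) v', None)"
      using assms(4) prefix' by (simp add: prover_next_def take_Suc_conv_app_nth)
    then show ?thesis using prefix' True prover_inv.prefix'[of "Suc s" v' "Suc q" v] by simp
  next
    case False
    then have "a' = (3, 0, v, v', None)" using assms(4) prefix' by (simp add: prover_next_def)
    then show ?thesis using prefix' False prover_inv.copy[of 0 x v v v'] by simp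
  qed
next
  case (copy p w z)
  show ?thesis
  proof (cases "p < length x")
    case True
    then have "a' = (4, p, w @ [False], z, None)"
      using assms(4) copy by (simp add: prover_next_def symbol_at_def)
    then show ?thesis using copy True prover_inv.copy_bit[of p x] by simp
  next
    case False
    then have "a' = (5, length x, v @ dbl x @ [False], v' @ x, None)"
      using assms(4) copy by (simp add: prover_next_def symbol_at_def)
    then show ?thesis using copy False prover_inv.separate by simp
  qed
next
  case (copy_bit p w z)
  then have "a' = (3, Suc p, v @ dbl (take (Suc p) x), v' @ take (Suc p) x, None)"
    using assms(4) by (simp add: prover_next_def symbol_at_def dbl_take_Suc take_Suc_conv_app_nth)
  then show ?thesis using copy_bit prover_inv.copy[of "Suc p" x] by simp
next
  case separate
  then have "a' = (0, length x, v @ dbl (x @ False # replicate 0 True), v' @ x @ False # replicate 0 True, None)"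
    using assms(4) by (simp add: prover_next_def)
  then show ?thesis using separate prover_inv.ask[of 0 m _ v x] by simp
next
  case (ask t w z)
  show ?thesis
  proof (cases "t < m")
    case True
    then have "a' = (2, length x, w, z, None)" using assms(4) ask least by simp
    then show ?thesis using ask True prover_inv.pad[of t m] by simp
  next
    case False
    then have "a' = (1, length x, w, z, None)" "t = m" using assms(4) ask m by auto
    then show ?thesis using ask prover_inv.found by simp
  qed
next
  case (found w)
  then show ?thesis using assms(4) by (simp add: prover_next_def)
next
  case (pad t w z)
  then have "a' = (7 + length v + length v', length x, w @ [False], z, None)"
    using assms(4) by (simp add: prover_next_def)
  then show ?thesis using pad prover_inv.pad_bit[of t m] by simp
next
  case (pad_bit t w z q)
  then have a': "a' = (0, length x, v @ dbl (x @ False # replicate (Suc t) True), v' @ x @ False # replicate (Suc t) True, None)"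
    using assms(4) dbl_replicate_snoc[of t] by (simp add: prover_next_def replicate_append_same)
  show ?thesis unfolding a' using pad_bit by (auto intro: prover_inv.ask[of "Suc t"])
qed

lemma prover_FP:
  assumes "\<And>x. \<exists>t \<le> poly p (length x). v @ dbl (x @ False # replicate t True) \<in> \<O>"
  shows "(\<lambda>x. v' @ x @ False # replicate (LEAST t. v @ dbl (x @ False # replicate t True) \<in> \<O>) True) \<in> FP \<O>"
proof -
  define m where "m x = (LEAST t. v @ dbl (x @ False # replicate t True) \<in> \<O>)" for x
  have m: "v @ dbl (x @ False # replicate (m x) True) \<in> \<O>" "m x \<le> poly p (length x)" for x
  proof -
    obtain t where t: "t \<le> poly p (length x)" "v @ dbl (x @ False # replicate t True) \<in> \<O>"
      using assms by blast
    show "v @ dbl (x @ False # replicate (m x) True) \<in> \<O>" unfolding m_def using t(2) by (rule LeastI)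
    have "m x \<le> t" unfolding m_def using t(2) by (rule Least_le)
    then show "m x \<le> poly p (length x)" using t(1) by simp
  qed
  have least: "v @ dbl (x @ False # replicate t True) \<notin> \<O>" if "t < m x" for x t
    using that not_less_Least unfolding m_def by blast
  have "(\<lambda>x. v' @ x @ False # replicate (m x) True) \<in> FP \<O>"
  proof (rule next_function_FP[where nxt = "prover_next v v'" and N = "8 + length v + length v'"
        and I = "\<lambda>x. prover_inv \<O> v v' (m x) x" and \<mu> = "\<lambda>x. prover_rank v v' (m x) x" and s = 6])
    show "prover_next v v' q a f = None" if "8 + length v + length v' \<le> q" for q a f
      using that by (simp add: prover_next_def)
    show "prover_inv \<O> v v' (m x) x (6, 0, [], [], None)" for x
      using prover_inv.prefix[of 0 v 6] prover_inv.prefix'[of 0 v' 6 v "[]"] by (cases v) auto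
    show "prover_rank v v' (m x) x (6, 0, [], [], None) \<le>
        poly ([:length v + length v' + 7, 2:] + smult 4 p) (length x)" for x
      using m(2)[of x] by simp
    show "prover_inv \<O> v v' (m x) x a' \<and> prover_rank v v' (m x) x a' < prover_rank v v' (m x) x a"
      if "prover_inv \<O> v v' (m x) x a" "next_conf (prover_next v v') \<O> x a = Some a'" for x a a'
      using prover_step[OF m(1) least that] .
    show "z = v' @ x @ False # replicate (m x) True"
      if "prover_inv \<O> v v' (m x) x (q, p, w, z, f)" "next_conf (prover_next v v') \<O> x (q, p, w, z, f) = None"
      for x q p w z f
      using that(1) by cases (use that(2) in \<open>auto simp: prover_next_def symbol_at_def split: if_splits option.splits\<close>)
  qed
  then show ?thesis unfolding m_def .
qed

section \<open>The oracle separation\<close>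

lemma poly_time_nmach:
  assumes "otm_wf M" "poly_time M \<O>"
  obtains k where "\<And>y cs. acc k \<O> y cs \<longleftrightarrow> accepting_path M \<O> y cs" "nlang k \<O> = {y. accepts M \<O> y}"
proof -
  obtain p where p: "\<And>x cs. path M \<O> x cs \<Longrightarrow> length cs - 1 \<le> poly p (length x)"
    using assms(2) unfolding poly_time_def by blast
  obtain c where c: "\<And>n. poly p n \<le> (n + 2) ^ c" using poly_le_power by blast
  obtain k where k: "nmach k = M" "nclock k = (\<lambda>n. (n + 2) ^ c)" using ex_nmach[OF assms(1)] .
  have "length cs \<le> nclock k (length y) + 1" if "accepting_path M \<O> y cs" for y cs
    using p[of y cs] c[of "length y"] that k(2) by (auto simp: accepting_path_def halting_path_def)
  then have acc: "acc k \<O> y cs \<longleftrightarrow> accepting_path M \<O> y cs" for y cs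
    unfolding acc_def k(1) by blast
  then have "nlang k \<O> = {y. accepts M \<O> y}" unfolding nlang_def accepts_def by blast
  then show ?thesis using that acc by blast
qed

lemma NP_nlang:
  assumes "L \<in> NP \<O>"
  shows "\<exists>k. nlang k \<O> = L"
proof -
  obtain M where "otm_wf M" "poly_time M \<O>" and L: "L = {x. accepts M \<O> x}"
    using assms unfolding NP_def by blast
  then obtain k where "nlang k \<O> = {y. accepts M \<O> y}" using poly_time_nmach by metis
  then show ?thesis using L by blast
qed

lemma FP_fval:
  assumes "f \<in> FP \<O>"
  obtains i where "\<And>x y. fval i \<O> x y \<longleftrightarrow> y = f x"
proof -
  obtain M p where M: "otm_wf M" "deterministic M" "computes M \<O> f"
    and p: "\<And>x cs. path M \<O> x cs \<Longrightarrow> length cs - 1 \<le> poly p (length x)"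
    using assms unfolding FP_def poly_time_def by blast
  obtain c where c: "\<And>n. poly p n \<le> (n + 2) ^ c" using poly_le_power by blast
  obtain i where i: "fmach i = M" "fclock i = (\<lambda>n. (n + 2) ^ c)" using ex_fmach[OF M(1,2)] .
  have "fval i \<O> x (f x)" for x
  proof -
    obtain cs where cs: "halting_path M \<O> x cs" "tape_word (snd (last cs) ! 2) = f x"
      using M(3) unfolding computes_def by blast
    then have "length cs \<le> fclock i (length x) + 1"
      using p[of x cs] c[of "length x"] i(2) by (auto simp: halting_path_def)
    then show ?thesis using cs i(1) unfolding fval_def by blast
  qed
  then show ?thesis using that fval_unique by blast
qed

section \<open>The optimal proof system\<close>

definition proof_value :: "word set \<Rightarrow> nat \<Rightarrow> word \<Rightarrow> word" where
  "proof_value \<O> k u = (THE y. proves \<O> k u y)"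

text \<open>The default y will be a member of the language, so words without a codeword do not
  enlarge the range.\<close>

definition proof_system :: "word set \<Rightarrow> nat \<Rightarrow> word \<Rightarrow> word \<Rightarrow> word" where
  "proof_system \<O> k y u = (if code k u 0 \<in> \<O> then proof_value \<O> k u else y)"

lemma proof_value_eq: "proves \<O> k u y \<Longrightarrow> proof_value \<O> k u = y"
  unfolding proof_value_def using proves_unique by blast

lemma code_eq_append: "code k u m = (True # replicate k True @ [False]) @ dbl u @ replicate m True"
  by (simp add: code_def)

lemma proof_system_FP:
  assumes "\<And>u. valid_at {} \<O> k u"
  shows "proof_system \<O> k y \<in> FP \<O>"
proof -
  let ?v = "True # replicate k True @ [False]"
  have "(\<forall>m. ?v @ dbl u @ replicate m True \<in> \<O> \<longleftrightarrow> info (proof_value \<O> k u) m) \<and>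
      length (proof_value \<O> k u) \<le> length u" if "?v @ dbl u \<in> \<O>" for u
  proof -
    have c: "code k u 0 \<in> \<O>" using that by (simp add: code_eq_append)
    then obtain z where z: "proves \<O> k u z" using assms[of u] unfolding valid_at_def by blast
    then have "code k u m \<in> \<O> \<longleftrightarrow> info z m" for m
      using assms[of u] c proves_unique[OF z] unfolding valid_at_def by blast
    then show ?thesis using proof_value_eq[OF z] proves_length[OF z] unfolding code_eq_append by simp
  qed
  from reader_FP[of ?v \<O> "proof_value \<O> k" y, OF this] show ?thesis
    unfolding proof_system_def code_eq_append by simp
qed

text \<open>Soundness of codewords gives one inclusion. For the other, a certificate listing the
  answers along an accepting path is governed without any promise, so its codeword is
  present.\<close>

lemma range_proof_system:
  assumes "\<And>u. valid_at {} \<O> k u" "y0 \<in> nlang k \<O>"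
  shows "range (proof_system \<O> k y0) = nlang k \<O>"
proof (intro set_eqI iffI)
  fix y assume "y \<in> range (proof_system \<O> k y0)"
  then obtain u where u: "y = proof_system \<O> k y0 u" by blast
  show "y \<in> nlang k \<O>"
  proof (cases "code k u 0 \<in> \<O>")
    case True
    then obtain z where z: "proves \<O> k u z" "z \<in> nlang k \<O>" using assms(1)[of u] unfolding valid_at_def by blast
    then show ?thesis using True proof_value_eq[OF z(1)] u by (simp add: proof_system_def)
  qed (use u assms(2) in \<open>simp add: proof_system_def\<close>)
next
  fix y assume "y \<in> nlang k \<O>"
  then obtain cs where cs: "acc k \<O> y cs" by (auto simp: nlang_def)
  let ?Q = "queries (nmach k) cs"
  obtain Q where Q: "set Q = ?Q" using finite_list[OF finite_queries] by blast
  obtain P where P: "set P = \<O> \<inter> ?Q" using finite_list[of "\<O> \<inter> ?Q"] finite_queries by blast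
  \<comment> \<open>The last component makes the proof long enough for both length conditions of
    \<open>certificate\<close>.\<close>
  let ?u = "cproof y Q P (weight ?Q + length y)"
  have "?Q \<inter> \<O> = ?Q \<inter> set P" using P by blast
  then have "acc k (set P) y cs" using acc_cong cs by blast
  moreover have "weight ?Q + length y < length ?u" by (rule length_cproof)
  ultimately have "certificate k y (set Q) (set P) (length ?u)" unfolding certificate_def Q by auto
  then have pr: "proves \<O> k ?u y" using P Q by (simp add: proves_simps)
  moreover have "governed {} k ?u" unfolding governed_def by blast
  ultimately have "code k ?u 0 \<in> \<O>" using assms(1)[of ?u] unfolding valid_at_def by blast
  then have "proof_system \<O> k y0 ?u = y" using proof_value_eq[OF pr] by (simp add: proof_system_def)
  then show "y \<in> range (proof_system \<O> k y0)" by (metis rangeI)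
qed

lemma fproof_eq_append: "fproof i x t = (True # replicate i True @ [False]) @ x @ False # replicate t True"
  by (simp add: fproof_def)

lemma threshold_poly: "\<exists>p. threshold k i = poly p"
proof -
  obtain pf pk where p: "fclock i = poly pf" "nclock k = poly pk" using fclock_poly nclock_poly by metis
  have "threshold k i = poly ((pf + 1)\<^sup>2 + (pcompose pk pf + 1)\<^sup>2)"
    by (rule ext) (simp add: threshold_def p poly_pcompose)
  then show ?thesis by blast
qed

text \<open>The simulation searches for the least padding whose codeword is present. This padding is
  polynomial, since all codewords of the function are present once the padding reaches both
  \<open>threshold\<close> and m.\<close>

lemma proof_system_simulates:
  assumes "\<And>u. valid_at {} \<O> k u" "proof_complete \<O> k i m" "\<And>x y. fval i \<O> x y \<longleftrightarrow> y = f x"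
  shows "P_simulated \<O> f (proof_system \<O> k y)"
proof -
  define l where "l x = (LEAST t. code k (fproof i x t) 0 \<in> \<O>)" for x
  obtain p where p: "threshold k i = poly p" using threshold_poly by blast
  let ?p = "p + [:m:]"
  have ex: "code k (fproof i x (poly ?p (length x))) 0 \<in> \<O>" for x
    using assms(2,3) unfolding proof_complete_def by (simp add: p)
  then have l: "code k (fproof i x (l x)) 0 \<in> \<O>" "l x \<le> poly ?p (length x)" for x
    unfolding l_def using LeastI Least_le by metis+
  let ?v' = "True # replicate i True @ [False]"
  \<comment> \<open>As \<open>dbl\<close> distributes over append, the encoded index i belongs to
    the constant prefix of the query.\<close>
  let ?v = "(True # replicate k True @ [False]) @ dbl ?v'"
  have code: "?v @ dbl (x @ False # replicate t True) = code k (fproof i x t) 0" for x t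
    by (simp add: code_eq_append fproof_eq_append)
  have "(\<lambda>x. ?v' @ x @ False # replicate (LEAST t. ?v @ dbl (x @ False # replicate t True) \<in> \<O>) True) \<in> FP \<O>"
    by (rule prover_FP[of ?p]) (use ex code in \<open>metis order_refl\<close>)
  then have "(\<lambda>x. fproof i x (l x)) \<in> FP \<O>" unfolding code l_def fproof_eq_append .
  moreover have "length (fproof i x (l x)) \<le> poly (?p + [:i + 3, 1:]) (length x)" for x
    using l(2)[of x] by (simp add: length_fproof)
  moreover have "proof_system \<O> k y (fproof i x (l x)) = f x" for x
  proof -
    obtain z where z: "proves \<O> k (fproof i x (l x)) z"
      using assms(1) l(1) unfolding valid_at_def by blast
    then have "z = f x" using assms(3) by (simp add: proves_simps)
    then show ?thesis using l(1) proof_value_eq[OF z] by (simp add: proof_system_def)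
  qed
  ultimately show ?thesis
    unfolding P_simulated_def by (intro bexI[of _ "\<lambda>x. fproof i x (l x)"] exI allI conjI)
qed

theorem theorem3p2:
  "\<exists>\<O> :: word set.
     (\<nexists>A B. disjoint_NP_pair \<O> A B \<and> pair_hard_for \<O> (A, B) (NP \<O> \<inter> coNP \<O>)) \<and>
     (\<forall>L \<in> NP \<O>. L \<noteq> {} \<longrightarrow> has_P_optimal_proof_system \<O> L) \<and>
     (\<nexists>C. UP_complete \<O> C)"
proof -
  obtain \<O> where valid: "\<And>k u. valid_at {} \<O> k u"
    and complete: "\<And>k i. (\<And>x y. fval i \<O> x y \<Longrightarrow> y \<in> nlang k \<O>) \<Longrightarrow> \<exists>m. proof_complete \<O> k i m"
    and pairs: "\<And>a b. \<not> collision (a, b, False) \<O> \<Longrightarrow> \<exists>j. separating_tag \<O> (a, b, False) j"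
    and unambiguous: "\<And>a. \<not> collision (a, a, True) \<O> \<Longrightarrow> \<exists>j. separating_tag \<O> (a, a, True) j"
    by (rule generic_oracle) (rule that; blast)
  have "\<not> pair_hard_for \<O> (A, B) (NP \<O> \<inter> coNP \<O>)" if AB: "disjoint_NP_pair \<O> A B" for A B
  proof
    assume hard: "pair_hard_for \<O> (A, B) (NP \<O> \<inter> coNP \<O>)"
    obtain a b where ab: "nlang a \<O> = A" "nlang b \<O> = B"
      using AB NP_nlang unfolding disjoint_NP_pair_def by metis
    then have "\<not> collision (a, b, False) \<O>"
      using AB unfolding disjoint_NP_pair_def collision_def nlang_def by auto
    then obtain j where j: "separating_tag \<O> (a, b, False) j" using pairs by blast
    then have one: "\<And>n. one_at \<O> j n" unfolding separating_tag_def by blast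
    let ?L = "witness_lang \<O> j True"
    \<comment> \<open>Exactly one generic word per length exists, so the opposite bit describes the
      complement, again an NP set.\<close>
    have "?L = - witness_lang \<O> j False" using witness_lang_Compl[OF one] by blast
    then have "?L \<in> NP \<O> \<inter> coNP \<O>" using witness_lang_NP unfolding coNP_def by blast
    then have "\<exists>f \<in> FP \<O>. f ` ?L \<subseteq> A \<and> f ` (- ?L) \<subseteq> B"
      using hard unfolding pair_hard_for_def case_prod_conv by blast
    then obtain f where f: "f \<in> FP \<O>" "f ` ?L \<subseteq> A" "f ` (- ?L) \<subseteq> B" by blast
    obtain i where i: "\<And>x y. fval i \<O> x y \<longleftrightarrow> y = f x" using FP_fval[OF f(1)] by blast
    obtain x where "\<not> reduces_at (a, b, False) \<O> j x (f x)"
      using j i unfolding separating_tag_def by metis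
    then show False using f(2,3) ab by (auto split: if_splits)
  qed
  moreover have "has_P_optimal_proof_system \<O> L" if L: "L \<in> NP \<O>" "L \<noteq> {}" for L
  proof -
    obtain k where k: "nlang k \<O> = L" using NP_nlang[OF L(1)] by blast
    obtain y where y: "y \<in> nlang k \<O>" using L(2) k by blast
    let ?g = "proof_system \<O> k y"
    have g: "?g \<in> FP \<O>" "range ?g = L"
      using proof_system_FP[OF valid] range_proof_system[OF valid y] k by auto
    have "P_simulated \<O> f ?g" if f: "f \<in> FP \<O>" "range f = range ?g" for f
    proof -
      obtain i where i: "\<And>x y. fval i \<O> x y \<longleftrightarrow> y = f x" using FP_fval[OF f(1)] by blast
      have "f x \<in> nlang k \<O>" for x using f(2) g(2) k by blast
      then have "\<exists>m. proof_complete \<O> k i m" using i by (intro complete) simp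
      then obtain m where m: "proof_complete \<O> k i m" by blast
      show ?thesis by (rule proof_system_simulates[OF valid m i])
    qed
    then show ?thesis
      using g unfolding has_P_optimal_proof_system_def proof_system_for_def P_optimal_def by blast
  qed
  moreover have "\<not> UP_complete \<O> C" for C
  proof
    assume C: "UP_complete \<O> C"
    then obtain M where M: "otm_wf M" "poly_time M \<O>" "C = {x. accepts M \<O> x}"
      and unique: "\<And>x cs cs'. accepting_path M \<O> x cs \<Longrightarrow> accepting_path M \<O> x cs' \<Longrightarrow> cs = cs'"
      unfolding UP_complete_def UP_def by blast
    obtain a where a: "\<And>y cs. acc a \<O> y cs \<longleftrightarrow> accepting_path M \<O> y cs" "nlang a \<O> = C"
      using poly_time_nmach[OF M(1,2)] M(3) by metis
    have "\<not> collision (a, a, True) \<O>" using unique a(1) unfolding collision_def by auto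
    then obtain j where j: "separating_tag \<O> (a, a, True) j" using unambiguous by blast
    then have "witness_lang \<O> j True \<in> UP \<O>" unfolding separating_tag_def by (intro witness_lang_UP) blast
    then obtain f where f: "f \<in> FP \<O>" "\<And>x. x \<in> witness_lang \<O> j True \<longleftrightarrow> f x \<in> C"
      using C unfolding UP_complete_def many_one_reducible_def by blast
    obtain i where i: "\<And>x y. fval i \<O> x y \<longleftrightarrow> y = f x" using FP_fval[OF f(1)] by blast
    obtain x where "\<not> reduces_at (a, a, True) \<O> j x (f x)"
      using j i unfolding separating_tag_def by metis
    then show False using f(2) a(2) by (auto split: if_splits)
  qed
  ultimately show ?thesis by blast
qed

end
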